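(* For each $n\ge1$, let $p=p_n\ge2$ be an integer (allowed to increase with $n$) and let $Z_1,\dots,Z_n$ be independent centered random vectors in $\mathbb{R}^p$, $Z_i=(Z_{i1},\dots,Z_{ip})^T$, each with finite covariance matrix $\mathrm{E}[Z_iZ_i^T]$ (the vectors and their distributions may depend on $n$). Let $T_n=(T_{n,1},\dots,T_{n,p})^T\sim N\left(0,n^{-1}\sum_{i=1}^n\mathrm{E}[Z_iZ_i^T]\right)$. Let $\eta_1,\dots,\eta_n$ be independent standard Gaussian random variables independent of $Z_1^n:=\{Z_1,\dots,Z_n\}$, and let $S_n^\eta=(S_{n,1}^\eta,\dots,S_{n,p}^\eta)^T:=n^{-1/2}\sum_{i=1}^n\eta_iZ_i$. Suppose that there are constants $0<c_1<C_1$ (not depending on $n$) such that $c_1\le n^{-1}\sum_{i=1}^n\mathrm{E}[Z_{ij}^2]\le C_1$ for all $1\le j\le p$. Moreover, suppose that $$\hat\Delta:=\max_{1\le j,k\le p}\left|n^{-1}\sum_{i=1}^n\left(Z_{ij}Z_{ik}-\mathrm{E}[Z_{ij}Z_{ik}]\right)\right|$$ obeys, as $n\to\infty$, $$\hat\Delta\left(\mathrm{E}\left[\max_{1\le j\le p}T_{n,j}\right]\right)^2\log p=o_{\mathrm{P}}(1)\quad\text{and}\quad\hat\Delta(\log p)(1\vee\log\log p)=o_{\mathrm{P}}(1).$$ Then $$\sup_{x\in\mathbb{R}}\left|\mathrm{P}\left(\max_{1\le j\le p}S_{n,j}^\eta\le x\;\middle|\;Z_1^n\right)-\mathrm{P}\left(\max_{1\le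 j\le p}T_{n,j}\le x\right)\right|\to0\quad\text{in probability, as }n\to\infty.$$
   Context: $a\vee b:=\max\{a,b\}$. $o_{\mathrm{P}}(1)$ denotes a sequence of random variables converging to $0$ in probability as $n\to\infty$. Conditionally on $Z_1^n$, $S_n^\eta$ has the distribution $N(0,n^{-1}\sum_{i=1}^nZ_iZ_i^T)$, and the conditional probability is understood with respect to this conditional law. *)

theory Defs
  imports "HOL-Probability.Probability"
begin

text \<open>Vectors of dimension \<open>p\<close> are functions in \<open>{1..p} \<rightarrow>\<^sub>E \<real>\<close>, since the dimension
  varies with the sample size inside the theorem.\<close>

abbreviation real_vec :: "nat \<Rightarrow> (nat \<Rightarrow> real) measure" where
  "real_vec p \<equiv> PiM {1..p} (\<lambda>_. borel)"

definition vec_max :: "nat \<Rightarrow> (nat \<Rightarrow> real) \<Rightarrow> real" where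
  "vec_max p y = (MAX j\<in>{1..p}. y j)"

definition centered_normal :: "real \<Rightarrow> real measure" where
  "centered_normal v = (if v = 0 then return borel 0 else density lborel (normal_density 0 (sqrt v)))"

text \<open>\<open>\<mu>\<close> is the law \<open>N(0, \<Sigma>)\<close>: every linear form \<open>a\<^sup>T y\<close> has law \<open>N(0, a\<^sup>T \<Sigma> a)\<close>.
  The matrix \<open>\<Sigma>\<close> may be singular.\<close>

definition centered_gaussian :: "nat \<Rightarrow> (nat \<Rightarrow> nat \<Rightarrow> real) \<Rightarrow> (nat \<Rightarrow> real) measure \<Rightarrow> bool" where
  "centered_gaussian p \<Sigma> \<mu> \<longleftrightarrow>
     sets \<mu> = sets (real_vec p) \<and>
     (\<forall>j\<in>{1..p}. \<forall>k\<in>{1..p}. \<Sigma> j k = \<Sigma> k j) \<and>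
     (\<forall>a. let v = (\<Sum>j=1..p. \<Sum>k=1..p. a j * \<Sigma> j k * a k)
          in 0 \<le> v \<and> distr \<mu> borel (\<lambda>y. \<Sum>j=1..p. a j * y j) = centered_normal v)"

definition average_cov ::
    "'a measure \<Rightarrow> nat \<Rightarrow> (nat \<Rightarrow> 'a \<Rightarrow> nat \<Rightarrow> real) \<Rightarrow> nat \<Rightarrow> nat \<Rightarrow> real" where
  "average_cov M n Z j k = (1 / real n) * (\<Sum>i=1..n. integral\<^sup>L M (\<lambda>\<omega>. Z i \<omega> j * Z i \<omega> k))"

definition Delta_hat ::
    "'a measure \<Rightarrow> nat \<Rightarrow> nat \<Rightarrow> (nat \<Rightarrow> 'a \<Rightarrow> nat \<Rightarrow> real) \<Rightarrow> 'a \<Rightarrow> real" where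
  "Delta_hat M n p Z \<omega> =
     (MAX (j, k)\<in>{1..p} \<times> {1..p}.
        \<bar>(1 / real n) * (\<Sum>i=1..n. Z i \<omega> j * Z i \<omega> k - integral\<^sup>L M (\<lambda>\<omega>. Z i \<omega> j * Z i \<omega> k))\<bar>)"

definition multiplier_sum :: "nat \<Rightarrow> nat \<Rightarrow> (nat \<Rightarrow> nat \<Rightarrow> real) \<Rightarrow> (nat \<Rightarrow> real) \<Rightarrow> nat \<Rightarrow> real" where
  "multiplier_sum n p z e = (\<lambda>j\<in>{1..p}. (1 / sqrt (real n)) * (\<Sum>i=1..n. e i * z i j))"

text \<open>The laws live on spaces \<open>M n\<close> that may change with \<open>n\<close>; the index \<open>n = 0\<close> is unconstrained.\<close>

definition tendsto_0_in_prob :: "(nat \<Rightarrow> 'a measure) \<Rightarrow> (nat \<Rightarrow> 'a \<Rightarrow> real) \<Rightarrow> bool" where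
  "tendsto_0_in_prob M X \<longleftrightarrow>
     (\<forall>n\<ge>1. X n \<in> borel_measurable (M n)) \<and>
     (\<forall>\<epsilon>>0. (\<lambda>n. measure (M n) {\<omega> \<in> space (M n). \<bar>X n \<omega>\<bar> > \<epsilon>}) \<longlonglongrightarrow> 0)"

definition regular_cond_distr ::
    "'a measure \<Rightarrow> 'a measure \<Rightarrow> 'b measure \<Rightarrow> ('a \<Rightarrow> 'b) \<Rightarrow> ('a \<Rightarrow> 'b measure) \<Rightarrow> bool" where
  "regular_cond_distr M F N X \<kappa> \<longleftrightarrow>
     \<kappa> \<in> F \<rightarrow>\<^sub>M prob_algebra N \<and>
     (\<forall>A\<in>sets N. AE \<omega> in M. measure (\<kappa> \<omega>) A = real_cond_exp M F (indicator (X -` A \<inter> space M)) \<omega>)"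

text \<open>The \<open>\<sigma>\<close>-algebra generated by the \<open>N\<close>-valued random variables \<open>X 1, \<dots>, X n\<close>.\<close>

abbreviation generated_algebra ::
    "'a measure \<Rightarrow> nat \<Rightarrow> 'b measure \<Rightarrow> (nat \<Rightarrow> 'a \<Rightarrow> 'b) \<Rightarrow> 'a measure" where
  "generated_algebra M n N X \<equiv>
     vimage_algebra (space M) (\<lambda>\<omega>. \<lambda>i\<in>{1..n}. X i \<omega>) (PiM {1..n} (\<lambda>_. N))"

text \<open>The lemmas below show that regular conditional distributions of the multiplier sum
  exist, that one version is obtained by freezing the data, and that this version
  is \<open>N(0, n\<^sup>-\<^sup>1 \<Sum>\<^sub>i Z\<^sub>i Z\<^sub>i\<^sup>T)\<close>.\<close>

lemma (in prob_space) regular_cond_distr_freeze: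
  assumes X[measurable]: "X \<in> M \<rightarrow>\<^sub>M Mx" and Y[measurable]: "Y \<in> M \<rightarrow>\<^sub>M My"
    and ind: "indep_set (sets (vimage_algebra (space M) X Mx)) (sets (vimage_algebra (space M) Y My))"
    and g[measurable]: "g \<in> Mx \<Otimes>\<^sub>M My \<rightarrow>\<^sub>M N"
  shows "regular_cond_distr M (vimage_algebra (space M) X Mx) N (\<lambda>\<omega>. g (X \<omega>, Y \<omega>))
           (\<lambda>\<omega>. distr M N (\<lambda>\<omega>'. g (X \<omega>, Y \<omega>')))"
proof -
  let ?F = "vimage_algebra (space M) X Mx"
  let ?PX = "distr M Mx X" and ?PY = "distr M My Y"
  interpret PX: prob_space ?PX by (rule prob_space_distr) measurable
  interpret PY: prob_space ?PY by (rule prob_space_distr) measurable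
  interpret P: pair_prob_space ?PX ?PY ..
  have joint: "distr M (Mx \<Otimes>\<^sub>M My) (\<lambda>\<omega>. (X \<omega>, Y \<omega>)) = ?PX \<Otimes>\<^sub>M ?PY"
  proof (rule pair_measure_eqI[symmetric])
    show "sigma_finite_measure ?PX" "sigma_finite_measure ?PY" by unfold_locales
    show "sets (?PX \<Otimes>\<^sub>M ?PY) = sets (distr M (Mx \<Otimes>\<^sub>M My) (\<lambda>\<omega>. (X \<omega>, Y \<omega>)))"
      by simp
    fix A B assume "A \<in> sets ?PX" "B \<in> sets ?PY"
    then have [measurable]: "A \<in> sets Mx" "B \<in> sets My" by auto
    have "prob ((X -` A \<inter> space M) \<inter> (Y -` B \<inter> space M))
        = prob (X -` A \<inter> space M) * prob (Y -` B \<inter> space M)"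
      by (rule indep_setD[OF ind]) (auto intro: in_vimage_algebra)
    moreover have "(\<lambda>\<omega>. (X \<omega>, Y \<omega>)) -` (A \<times> B) \<inter> space M
        = (X -` A \<inter> space M) \<inter> (Y -` B \<inter> space M)" by auto
    ultimately show "emeasure ?PX A * emeasure ?PY B
        = emeasure (distr M (Mx \<Otimes>\<^sub>M My) (\<lambda>\<omega>. (X \<omega>, Y \<omega>))) (A \<times> B)"
      by (simp add: emeasure_distr emeasure_eq_measure ennreal_mult'')
  qed
  have XF[measurable]: "X \<in> ?F \<rightarrow>\<^sub>M Mx"
    by (rule measurable_vimage_algebra1) (use measurable_space[OF X] in auto)
  have subalg: "subalgebra M ?F"
    unfolding subalgebra_def
    by (auto simp: sets_vimage_algebra2 measurable_space[OF X] intro!: measurable_sets[OF X])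
  interpret F: finite_measure_subalgebra M ?F by unfold_locales (rule subalg)
  let ?k = "\<lambda>x. distr ?PY N (\<lambda>y. g (x, y))"
  have k_eq: "distr M N (\<lambda>\<omega>'. g (X \<omega>, Y \<omega>')) = ?k (X \<omega>)" if "\<omega> \<in> space M" for \<omega>
  proof -
    have [measurable]: "X \<omega> \<in> space Mx" using that measurable_space[OF X] by auto
    show ?thesis by (subst distr_distr) (auto simp: comp_def)
  qed
  have k_meas: "?k \<in> Mx \<rightarrow>\<^sub>M prob_algebra N"
    by (rule measurable_distr_prob_space2[where M=My])
       (auto intro!: measurable_const simp: space_prob_algebra PY.prob_space_axioms)
  have kappa: "(\<lambda>\<omega>. distr M N (\<lambda>\<omega>'. g (X \<omega>, Y \<omega>'))) \<in> ?F \<rightarrow>\<^sub>M prob_algebra N"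
    by (subst measurable_cong[where g="\<lambda>\<omega>. ?k (X \<omega>)"])
       (auto simp: k_eq intro!: measurable_compose[OF XF k_meas])
  have "AE \<omega> in M. real_cond_exp M ?F (indicator ((\<lambda>\<omega>. g (X \<omega>, Y \<omega>)) -` A \<inter> space M)) \<omega>
          = measure (?k (X \<omega>)) A" if A[measurable]: "A \<in> sets N" for A
  proof (rule F.real_cond_exp_charact)
    have km[measurable]: "(\<lambda>x. measure (?k x) A) \<in> borel_measurable Mx"
      by (rule measurable_compose[OF measurable_prob_algebraD[OF k_meas]]) measurable
    show "(\<lambda>\<omega>. measure (?k (X \<omega>)) A) \<in> borel_measurable ?F" by measurable
    have k1: "measure (?k x) A \<le> 1" if [measurable]: "x \<in> space Mx" for x
    proof -
      interpret K: prob_space "?k x" by (rule PY.prob_space_distr) measurable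
      show ?thesis by simp
    qed
    show "integrable M (\<lambda>\<omega>. measure (?k (X \<omega>)) A)"
      by (rule integrable_const_bound[where B=1]) (auto intro!: AE_I2 k1 measurable_space[OF X])
    show "integrable M (indicator ((\<lambda>\<omega>. g (X \<omega>, Y \<omega>)) -` A \<inter> space M) :: _ \<Rightarrow> real)"
      by (intro integrable_real_indicator) (auto simp: emeasure_eq_measure)
    fix B assume "B \<in> sets ?F"
    then obtain C where C[measurable]: "C \<in> sets Mx" and B: "B = X -` C \<inter> space M"
      by (auto simp: sets_vimage_algebra2 measurable_space[OF X])
    let ?h = "\<lambda>(x, y). indicator C x * indicator A (g (x, y)) :: real"
    have hi: "integrable (?PX \<Otimes>\<^sub>M ?PY) ?h"
      by (rule P.integrable_const_bound[where B=1]) (auto simp: indicator_def)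
    have "(\<integral>\<omega>\<in>B. indicator ((\<lambda>\<omega>. g (X \<omega>, Y \<omega>)) -` A \<inter> space M) \<omega> \<partial>M)
          = (\<integral>\<omega>. ?h (X \<omega>, Y \<omega>) \<partial>M)"
      unfolding set_lebesgue_integral_def B
      by (intro Bochner_Integration.integral_cong) (auto simp: indicator_def)
    also have "\<dots> = integral\<^sup>L (distr M (Mx \<Otimes>\<^sub>M My) (\<lambda>\<omega>. (X \<omega>, Y \<omega>))) ?h"
      by (subst integral_distr) auto
    also have "\<dots> = integral\<^sup>L (?PX \<Otimes>\<^sub>M ?PY) ?h" by (simp add: joint)
    also have "\<dots> = (\<integral>x. (\<integral>y. ?h (x, y) \<partial>?PY) \<partial>?PX)"
      using P.integral_fst'[OF hi] by simp
    also have "\<dots> = (\<integral>x. indicator C x * measure (?k x) A \<partial>?PX)"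
    proof (intro Bochner_Integration.integral_cong refl)
      fix x assume "x \<in> space ?PX"
      then have [measurable]: "x \<in> space Mx" by simp
      have "(\<integral>y. ?h (x, y) \<partial>?PY) = indicator C x * (\<integral>y. indicator A (g (x, y)) \<partial>?PY)"
        by simp
      also have "(\<integral>y. indicator A (g (x, y)) \<partial>?PY) = (\<integral>y. indicator A y \<partial>?k x :: real)"
        by (subst integral_distr) auto
      also have "\<dots> = measure (?k x) A"
        using sets.sets_into_space[OF A] by (simp add: Int_absorb2)
      finally show "(\<integral>y. ?h (x, y) \<partial>?PY) = indicator C x * measure (?k x) A" .
    qed
    also have "\<dots> = (\<integral>\<omega>. indicator C (X \<omega>) * measure (?k (X \<omega>)) A \<partial>M)"
      by (subst integral_distr) auto
    also have "\<dots> = (\<integral>\<omega>\<in>B. measure (?k (X \<omega>)) A \<partial>M)"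
      unfolding set_lebesgue_integral_def B
      by (intro Bochner_Integration.integral_cong) (auto simp: indicator_def)
    finally show "(\<integral>\<omega>\<in>B. indicator ((\<lambda>\<omega>. g (X \<omega>, Y \<omega>)) -` A \<inter> space M) \<omega> \<partial>M)
        = (\<integral>\<omega>\<in>B. measure (?k (X \<omega>)) A \<partial>M)" .
  qed
  then have "\<forall>A\<in>sets N. AE \<omega> in M. measure (distr M N (\<lambda>\<omega>'. g (X \<omega>, Y \<omega>'))) A
      = real_cond_exp M ?F (indicator ((\<lambda>\<omega>. g (X \<omega>, Y \<omega>)) -` A \<inter> space M)) \<omega>"
    by (fastforce simp: k_eq elim: AE_mp intro: AE_I2)
  with kappa show ?thesis by (simp add: regular_cond_distr_def)
qed

lemma multiplier_sum_restrict:
  "multiplier_sum n p z e = multiplier_sum n p (restrict z {1..n}) (restrict e {1..n})"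
  by (auto simp: multiplier_sum_def fun_eq_iff intro!: sum.cong)

lemma (in prob_space) regular_cond_distr_multiplier_sum:
  fixes Z :: "nat \<Rightarrow> 'a \<Rightarrow> nat \<Rightarrow> real" and \<eta> :: "nat \<Rightarrow> 'a \<Rightarrow> real"
  assumes Z: "\<And>i. i \<in> {1..n} \<Longrightarrow> Z i \<in> M \<rightarrow>\<^sub>M real_vec p"
    and \<eta>: "\<And>i. i \<in> {1..n} \<Longrightarrow> \<eta> i \<in> borel_measurable M"
    and ind: "indep_set (sets (generated_algebra M n (real_vec p) Z)) (sets (generated_algebra M n borel \<eta>))"
  shows "regular_cond_distr M (generated_algebra M n (real_vec p) Z) (real_vec p)
           (\<lambda>\<omega>. multiplier_sum n p (\<lambda>i. Z i \<omega>) (\<lambda>i. \<eta> i \<omega>))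
           (\<lambda>\<omega>. distr M (real_vec p) (\<lambda>\<omega>'. multiplier_sum n p (\<lambda>i. Z i \<omega>) (\<lambda>i. \<eta> i \<omega>')))"
proof -
  let ?g = "\<lambda>(z, e). multiplier_sum n p z e"
  have g: "?g \<in> PiM {1..n} (\<lambda>_. real_vec p) \<Otimes>\<^sub>M PiM {1..n} (\<lambda>_. borel) \<rightarrow>\<^sub>M real_vec p"
    unfolding multiplier_sum_def split_def
  proof (rule measurable_restrict)
    fix j assume j: "j \<in> {1..p}"
    have "(\<lambda>x. fst x i j) \<in> borel_measurable
        (PiM {1..n} (\<lambda>_. real_vec p) \<Otimes>\<^sub>M PiM {1..n} (\<lambda>_. borel :: real measure))"
      if "i \<in> {1..n}" for i
      using that j
      by (intro measurable_compose[OF _ measurable_component_singleton[of j "{1..p}" "\<lambda>_. borel"]]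
          measurable_compose[OF measurable_fst measurable_component_singleton]) auto
    moreover have "(\<lambda>x. snd x i) \<in> borel_measurable
        (PiM {1..n} (\<lambda>_. real_vec p) \<Otimes>\<^sub>M PiM {1..n} (\<lambda>_. borel :: real measure))"
      if "i \<in> {1..n}" for i
      using that by (intro measurable_compose[OF measurable_snd measurable_component_singleton]) auto
    ultimately show "(\<lambda>x. 1 / sqrt (real n) * (\<Sum>i = 1..n. snd x i * fst x i j)) \<in> borel_measurable
        (PiM {1..n} (\<lambda>_. real_vec p) \<Otimes>\<^sub>M PiM {1..n} (\<lambda>_. borel :: real measure))"
      by (intro borel_measurable_times borel_measurable_sum) auto
  qed
  show ?thesis
    using regular_cond_distr_freeze[OF measurable_restrict[OF Z] measurable_restrict[OF \<eta>] ind g]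
    by (simp only: split_conv multiplier_sum_restrict[symmetric])
qed

lemma (in prob_space) centered_gaussian_multiplier_sum:
  assumes ind: "indep_vars (\<lambda>_. borel) \<eta> {1..n}"
    and std: "\<And>i. i \<in> {1..n} \<Longrightarrow> distributed M lborel (\<eta> i) std_normal_density"
  shows "centered_gaussian p (\<lambda>j k. (1 / real n) * (\<Sum>i=1..n. z i j * z i k))
           (distr M (real_vec p) (\<lambda>\<omega>. multiplier_sum n p z (\<lambda>i. \<eta> i \<omega>)))"
proof -
  have [measurable]: "random_variable borel (\<eta> i)" if "i \<in> {1..n}" for i
    using ind that by (auto simp: indep_vars_def)
  have mm[measurable]: "(\<lambda>\<omega>. multiplier_sum n p z (\<lambda>i. \<eta> i \<omega>)) \<in> M \<rightarrow>\<^sub>M real_vec p"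
    unfolding multiplier_sum_def by (intro measurable_restrict) measurable
  have "0 \<le> v \<and> distr (distr M (real_vec p) (\<lambda>\<omega>. multiplier_sum n p z (\<lambda>i. \<eta> i \<omega>)))
          borel (\<lambda>y. \<Sum>j=1..p. a j * y j) = centered_normal v"
    if v: "v = (\<Sum>j=1..p. \<Sum>k=1..p. a j * ((1 / real n) * (\<Sum>i=1..n. z i j * z i k)) * a k)"
    for a v
  proof -
    define b where "b i = (1 / sqrt (real n)) * (\<Sum>j=1..p. a j * z i j)" for i
    have "(b i)\<^sup>2 = (\<Sum>j=1..p. \<Sum>k=1..p. a j * ((1 / real n) * (z i j * z i k)) * a k)" for i
      unfolding b_def power2_eq_square
      by (simp add: sum_product sum_distrib_left sum_distrib_right field_simps
          flip: real_sqrt_mult)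
    then have "(\<Sum>i=1..n. (b i)\<^sup>2)
        = (\<Sum>i=1..n. \<Sum>j=1..p. \<Sum>k=1..p. a j * ((1 / real n) * (z i j * z i k)) * a k)"
      by simp
    also have "\<dots> = (\<Sum>j=1..p. \<Sum>i=1..n. \<Sum>k=1..p. a j * ((1 / real n) * (z i j * z i k)) * a k)"
      by (rule sum.swap)
    also have "\<dots> = (\<Sum>j=1..p. \<Sum>k=1..p. \<Sum>i=1..n. a j * ((1 / real n) * (z i j * z i k)) * a k)"
      by (intro sum.cong refl sum.swap)
    also have "\<dots> = v"
      unfolding v by (simp add: sum_distrib_left sum_distrib_right)
    finally have vb: "v = (\<Sum>i=1..n. (b i)\<^sup>2)" ..
    define I where "I = {i\<in>{1..n}. b i \<noteq> 0}"
    have vI: "v = (\<Sum>i\<in>I. (b i)\<^sup>2)"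
      unfolding vb I_def by (rule sum.mono_neutral_right) auto
    have lin: "(\<Sum>j=1..p. a j * multiplier_sum n p z (\<lambda>i. \<eta> i \<omega>) j) = (\<Sum>i\<in>I. b i * \<eta> i \<omega>)" for \<omega>
    proof -
      have "(\<Sum>j=1..p. a j * multiplier_sum n p z (\<lambda>i. \<eta> i \<omega>) j)
          = (\<Sum>j=1..p. \<Sum>i=1..n. a j * ((1 / sqrt (real n)) * (\<eta> i \<omega> * z i j)))"
        by (simp add: multiplier_sum_def sum_distrib_left)
      also have "\<dots> = (\<Sum>i=1..n. \<Sum>j=1..p. a j * ((1 / sqrt (real n)) * (\<eta> i \<omega> * z i j)))"
        by (rule sum.swap)
      also have "\<dots> = (\<Sum>i=1..n. b i * \<eta> i \<omega>)"
        unfolding b_def sum_distrib_left sum_distrib_right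
        by (intro sum.cong refl) (simp add: mult_ac)
      also have "\<dots> = (\<Sum>i\<in>I. b i * \<eta> i \<omega>)"
        unfolding I_def by (rule sum.mono_neutral_right) auto
      finally show ?thesis .
    qed
    have dd: "distr (distr M (real_vec p) (\<lambda>\<omega>. multiplier_sum n p z (\<lambda>i. \<eta> i \<omega>)))
          borel (\<lambda>y. \<Sum>j=1..p. a j * y j) = distr M borel (\<lambda>\<omega>. \<Sum>i\<in>I. b i * \<eta> i \<omega>)"
      by (subst distr_distr) (simp_all only: comp_def lin mm, measurable)
    show ?thesis
    proof (cases "I = {}")
      case True
      then show ?thesis
        using dd vI by (simp add: centered_normal_def distr_const)
    next
      case False
      have fin: "finite I" by (simp add: I_def)
      have vpos: "0 < v"
        unfolding vI by (rule sum_pos) (use fin False in \<open>auto simp: I_def\<close>)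
      have ind': "indep_vars (\<lambda>_. borel) (\<lambda>i \<omega>. b i * \<eta> i \<omega>) I"
        by (rule indep_vars_compose2[where X=\<eta> and Y="\<lambda>i x. b i * x" and M'="\<lambda>_. borel"])
           (auto intro: indep_vars_subset[OF ind] simp: I_def)
      have nrm: "distributed M lborel (\<lambda>\<omega>. b i * \<eta> i \<omega>) (normal_density 0 \<bar>b i\<bar>)" if "i \<in> I" for i
        using normal_density_affine[OF std, of i "b i" 0] that by (simp add: I_def)
      have "distributed M lborel (\<lambda>\<omega>. \<Sum>i\<in>I. b i * \<eta> i \<omega>)
          (normal_density (\<Sum>i\<in>I. 0) (sqrt (\<Sum>i\<in>I. \<bar>b i\<bar>\<^sup>2)))"
        by (rule sum_indep_normal[OF fin False ind' _ nrm]) (auto simp: I_def)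
      then have "distr M lborel (\<lambda>\<omega>. \<Sum>i\<in>I. b i * \<eta> i \<omega>) = density lborel (normal_density 0 (sqrt v))"
        by (simp add: distributed_def vI)
      moreover have "distr M lborel (\<lambda>\<omega>. \<Sum>i\<in>I. b i * \<eta> i \<omega>) = distr M borel (\<lambda>\<omega>. \<Sum>i\<in>I. b i * \<eta> i \<omega>)"
        by (rule distr_cong) auto
      ultimately show ?thesis
        using dd vpos by (simp add: centered_normal_def)
    qed
  qed
  then show ?thesis
    unfolding centered_gaussian_def Let_def by (auto simp: mult.commute)
qed

end

theory Submission
  imports Defs
begin

text \<open>
  Given the data, the multiplier vector is centered Gaussian with the empirical covariance
  matrix, and the entries of that matrix differ from those of the covariance matrix of
  \<open>T\<^sub>n\<close> by at most \<open>\<Delta>\<close>, the value of \<open>Delta_hat\<close>. The theorem therefore reduces to a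
  comparison of the maxima of two centered Gaussian vectors \<open>X\<close> and \<open>Y\<close> with nearly equal
  covariance matrices, \<open>gaussian_max_comparison_uniform\<close>: if the variances of \<open>Y\<close> are bounded
  below and \<open>\<Delta> (log p) (1 + E (max Y)\<^sup>+)\<^sup>2\<close> is small, then the two distribution functions are
  uniformly close. Since \<open>E (max Y)\<^sup>+ \<le> E (max Y) + 1 + C\<^sub>1\<close>, the hypotheses of the theorem make
  this quantity tend to 0 in probability.

  The comparison has two ingredients. Let \<open>\<delta> > 0\<close> be the resolution at which the distribution
  functions are compared.

  \<^item> Smoothing. The indicator of \<open>max y \<le> x\<close> is replaced by a logistic function of slope
    \<open>\<alpha> = K / \<delta>\<close>, with \<open>K\<close> a large constant, applied to the soft maximum \<open>\<beta>\<^sup>-\<^sup>1 log (\<Sum>\<^sub>j exp (\<beta> y\<^sub>j))\<close> with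
    \<open>\<beta> = (log p) / \<delta>\<close>. For this test function the expectations under \<open>X\<close> and \<open>Y\<close> differ by at
    most \<open>(2 \<alpha> \<beta> + \<alpha>\<^sup>2) \<Delta> / 2\<close>, which is of order \<open>\<Delta> (log p) / \<delta>\<^sup>2\<close>
    (\<open>gaussian_soft_step_comparison\<close>). The point is that the Hessian of the soft maximum is
    \<open>\<beta>\<close> times the covariance matrix of a random unit coordinate vector, so the sum of the absolute values
    of its entries is at most \<open>2 \<beta>\<close> whatever \<open>p\<close> is. The proof follows the interpolation
    \<open>\<surd>t X + \<surd>(1 - t) Y\<close>. Increasing \<open>t\<close> by \<open>e\<close> exchanges an independent summand \<open>\<surd>e Y\<close> for
    \<open>\<surd>e X\<close>; by a Taylor expansion this costs \<open>e (2 \<alpha> \<beta> + \<alpha>\<^sup>2) \<Delta> / 2\<close> up to \<open>O(e\<^sup>3\<^sup>/\<^sup>2)\<close>, and the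
    remainders vanish in total as \<open>e\<close> tends to 0. No integration by parts is involved.

  \<^item> Anti-concentration. The maximum of \<open>Y\<close> lies in an interval of length \<open>\<eta>\<close> with probability
    at most a constant times \<open>\<eta> (1 + E (max Y)\<^sup>+)\<close> (\<open>gaussian_max_anticoncentration\<close>). Subtract
    \<open>x\<close> and divide every coordinate by its standard deviation, so that unit-variance variables
    minus offsets \<open>b\<^sub>j\<close> have to be studied near 0. Conditionally on the value \<open>\<xi>\<close> of the
    \<open>i\<close>-th variable, the event that \<open>i\<close> attains the maximum grows with \<open>\<xi>\<close>, because
    correlations do not exceed 1. Hence moving an interval upwards diminishes the probability
    that it contains the maximum by no more than a ratio of normal densities
    (\<open>max_window_shift\<close>). Many disjoint translates of the interval fit into the upper tail each with a
    fixed fraction of its probability, so that the probability of the interval is small compared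
    with the tail probability \<open>P (max Y > x)\<close>, and Markov's inequality bounds the latter.

  With \<open>\<delta>\<close> a small multiple of \<open>1 / (1 + E (max Y)\<^sup>+)\<close> both errors are small. Laws on
  \<open>\<real>\<^sup>p\<close> are identified throughout by their characteristic functions, in the real form
  \<open>\<integral> cos (a\<^sup>T y + \<theta>)\<close> (\<open>PiM_borel_measure_eqI_cos\<close>).
\<close>

section \<open>Uniqueness of finite measures on products of the real line\<close>

text \<open>The phases \<open>\<theta> = 0\<close> and \<open>\<theta> = - \<pi> / 2\<close> give the real and imaginary parts of the characteristic
  function. Admitting every phase keeps the condition real and stable under translation.\<close>

lemma finite_borel_measure_eqI_cos:
  fixes P Q :: "real measure"
  assumes P: "finite_measure P" "sets P = sets borel" and Q: "finite_measure Q" "sets Q = sets borel"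
    and eq: "\<And>s \<theta>. (\<integral>x. cos (s * x + \<theta>) \<partial>P) = (\<integral>x. cos (s * x + \<theta>) \<partial>Q)"
  shows "P = Q"
proof -
  interpret P: finite_measure P by fact
  interpret Q: finite_measure Q by fact
  have [measurable_cong, simp]: "sets P = sets borel" "sets Q = sets borel" by fact+
  have sp[simp]: "space P = UNIV" "space Q = UNIV"
    using sets_eq_imp_space_eq[OF P(2)] sets_eq_imp_space_eq[OF Q(2)] by auto
  define m where "m = measure P UNIV"
  have mQ: "measure Q UNIV = m"
    using eq[of 0 0] by (simp add: m_def)
  have eP: "emeasure P UNIV = ennreal m" "emeasure Q UNIV = ennreal m"
    by (auto simp: P.emeasure_eq_measure Q.emeasure_eq_measure m_def mQ[unfolded m_def])
  show ?thesis
  proof (cases "m = 0")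
    case True
    have "emeasure P A = emeasure Q A" for A
    proof -
      have "emeasure P A \<le> emeasure P UNIV" "emeasure Q A \<le> emeasure Q UNIV"
        by (metis emeasure_space sp)+
      then show ?thesis using True eP by simp
    qed
    then show ?thesis by (intro measure_eqI) auto
  next
    case False
    then have m: "m > 0" by (simp add: m_def less_le)
    let ?N = "\<lambda>R. density R (\<lambda>_. ennreal (1 / m))"
    have rd: "real_distribution (?N R)"
      if "sets R = sets borel" "emeasure R UNIV = ennreal m" for R :: "real measure"
    proof -
      have "emeasure (?N R) (space (?N R)) = 1"
        using that m sets_eq_imp_space_eq[OF that(1)]
        by (simp add: emeasure_density_const ennreal_mult[symmetric])
      then have "prob_space (?N R)" by (rule prob_spaceI)
      then show ?thesis using that by (simp add: real_distribution_def real_distribution_axioms_def)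
    qed
    have int: "integrable P (\<lambda>x. cos (s * x + \<theta>))" "integrable Q (\<lambda>x. cos (s * x + \<theta>))" for s \<theta>
      by (rule P.integrable_const_bound[where B=1] Q.integrable_const_bound[where B=1]; simp)+
    have ch: "char (?N R) t = of_real ((1 / m) * (\<integral>x. cos (t * x + 0) \<partial>R))
         + \<i> * of_real ((1 / m) * (\<integral>x. cos (t * x + (- pi / 2)) \<partial>R))"
      if R: "sets R = sets borel"
        and int: "\<And>s \<theta>. integrable R (\<lambda>x. cos (s * x + \<theta>))" for R t
    proof -
      have [measurable_cong]: "sets R = sets borel" by fact
      have eq: "iexp (t * x) = of_real (cos (t * x + 0)) + \<i> * of_real (cos (t * x + (- pi / 2)))" for x
        by (simp add: complex_eq_iff Re_exp Im_exp cos_diff)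
      have ci: "integrable R (\<lambda>x. complex_of_real ((1 / m) * cos (s * x + \<theta>)))" for s \<theta>
        by (intro integrable_of_real integrable_mult_right int)
      have "char (?N R) t = (\<integral>x. (1 / m) *\<^sub>R iexp (t * x) \<partial>R)"
        unfolding char_def using m by (subst integral_density) auto
      also have "\<dots> = (\<integral>x. of_real ((1 / m) * cos (t * x + 0)) + \<i> * of_real ((1 / m) * cos (t * x + (- pi / 2))) \<partial>R)"
        by (intro Bochner_Integration.integral_cong refl, subst eq) (simp add: scaleR_conv_of_real ring_distribs)
      also have "\<dots> = of_real (\<integral>x. (1 / m) * cos (t * x + 0) \<partial>R)
         + \<i> * of_real (\<integral>x. (1 / m) * cos (t * x + (- pi / 2)) \<partial>R)"
        using ci[of "t" 0] integrable_mult_right[OF ci[of t "- pi / 2"], of \<i>]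
        by (subst Bochner_Integration.integral_add) (simp_all del: of_real_mult)
      finally show ?thesis by simp
    qed
    have "?N P = ?N Q"
    proof (rule Levy_uniqueness)
      show "real_distribution (?N P)" "real_distribution (?N Q)" by (auto intro: rd simp: eP)
      show "char (?N P) = char (?N Q)"
        by (intro ext) (simp only: ch[OF P(2) int(1)] ch[OF Q(2) int(2)] eq)
    qed
    then have N: "emeasure (?N P) A = emeasure (?N Q) A" for A by simp
    show ?thesis
    proof (rule measure_eqI)
      fix A assume "A \<in> sets P"
      then have "ennreal (1 / m) * emeasure P A = ennreal (1 / m) * emeasure Q A"
        using N[of A] by (simp add: emeasure_density_const)
      then show "emeasure P A = emeasure Q A"
        using m by (subst (asm) ennreal_mult_cancel_left) auto
    qed simp
  qed
qed

text \<open>Coordinates are treated one at a time: by induction on \<open>K\<close>, the integrals of a product of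
  indicators of the coordinates in \<open>K\<close> times a cosine agree. In the step the next coordinate is
  handled by one-dimensional uniqueness, which is preserved because products of cosines are
  sums of cosines.\<close>

lemma PiM_borel_measure_eqI_cos:
  fixes P Q :: "('i \<Rightarrow> real) measure"
  assumes I: "finite I"
    and P: "finite_measure P" "sets P = sets (PiM I (\<lambda>_. borel))"
    and Q: "finite_measure Q" "sets Q = sets (PiM I (\<lambda>_. borel))"
    and eq: "\<And>a \<theta>. (\<integral>y. cos ((\<Sum>i\<in>I. a i * y i) + \<theta>) \<partial>P) = (\<integral>y. cos ((\<Sum>i\<in>I. a i * y i) + \<theta>) \<partial>Q)"
  shows "P = Q"
proof -
  interpret P: finite_measure P by fact
  interpret Q: finite_measure Q by fact
  have [measurable_cong]: "sets P = sets (PiM I (\<lambda>_. borel))" "sets Q = sets (PiM I (\<lambda>_. borel))"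
    by fact+
  let ?c = "\<lambda>a \<theta> (y :: 'i \<Rightarrow> real). cos ((\<Sum>i\<in>I. a i * y i) + \<theta>)"
  let ?d = "\<lambda>K A (y :: 'i \<Rightarrow> real). \<Prod>i\<in>K. indicator (A i) (y i) :: real"
  have d01: "0 \<le> ?d K A y \<and> ?d K A y \<le> 1" for K A y
    by (auto intro!: prod_nonneg prod_le_1)
  have cK: "\<forall>A a \<theta>. (\<forall>i\<in>K. A i \<in> sets borel) \<longrightarrow>
      (\<integral>y. ?d K A y * ?c a \<theta> y \<partial>P) = (\<integral>y. ?d K A y * ?c a \<theta> y \<partial>Q)"
    if "finite K" "K \<subseteq> I" for K
    using that
  proof (induction K)
    case empty
    then show ?case using eq by simp
  next
    case (insert j K)
    then have jI[simp]: "j \<in> I" and KI: "K \<subseteq> I" "j \<notin> K" by auto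
    show ?case
    proof (intro allI impI)
      fix A :: "'i \<Rightarrow> real set" and a :: "'i \<Rightarrow> real" and \<theta> :: real
      assume A: "\<forall>i\<in>insert j K. A i \<in> sets borel"
      then have AK: "\<And>i. i \<in> K \<Longrightarrow> A i \<in> sets borel" and Aj[measurable]: "A j \<in> sets borel" by auto
      have dm: "?d K A \<in> borel_measurable (PiM I (\<lambda>_. borel))"
      proof (rule borel_measurable_prod)
        fix i assume i: "i \<in> K"
        then have [measurable]: "A i \<in> sets borel" "i \<in> I" using AK KI by auto
        show "(\<lambda>y. indicator (A i) (y i) :: real) \<in> borel_measurable (PiM I (\<lambda>_. borel))"
          by measurable
      qed
      note [measurable] = dm
      have cm[measurable]: "?c a \<theta> \<in> borel_measurable (PiM I (\<lambda>_. borel))" for a \<theta>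
        by measurable
      \<comment> \<open>The weight \<open>1 + cos\<close> is nonnegative, so it defines a measure to which the
        one-dimensional uniqueness theorem applies.\<close>
      let ?w = "\<lambda>b \<psi> y. ?d K A y * (1 + ?c b \<psi> y)"
      have w0: "0 \<le> ?w b \<psi> y" for b \<psi> y
        using d01 cos_ge_minus_one[of "(\<Sum>i\<in>I. b i * y i) + \<psi>"]
        by (intro mult_nonneg_nonneg conjunct1[OF d01]) linarith
      have bd: "\<bar>?d K A y * ?c b \<psi> y\<bar> \<le> 1" for b \<psi> y
        using d01[where K=K and A=A and y=y] abs_cos_le_one[of "(\<Sum>i\<in>I. b i * y i) + \<psi>"]
        by (auto simp: abs_mult intro!: mult_le_one)
      have dcint: "integrable R (\<lambda>y. ?d K A y * ?c b \<psi> y)"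
        if "finite_measure R" "sets R = sets (PiM I (\<lambda>_. borel))" for R b \<psi>
      proof -
        have [measurable_cong]: "sets R = sets (PiM I (\<lambda>_. borel))" by fact
        show ?thesis
          by (rule finite_measure.integrable_const_bound[OF that(1), where B=1]) (use bd in auto)
      qed
      have dint: "integrable R (?d K A)"
        if "finite_measure R" "sets R = sets (PiM I (\<lambda>_. borel))" for R
        using dcint[OF that, of "\<lambda>_. 0" 0] by simp
      let ?D = "\<lambda>R b \<psi>. distr (density R (\<lambda>y. ennreal (?w b \<psi> y))) borel (\<lambda>y. y j)"
      have Dcos: "(\<integral>x. cos (s * x + \<phi>) \<partial>?D R b \<psi>)
          = (\<integral>y. ?d K A y * ?c (\<lambda>i. if i = j then s else 0) \<phi> y \<partial>R)
            + ((\<integral>y. ?d K A y * ?c (b(j := b j + s)) (\<psi> + \<phi>) y \<partial>R)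
               + (\<integral>y. ?d K A y * ?c (b(j := b j - s)) (\<psi> - \<phi>) y \<partial>R)) / 2"
        if R: "finite_measure R" "sets R = sets (PiM I (\<lambda>_. borel))" for R b \<psi> s \<phi>
      proof -
        have [measurable_cong]: "sets R = sets (PiM I (\<lambda>_. borel))" by fact
        have upd: "(\<Sum>i\<in>I. (b(j := c)) i * y i) = (\<Sum>i\<in>I. b i * y i) + (c - b j) * y j" for c and y :: "'i \<Rightarrow> real"
          using I by (simp add: sum.remove[of I j] algebra_simps)
        have single: "(\<Sum>i\<in>I. (if i = j then s else 0) * y i) = s * y j" for y :: "'i \<Rightarrow> real"
          using I by (simp add: if_distrib[of "\<lambda>x. x * _"] sum.delta cong: if_cong)
        have tr: "?w b \<psi> y * cos (s * y j + \<phi>) = ?d K A y * ?c (\<lambda>i. if i = j then s else 0) \<phi> y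
            + (?d K A y * ?c (b(j := b j + s)) (\<psi> + \<phi>) y
               + ?d K A y * ?c (b(j := b j - s)) (\<psi> - \<phi>) y) / 2" for y
        proof -
          have "D * (1 + cos U) * cos V = D * cos V + (D * cos (U + V) + D * cos (U - V)) / 2" for D U V :: real
            using arg_cong[OF cos_times_cos[of U V], of "\<lambda>x. D * x"] by (simp add: ring_distribs add.commute)
          note this[of "?d K A y" "(\<Sum>i\<in>I. b i * y i) + \<psi>" "s * y j + \<phi>"]
          then show ?thesis unfolding upd single by (simp add: algebra_simps)
        qed
        have "(\<integral>x. cos (s * x + \<phi>) \<partial>?D R b \<psi>) = (\<integral>y. ?w b \<psi> y * cos (s * y j + \<phi>) \<partial>R)"
          using w0 by (simp add: integral_distr integral_density)
        also have "\<dots> = (\<integral>y. ?d K A y * ?c (\<lambda>i. if i = j then s else 0) \<phi> y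
            + (?d K A y * ?c (b(j := b j + s)) (\<psi> + \<phi>) y
               + ?d K A y * ?c (b(j := b j - s)) (\<psi> - \<phi>) y) / 2 \<partial>R)"
          unfolding tr ..
        also have "\<dots> = (\<integral>y. ?d K A y * ?c (\<lambda>i. if i = j then s else 0) \<phi> y \<partial>R)
            + ((\<integral>y. ?d K A y * ?c (b(j := b j + s)) (\<psi> + \<phi>) y \<partial>R)
               + (\<integral>y. ?d K A y * ?c (b(j := b j - s)) (\<psi> - \<phi>) y \<partial>R)) / 2"
          using dcint[OF R]
          by (subst Bochner_Integration.integral_add) auto
        finally show ?thesis .
      qed
      have Dfin: "finite_measure (?D R b \<psi>)"
        if R: "finite_measure R" "sets R = sets (PiM I (\<lambda>_. borel))" for R b \<psi>
      proof -
        have [measurable_cong]: "sets R = sets (PiM I (\<lambda>_. borel))" by fact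
        have "integrable R (?w b \<psi>)"
          using dcint[OF R] dint[OF R] by (auto simp: ring_distribs)
        then have "(\<integral>\<^sup>+y. ennreal (?w b \<psi> y) \<partial>R) = ennreal (\<integral>y. ?w b \<psi> y \<partial>R)"
          using w0 by (intro nn_integral_eq_integral) auto
        then have "finite_measure (density R (\<lambda>y. ennreal (?w b \<psi> y)))"
          by (intro finite_measureI) (simp add: emeasure_density)
        then show ?thesis
          by (rule finite_measure.finite_measure_distr) measurable
      qed
      have Deq: "?D P b \<psi> = ?D Q b \<psi>" for b \<psi>
      proof (rule finite_borel_measure_eqI_cos)
        show "finite_measure (?D P b \<psi>)" "finite_measure (?D Q b \<psi>)"
          using Dfin P Q by blast+
        have "(\<integral>y. ?d K A y * ?c b \<psi> y \<partial>P) = (\<integral>y. ?d K A y * ?c b \<psi> y \<partial>Q)" for b \<psi>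
          using insert.IH[OF KI(1)] AK by blast
        then show "(\<integral>x. cos (s * x + \<phi>) \<partial>?D P b \<psi>) = (\<integral>x. cos (s * x + \<phi>) \<partial>?D Q b \<psi>)" for s \<phi>
          unfolding Dcos[OF P] Dcos[OF Q] by presburger
      qed auto
      have ins: "?d (insert j K) A y = ?d K A y * indicator (A j) (y j)" for y
        using insert by simp
      have wint: "(\<integral>y. ?w b \<psi> y * indicator (A j) (y j) \<partial>P) = (\<integral>y. ?w b \<psi> y * indicator (A j) (y j) \<partial>Q)" for b \<psi>
      proof -
        have "(\<integral>y. ?w b \<psi> y * indicator (A j) (y j) \<partial>R) = (\<integral>x. indicator (A j) x \<partial>?D R b \<psi> :: real)"
          if "sets R = sets (PiM I (\<lambda>_. borel))" for R
        proof -
          have [measurable_cong]: "sets R = sets (PiM I (\<lambda>_. borel))" by fact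
          show ?thesis
            by (subst integral_distr, measurable, subst integral_density) (simp_all add: w0)
        qed
        then show ?thesis using P Q Deq by presburger
      qed
      have bint: "integrable R (\<lambda>y. ?d (insert j K) A y * ?c b \<psi> y)"
        if "finite_measure R" "sets R = sets (PiM I (\<lambda>_. borel))" for R b \<psi>
      proof -
        have [measurable_cong]: "sets R = sets (PiM I (\<lambda>_. borel))" by fact
        show ?thesis unfolding ins
        proof (rule finite_measure.integrable_const_bound[OF that(1), where B=1])
          show "AE y in R. norm (?d K A y * indicator (A j) (y j) * ?c b \<psi> y) \<le> 1"
            using bd[of _ b \<psi>] by (auto simp: indicator_def)
        qed measurable
      qed
      have split: "(\<integral>y. ?w b \<psi> y * indicator (A j) (y j) \<partial>R)
          = (\<integral>y. ?d (insert j K) A y \<partial>R) + (\<integral>y. ?d (insert j K) A y * ?c b \<psi> y \<partial>R)"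
        if R: "finite_measure R" "sets R = sets (PiM I (\<lambda>_. borel))" for R b \<psi>
      proof -
        have "integrable R (\<lambda>y. ?d (insert j K) A y)"
          using bint[OF R, of "\<lambda>_. 0" 0] by simp
        then have "(\<integral>y. ?d (insert j K) A y \<partial>R) + (\<integral>y. ?d (insert j K) A y * ?c b \<psi> y \<partial>R)
           = (\<integral>y. ?d (insert j K) A y + ?d (insert j K) A y * ?c b \<psi> y \<partial>R)"
          using bint[OF R] by (subst Bochner_Integration.integral_add) auto
        then show ?thesis unfolding ins by (simp add: algebra_simps)
      qed
      have "(\<integral>y. ?d (insert j K) A y \<partial>P) = (\<integral>y. ?d (insert j K) A y \<partial>Q)"
        using wint[of "\<lambda>_. 0" "pi / 2"] unfolding split[OF P] split[OF Q] by simp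
      then show "(\<integral>y. ?d (insert j K) A y * ?c a \<theta> y \<partial>P) = (\<integral>y. ?d (insert j K) A y * ?c a \<theta> y \<partial>Q)"
        using wint[of a \<theta>] unfolding split[OF P] split[OF Q] by simp
    qed
  qed
  show ?thesis
  proof (rule measure_eqI_PiM_finite[OF I P(2) Q(2)])
    fix A assume A: "\<And>i. i \<in> I \<Longrightarrow> A i \<in> sets (borel :: real measure)"
    have "(\<integral>y. ?d I A y \<partial>R) = measure R (Pi\<^sub>E I A)"
      if R: "finite_measure R" "sets R = sets (PiM I (\<lambda>_. borel))" for R
    proof -
      have sp: "space R = Pi\<^sub>E I (\<lambda>_. UNIV)"
        using sets_eq_imp_space_eq[OF R(2)] by (simp add: space_PiM)
      have "?d I A y = indicator (Pi\<^sub>E I A) y" if "y \<in> space R" for y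
      proof (cases "\<forall>i\<in>I. y i \<in> A i")
        case True
        then show ?thesis using that sp by (auto simp: PiE_iff)
      next
        case False
        then obtain i where "i \<in> I" "y i \<notin> A i" by blast
        then have "y \<notin> Pi\<^sub>E I A" "\<exists>i\<in>I. indicator (A i) (y i) = (0::real)"
          by (auto simp: PiE_iff intro!: bexI[of _ i])
        then show ?thesis using I by (simp add: prod_zero)
      qed
      then have "(\<integral>y. ?d I A y \<partial>R) = (\<integral>y. indicator (Pi\<^sub>E I A) y \<partial>R)"
        by (intro Bochner_Integration.integral_cong) auto
      also have "\<dots> = measure R (Pi\<^sub>E I A)"
        using A sets.sets_into_space[of "Pi\<^sub>E I A" R] R I
        by (auto simp: Int_absorb2)
      finally show ?thesis .
    qed
    moreover have "(\<integral>y. ?d I A y \<partial>P) = (\<integral>y. ?d I A y \<partial>Q)"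
      using cK[OF I subset_refl, rule_format, of A "\<lambda>_. 0" 0] A by simp
    ultimately show "emeasure P (Pi\<^sub>E I A) = emeasure Q (Pi\<^sub>E I A)"
      using P Q by (simp add: P.emeasure_eq_measure Q.emeasure_eq_measure)
  next
    show "range (\<lambda>_::nat. Pi\<^sub>E I (\<lambda>_. UNIV)) \<subseteq> prod_algebra I (\<lambda>_. borel :: real measure)"
      using I by (auto intro!: prod_algebraI_finite)
  qed (auto simp: space_PiM)
qed

section \<open>Gaussian laws\<close>

text \<open>Covers the degenerate variance 0 as well, so that no later argument has to distinguish it.\<close>

lemma centered_normal_eq_distr:
  assumes "0 \<le> v"
  shows "centered_normal v = distr std_normal_distribution borel (\<lambda>x. sqrt v * x)"
proof (cases "v = 0")
  case True
  interpret prob_space std_normal_distribution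
    by (rule prob_space_normal_density) simp
  show ?thesis using True by (simp add: centered_normal_def distr_const)
next
  case False
  then have v: "0 < v" using assms by simp
  interpret prob_space std_normal_distribution
    by (rule prob_space_normal_density) simp
  have "distributed std_normal_distribution lborel (\<lambda>x. x) std_normal_density"
    by (auto simp: distributed_def intro!: measure_eqI simp: emeasure_distr)
  from normal_density_affine[OF this, of "sqrt v" 0] v
  have "distr std_normal_distribution lborel (\<lambda>x. sqrt v * x) = density lborel (normal_density 0 (sqrt v))"
    by (simp add: distributed_def)
  moreover have "distr std_normal_distribution lborel (\<lambda>x. sqrt v * x)
      = distr std_normal_distribution borel (\<lambda>x. sqrt v * x)"
    by (rule distr_cong) auto
  ultimately show ?thesis using v by (simp add: centered_normal_def)
qed

lemma integral_cos_std_normal: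
  "(\<integral>x. cos (s * x + \<theta>) \<partial>std_normal_distribution) = exp (- s\<^sup>2 / 2) * cos \<theta>"
proof -
  interpret real_distribution std_normal_distribution by (rule real_dist_normal_dist)
  have "char std_normal_distribution s = complex_of_real (exp (- s\<^sup>2 / 2))"
    by (simp add: char_std_normal_distribution)
  moreover have "integrable std_normal_distribution (\<lambda>x. iexp (s * x))"
    by (rule integrable_iexp) auto
  ultimately have "(\<integral>x. iexp \<theta> * iexp (s * x) \<partial>std_normal_distribution) = iexp \<theta> * complex_of_real (exp (- s\<^sup>2 / 2))"
     and i: "integrable std_normal_distribution (\<lambda>x. iexp \<theta> * iexp (s * x))"
    by (simp_all add: char_def)
  then have "Re (\<integral>x. iexp \<theta> * iexp (s * x) \<partial>std_normal_distribution) = cos \<theta> * exp (- s\<^sup>2 / 2)"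
    by (simp add: Re_exp)
  moreover have "Re (\<integral>x. iexp \<theta> * iexp (s * x) \<partial>std_normal_distribution)
      = (\<integral>x. Re (iexp \<theta> * iexp (s * x)) \<partial>std_normal_distribution)"
    by (rule integral_Re[OF i, symmetric])
  moreover have "Re (iexp \<theta> * iexp (s * x)) = cos (s * x + \<theta>)" for x
    by (simp add: Re_exp Im_exp cos_add)
  ultimately show ?thesis by (simp only: mult.commute)
qed

text \<open>The characteristic function of \<open>N(0, \<Sigma>)\<close>, with a phase in place of the imaginary part.
  Sums of independent vectors become additions of phases under the integral.\<close>

definition gaussian_law :: "nat \<Rightarrow> (nat \<Rightarrow> nat \<Rightarrow> real) \<Rightarrow> (nat \<Rightarrow> real) measure \<Rightarrow> bool" where
  "gaussian_law p \<Sigma> \<mu> \<longleftrightarrow> prob_space \<mu> \<and> sets \<mu> = sets (real_vec p) \<and>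
     (\<forall>a \<theta>. (\<integral>y. cos ((\<Sum>j=1..p. a j * y j) + \<theta>) \<partial>\<mu>)
        = exp (- (\<Sum>j=1..p. \<Sum>k=1..p. a j * \<Sigma> j k * a k) / 2) * cos \<theta>)"

lemma gaussian_lawD:
  assumes "gaussian_law p \<Sigma> \<mu>"
  shows "prob_space \<mu>" "sets \<mu> = sets (real_vec p)"
    "(\<integral>y. cos ((\<Sum>j=1..p. a j * y j) + \<theta>) \<partial>\<mu>)
        = exp (- (\<Sum>j=1..p. \<Sum>k=1..p. a j * \<Sigma> j k * a k) / 2) * cos \<theta>"
  using assms by (auto simp: gaussian_law_def)

lemma gaussian_law_unique:
  assumes "gaussian_law p \<Sigma> \<mu>" "gaussian_law p \<Sigma>' \<nu>"
    and "\<And>j k. j \<in> {1..p} \<Longrightarrow> k \<in> {1..p} \<Longrightarrow> \<Sigma> j k = \<Sigma>' j k"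
  shows "\<mu> = \<nu>"
proof (rule PiM_borel_measure_eqI_cos)
  show "(\<integral>y. cos ((\<Sum>j=1..p. a j * y j) + \<theta>) \<partial>\<mu>) = (\<integral>y. cos ((\<Sum>j=1..p. a j * y j) + \<theta>) \<partial>\<nu>)" for a \<theta>
    using gaussian_lawD(3)[OF assms(1)] gaussian_lawD(3)[OF assms(2)] assms(3) by simp
qed (use gaussian_lawD[OF assms(1)] gaussian_lawD[OF assms(2)] in \<open>auto intro: prob_space.finite_measure\<close>)

lemma centered_gaussianD:
  assumes "centered_gaussian p \<Sigma> \<mu>"
  shows "sets \<mu> = sets (real_vec p)" "prob_space \<mu>"
    "0 \<le> (\<Sum>j=1..p. \<Sum>k=1..p. a j * \<Sigma> j k * a k)"
    "distr \<mu> borel (\<lambda>y. \<Sum>j=1..p. a j * y j)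
      = distr std_normal_distribution borel (\<lambda>x. sqrt (\<Sum>j=1..p. \<Sum>k=1..p. a j * \<Sigma> j k * a k) * x)"
    "j \<in> {1..p} \<Longrightarrow> k \<in> {1..p} \<Longrightarrow> \<Sigma> j k = \<Sigma> k j"
proof -
  have *: "0 \<le> (\<Sum>j=1..p. \<Sum>k=1..p. a j * \<Sigma> j k * a k)"
    "distr \<mu> borel (\<lambda>y. \<Sum>j=1..p. a j * y j)
      = centered_normal (\<Sum>j=1..p. \<Sum>k=1..p. a j * \<Sigma> j k * a k)" for a
    using assms by (auto simp: centered_gaussian_def Let_def)
  show s: "sets \<mu> = sets (real_vec p)" using assms by (simp add: centered_gaussian_def)
  note [measurable_cong] = s
  have "prob_space (distr \<mu> borel (\<lambda>y. \<Sum>j=1..p. (\<lambda>_. 0) j * y j))"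
    unfolding * by (auto simp: centered_normal_def intro: prob_space_return)
  then show "prob_space \<mu>" by (rule prob_space_distrD[rotated]) measurable
  show "0 \<le> (\<Sum>j=1..p. \<Sum>k=1..p. a j * \<Sigma> j k * a k)" by fact
  then show "distr \<mu> borel (\<lambda>y. \<Sum>j=1..p. a j * y j)
      = distr std_normal_distribution borel (\<lambda>x. sqrt (\<Sum>j=1..p. \<Sum>k=1..p. a j * \<Sigma> j k * a k) * x)"
    using *(2)[of a] by (simp add: centered_normal_eq_distr)
  show "j \<in> {1..p} \<Longrightarrow> k \<in> {1..p} \<Longrightarrow> \<Sigma> j k = \<Sigma> k j"
    using assms by (auto simp: centered_gaussian_def)
qed

lemma gaussian_law_centered_gaussian:
  assumes "centered_gaussian p \<Sigma> \<mu>"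
  shows "gaussian_law p \<Sigma> \<mu>"
  unfolding gaussian_law_def
proof (intro conjI allI)
  note g = centered_gaussianD[OF assms]
  note [measurable_cong] = g(1)
  show "prob_space \<mu>" "sets \<mu> = sets (real_vec p)" by fact+
  fix a :: "nat \<Rightarrow> real" and \<theta>
  let ?v = "\<Sum>j=1..p. \<Sum>k=1..p. a j * \<Sigma> j k * a k"
  have "(\<integral>y. cos ((\<Sum>j=1..p. a j * y j) + \<theta>) \<partial>\<mu>) = (\<integral>x. cos (x + \<theta>) \<partial>distr \<mu> borel (\<lambda>y. \<Sum>j=1..p. a j * y j))"
    by (subst integral_distr) auto
  also have "\<dots> = (\<integral>x. cos (sqrt ?v * x + \<theta>) \<partial>std_normal_distribution)"
    unfolding g(4) by (subst integral_distr) auto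
  also have "\<dots> = exp (- ?v / 2) * cos \<theta>"
    unfolding integral_cos_std_normal using g(3)[of a] by simp
  finally show "(\<integral>y. cos ((\<Sum>j=1..p. a j * y j) + \<theta>) \<partial>\<mu>) = exp (- ?v / 2) * cos \<theta>" .
qed

lemma centered_gaussian_linear_moments:
  assumes "centered_gaussian p \<Sigma> \<mu>"
  shows "integrable \<mu> (\<lambda>y. (\<Sum>j=1..p. a j * y j) ^ m)"
    and "(\<integral>y. (\<Sum>j=1..p. a j * y j) \<partial>\<mu>) = 0"
    and "(\<integral>y. (\<Sum>j=1..p. a j * y j)\<^sup>2 \<partial>\<mu>) = (\<Sum>j=1..p. \<Sum>k=1..p. a j * \<Sigma> j k * a k)"
proof -
  note g = centered_gaussianD[OF assms]
  note [measurable_cong] = g(1)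
  let ?v = "\<Sum>j=1..p. \<Sum>k=1..p. a j * \<Sigma> j k * a k"
  have pw: "(\<integral>y. (\<Sum>j=1..p. a j * y j) ^ m \<partial>\<mu>) = sqrt ?v ^ m * (\<integral>x. x ^ m \<partial>std_normal_distribution)" for m
  proof -
    have "(\<integral>y. (\<Sum>j=1..p. a j * y j) ^ m \<partial>\<mu>) = (\<integral>x. x ^ m \<partial>distr \<mu> borel (\<lambda>y. \<Sum>j=1..p. a j * y j))"
      by (subst integral_distr) auto
    also have "\<dots> = (\<integral>x. (sqrt ?v * x) ^ m \<partial>std_normal_distribution)"
      unfolding g(4) by (subst integral_distr) auto
    also have "\<dots> = sqrt ?v ^ m * (\<integral>x. x ^ m \<partial>std_normal_distribution)"
      by (simp add: power_mult_distrib)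
    finally show ?thesis .
  qed
  have "integrable std_normal_distribution (\<lambda>x. (sqrt ?v * x) ^ m)"
    unfolding power_mult_distrib
    by (intro integrable_mult_right integrable_std_normal_distribution_moment)
  then have "integrable (distr \<mu> borel (\<lambda>y. \<Sum>j=1..p. a j * y j)) (\<lambda>x. x ^ m)"
    unfolding g(4) by (subst integrable_distr_eq) auto
  then show "integrable \<mu> (\<lambda>y. (\<Sum>j=1..p. a j * y j) ^ m)"
    by (subst (asm) integrable_distr_eq) auto
  show "(\<integral>y. (\<Sum>j=1..p. a j * y j) \<partial>\<mu>) = 0"
    using pw[of 1] integral_std_normal_distribution_moment_odd[of 1] by simp
  have "(\<integral>x. x\<^sup>2 \<partial>std_normal_distribution) = 1"
    using std_normal_distribution_even_moments(1)[of 1] by simp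
  then show "(\<integral>y. (\<Sum>j=1..p. a j * y j)\<^sup>2 \<partial>\<mu>) = ?v"
    using pw[of 2] g(3)[of a] by simp
qed

lemma sum_single_coefficient:
  fixes y :: "nat \<Rightarrow> real"
  assumes "k \<in> {1..p}"
  shows "(\<Sum>j=1..p. (if j = k then 1 else 0) * y j) = y k"
  using assms by (simp add: if_distrib[of "\<lambda>x. x * _"] sum.delta cong: if_cong)

text \<open>The mixed second moments are obtained by polarization from the variances of the linear forms
  \<open>s y\<^sub>j + t y\<^sub>k\<close>; nonnegativity of these variances gives the Cauchy-Schwarz inequality.\<close>

lemma centered_gaussian_moments:
  assumes G: "centered_gaussian p \<Sigma> \<mu>" and j: "j \<in> {1..p}" and k: "k \<in> {1..p}"
  shows "integrable \<mu> (\<lambda>y. y j ^ m)" "(\<integral>y. y j \<partial>\<mu>) = 0"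
    "integrable \<mu> (\<lambda>y. y j * y k)" "(\<integral>y. y j * y k \<partial>\<mu>) = \<Sigma> j k" "0 \<le> \<Sigma> j j"
    "(\<Sigma> j k)\<^sup>2 \<le> \<Sigma> j j * \<Sigma> k k"
proof -
  note g = centered_gaussianD[OF G]
  note [measurable_cong] = g(1)
  note lm = centered_gaussian_linear_moments[OF G]
  have mom: "integrable \<mu> (\<lambda>y. y j ^ m)" if "j \<in> {1..p}" for j m
    using lm(1)[of "\<lambda>i. if i = j then 1 else 0" m] that by (simp only: sum_single_coefficient)
  show "integrable \<mu> (\<lambda>y. y j ^ m)" by (rule mom[OF j])
  show "(\<integral>y. y j \<partial>\<mu>) = 0"
    using lm(2)[of "\<lambda>i. if i = j then 1 else 0"] j by (simp only: sum_single_coefficient)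
  have quad: "(\<Sum>i=1..p. \<Sum>l=1..p. (s * (if i = j then 1 else 0) + t * (if i = k then 1 else 0)) * \<Sigma> i l *
      (s * (if l = j then 1 else 0) + t * (if l = k then 1 else 0)))
    = s\<^sup>2 * \<Sigma> j j + 2 * s * t * \<Sigma> j k + t\<^sup>2 * \<Sigma> k k" if "j \<in> {1..p}" "k \<in> {1..p}" for s t j k
  proof -
    have inner: "(\<Sum>l=1..p. c * \<Sigma> i l * (s * (if l = j then 1 else 0) + t * (if l = k then 1 else 0)))
        = c * (s * \<Sigma> i j + t * \<Sigma> i k)" for c i
    proof -
      have "(\<Sum>l=1..p. c * \<Sigma> i l * (s * (if l = j then 1 else 0) + t * (if l = k then 1 else 0)))
        = (\<Sum>l=1..p. (if l = j then 1 else 0) * (c * s * \<Sigma> i l)) + (\<Sum>l=1..p. (if l = k then 1 else 0) * (c * t * \<Sigma> i l))"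
        by (simp add: sum.distrib[symmetric] algebra_simps)
      then show ?thesis using that by (simp only: sum_single_coefficient) (simp add: algebra_simps)
    qed
    have "(\<Sum>i=1..p. (s * (if i = j then 1 else 0) + t * (if i = k then 1 else 0)) * (s * \<Sigma> i j + t * \<Sigma> i k))
      = (\<Sum>i=1..p. (if i = j then 1 else 0) * (s * (s * \<Sigma> i j + t * \<Sigma> i k)))
        + (\<Sum>i=1..p. (if i = k then 1 else 0) * (t * (s * \<Sigma> i j + t * \<Sigma> i k)))"
      by (simp only: sum.distrib[symmetric]) (simp add: algebra_simps)
    also have "\<dots> = s * (s * \<Sigma> j j + t * \<Sigma> j k) + t * (s * \<Sigma> k j + t * \<Sigma> k k)"
      using that by (simp only: sum_single_coefficient)
    finally show ?thesis
      unfolding inner using g(5)[OF that] by (simp add: power2_eq_square algebra_simps)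
  qed
  have lin: "(\<Sum>i=1..p. (s * (if i = j then 1 else 0) + t * (if i = k then 1 else 0)) * y i) = s * y j + t * y k"
    for s t and y :: "nat \<Rightarrow> real"
  proof -
    have "(\<Sum>i=1..p. (s * (if i = j then 1 else 0) + t * (if i = k then 1 else 0)) * y i)
      = (\<Sum>i=1..p. (if i = j then 1 else 0) * (s * y i)) + (\<Sum>i=1..p. (if i = k then 1 else 0) * (t * y i))"
      by (simp only: sum.distrib[symmetric]) (simp add: algebra_simps)
    then show ?thesis using j k by (simp only: sum_single_coefficient)
  qed
  have q: "(\<integral>y. (s * y j + t * y k)\<^sup>2 \<partial>\<mu>) = s\<^sup>2 * \<Sigma> j j + 2 * s * t * \<Sigma> j k + t\<^sup>2 * \<Sigma> k k"
    and qi: "integrable \<mu> (\<lambda>y. (s * y j + t * y k)\<^sup>2)" for s t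
    using lm(3)[of "\<lambda>i. s * (if i = j then 1 else 0) + t * (if i = k then 1 else 0)"]
      lm(1)[of "\<lambda>i. s * (if i = j then 1 else 0) + t * (if i = k then 1 else 0)" 2] j k
    unfolding lin quad[OF j k] by auto
  have pol: "y j * y k = ((1 * y j + 1 * y k)\<^sup>2 - (1 * y j + 0 * y k)\<^sup>2 - (0 * y j + 1 * y k)\<^sup>2) / 2" for y :: "nat \<Rightarrow> real"
    by (simp add: power2_eq_square algebra_simps)
  show "integrable \<mu> (\<lambda>y. y j * y k)"
    unfolding pol by (intro integrable_divide Bochner_Integration.integrable_diff qi)
  have "(\<integral>y. y j * y k \<partial>\<mu>) = ((\<integral>y. (1 * y j + 1 * y k)\<^sup>2 \<partial>\<mu>) - (\<integral>y. (1 * y j + 0 * y k)\<^sup>2 \<partial>\<mu>) - (\<integral>y. (0 * y j + 1 * y k)\<^sup>2 \<partial>\<mu>)) / 2"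
    unfolding pol
    by (simp only: Bochner_Integration.integral_divide_zero Bochner_Integration.integral_diff Bochner_Integration.integrable_diff qi)
  then show "(\<integral>y. y j * y k \<partial>\<mu>) = \<Sigma> j k" unfolding q by simp
  have pos: "0 \<le> s\<^sup>2 * \<Sigma> j j + 2 * s * t * \<Sigma> j k + t\<^sup>2 * \<Sigma> k k" for s t
    unfolding q[symmetric] by simp
  show jj: "0 \<le> \<Sigma> j j" using pos[of 1 0] by simp
  have kk: "0 \<le> \<Sigma> k k" using pos[of 0 1] by simp
  show "(\<Sigma> j k)\<^sup>2 \<le> \<Sigma> j j * \<Sigma> k k"
  proof (cases "\<Sigma> j j = 0")
    case True
    have "0 \<le> 2 * t * \<Sigma> j k + \<Sigma> k k" for t using pos[of t 1] True by simp
    from this[of "- (\<Sigma> k k + 1) / (2 * \<Sigma> j k)"] have "\<Sigma> j k = 0"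
      by (cases "\<Sigma> j k = 0") (simp_all add: field_simps)
    then show ?thesis using True by simp
  next
    case False
    then have "0 < \<Sigma> j j" using jj by simp
    moreover have "0 \<le> \<Sigma> j j * (\<Sigma> j j * \<Sigma> k k - (\<Sigma> j k)\<^sup>2)"
      using pos[of "- \<Sigma> j k" "\<Sigma> j j"] by (simp add: power2_eq_square algebra_simps)
    ultimately show ?thesis by (simp add: zero_le_mult_iff)
  qed
qed

definition vec_convolution :: "nat \<Rightarrow> (nat \<Rightarrow> real) measure \<Rightarrow> (nat \<Rightarrow> real) measure \<Rightarrow> (nat \<Rightarrow> real) measure" where
  "vec_convolution p \<mu> \<nu> = distr (\<mu> \<Otimes>\<^sub>M \<nu>) (real_vec p) (\<lambda>(x, y). \<lambda>j\<in>{1..p}. x j + y j)"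

lemma measurable_vec_add[measurable]:
  "(\<lambda>(x, y). \<lambda>j\<in>{1..p}. x j + y j) \<in> real_vec p \<Otimes>\<^sub>M real_vec p \<rightarrow>\<^sub>M real_vec p"
  unfolding split_def
proof (rule measurable_restrict)
  fix j assume j: "j \<in> {1..p}"
  have "(\<lambda>x. fst x j) \<in> borel_measurable (real_vec p \<Otimes>\<^sub>M real_vec p)"
    "(\<lambda>x. snd x j) \<in> borel_measurable (real_vec p \<Otimes>\<^sub>M real_vec p)"
    using j by (auto intro!: measurable_compose[OF measurable_fst measurable_component_singleton]
      measurable_compose[OF measurable_snd measurable_component_singleton])
  then show "(\<lambda>x. fst x j + snd x j) \<in> borel_measurable (real_vec p \<Otimes>\<^sub>M real_vec p)"
    by (rule borel_measurable_add)
qed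

lemma integral_vec_convolution:
  fixes f :: "(nat \<Rightarrow> real) \<Rightarrow> real"
  assumes \<mu>: "prob_space \<mu>" "sets \<mu> = sets (real_vec p)" and \<nu>: "prob_space \<nu>" "sets \<nu> = sets (real_vec p)"
    and f[measurable]: "f \<in> borel_measurable (real_vec p)" and bd: "\<And>y. \<bar>f y\<bar> \<le> B"
  shows "(\<integral>y. f y \<partial>vec_convolution p \<mu> \<nu>) = (\<integral>x. (\<integral>y. f (\<lambda>j\<in>{1..p}. x j + y j) \<partial>\<nu>) \<partial>\<mu>)"
    and "integrable \<mu> (\<lambda>x. \<integral>y. f (\<lambda>j\<in>{1..p}. x j + y j) \<partial>\<nu>)"
proof -
  interpret \<mu>: prob_space \<mu> by fact
  interpret \<nu>: prob_space \<nu> by fact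
  interpret P: pair_prob_space \<mu> \<nu> ..
  note [measurable_cong] = \<mu>(2) \<nu>(2)
  have m[measurable]: "(\<lambda>(x, y). \<lambda>j\<in>{1..p}. x j + y j) \<in> \<mu> \<Otimes>\<^sub>M \<nu> \<rightarrow>\<^sub>M real_vec p" by measurable
  have i: "integrable (\<mu> \<Otimes>\<^sub>M \<nu>) (\<lambda>(x, y). f (\<lambda>j\<in>{1..p}. x j + y j))"
    by (rule P.integrable_const_bound[where B=B])
       (use bd measurable_compose[OF m f] in \<open>auto simp: split_def\<close>)
  have "(\<integral>y. f y \<partial>vec_convolution p \<mu> \<nu>) = (\<integral>(x, y). f (\<lambda>j\<in>{1..p}. x j + y j) \<partial>(\<mu> \<Otimes>\<^sub>M \<nu>))"
    unfolding vec_convolution_def by (subst integral_distr[OF m f]) (simp only: split_def)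
  then show "(\<integral>y. f y \<partial>vec_convolution p \<mu> \<nu>) = (\<integral>x. (\<integral>y. f (\<lambda>j\<in>{1..p}. x j + y j) \<partial>\<nu>) \<partial>\<mu>)"
    using P.integral_fst'[OF i] by simp
  show "integrable \<mu> (\<lambda>x. \<integral>y. f (\<lambda>j\<in>{1..p}. x j + y j) \<partial>\<nu>)"
    using P.integrable_fst'[OF i] by simp
qed

lemma gaussian_law_convolution:
  assumes \<mu>: "gaussian_law p \<Sigma> \<mu>" and \<nu>: "gaussian_law p \<Sigma>' \<nu>"
  shows "gaussian_law p (\<lambda>j k. \<Sigma> j k + \<Sigma>' j k) (vec_convolution p \<mu> \<nu>)"
  unfolding gaussian_law_def
proof (intro conjI allI)
  note m = gaussian_lawD[OF \<mu>] and n = gaussian_lawD[OF \<nu>]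
  note [measurable_cong] = m(2) n(2)
  interpret \<mu>: prob_space \<mu> by fact
  interpret \<nu>: prob_space \<nu> by fact
  interpret P: pair_prob_space \<mu> \<nu> ..
  show "prob_space (vec_convolution p \<mu> \<nu>)"
    unfolding vec_convolution_def by (rule P.prob_space_distr) measurable
  show "sets (vec_convolution p \<mu> \<nu>) = sets (real_vec p)"
    by (simp add: vec_convolution_def)
  fix a :: "nat \<Rightarrow> real" and \<theta>
  have "(\<integral>z. cos ((\<Sum>j=1..p. a j * z j) + \<theta>) \<partial>vec_convolution p \<mu> \<nu>)
      = (\<integral>x. (\<integral>y. cos ((\<Sum>j=1..p. a j * (\<lambda>j\<in>{1..p}. x j + y j) j) + \<theta>) \<partial>\<nu>) \<partial>\<mu>)"
    by (rule integral_vec_convolution(1)[OF m(1,2) n(1,2), where B=1]) auto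
  also have "\<dots> = (\<integral>x. (\<integral>y. cos ((\<Sum>j=1..p. a j * y j) + ((\<Sum>j=1..p. a j * x j) + \<theta>)) \<partial>\<nu>) \<partial>\<mu>)"
    by (simp add: sum.distrib algebra_simps)
  finally show "(\<integral>z. cos ((\<Sum>j=1..p. a j * z j) + \<theta>) \<partial>vec_convolution p \<mu> \<nu>)
      = exp (- (\<Sum>j=1..p. \<Sum>k=1..p. a j * (\<Sigma> j k + \<Sigma>' j k) * a k) / 2) * cos \<theta>"
    by (simp only: n(3) integral_mult_right_zero m(3))
       (simp add: sum.distrib ring_distribs mult_exp_exp add_divide_distrib)
qed

lemma gaussian_law_scale:
  assumes \<mu>: "gaussian_law p \<Sigma> \<mu>"
  shows "gaussian_law p (\<lambda>j k. s j * s k * \<Sigma> j k) (distr \<mu> (real_vec p) (\<lambda>y. \<lambda>j\<in>{1..p}. s j * y j))"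
  unfolding gaussian_law_def
proof (intro conjI allI)
  note m = gaussian_lawD[OF \<mu>]
  note [measurable_cong] = m(2)
  interpret \<mu>: prob_space \<mu> by fact
  have mm[measurable]: "(\<lambda>y. \<lambda>j\<in>{1..p}. s j * y j) \<in> \<mu> \<rightarrow>\<^sub>M real_vec p"
    by (intro measurable_restrict) measurable
  show "prob_space (distr \<mu> (real_vec p) (\<lambda>y. \<lambda>j\<in>{1..p}. s j * y j))"
    by (rule \<mu>.prob_space_distr) measurable
  fix a :: "nat \<Rightarrow> real" and \<theta>
  have "(\<integral>z. cos ((\<Sum>j=1..p. a j * z j) + \<theta>) \<partial>distr \<mu> (real_vec p) (\<lambda>y. \<lambda>j\<in>{1..p}. s j * y j))
      = (\<integral>y. cos ((\<Sum>j=1..p. (a j * s j) * y j) + \<theta>) \<partial>\<mu>)"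
    by (subst integral_distr) (auto simp: mult.assoc)
  then show "(\<integral>z. cos ((\<Sum>j=1..p. a j * z j) + \<theta>) \<partial>distr \<mu> (real_vec p) (\<lambda>y. \<lambda>j\<in>{1..p}. s j * y j))
      = exp (- (\<Sum>j=1..p. \<Sum>k=1..p. a j * (s j * s k * \<Sigma> j k) * a k) / 2) * cos \<theta>"
    unfolding m(3) by (simp add: mult_ac)
qed simp

section \<open>Second-order expansion of a smoothed indicator of the maximum\<close>

definition soft_max :: "nat \<Rightarrow> real \<Rightarrow> (nat \<Rightarrow> real) \<Rightarrow> real" where
  "soft_max p \<beta> y = ln (\<Sum>j=1..p. exp (\<beta> * y j)) / \<beta>"

text \<open>A smoothed indicator of \<open>max y \<le> c\<close>: a decreasing logistic function of slope \<open>\<alpha>\<close> applied to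
  the soft maximum.\<close>

definition soft_step :: "nat \<Rightarrow> real \<Rightarrow> real \<Rightarrow> real \<Rightarrow> (nat \<Rightarrow> real) \<Rightarrow> real" where
  "soft_step p \<alpha> \<beta> c y = 1 / (1 + exp (\<alpha> * (soft_max p \<beta> y - c)))"

text \<open>The gradient of the soft maximum, which is a probability vector.\<close>

definition gibbs_weight :: "nat \<Rightarrow> real \<Rightarrow> (nat \<Rightarrow> real) \<Rightarrow> nat \<Rightarrow> real" where
  "gibbs_weight p \<beta> y j = exp (\<beta> * y j) / (\<Sum>k=1..p. exp (\<beta> * y k))"

definition gibbs_moment :: "nat \<Rightarrow> real \<Rightarrow> (nat \<Rightarrow> real) \<Rightarrow> (nat \<Rightarrow> real) \<Rightarrow> nat \<Rightarrow> real" where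
  "gibbs_moment p \<beta> y x m = (\<Sum>j=1..p. gibbs_weight p \<beta> y j * x j ^ m)"

lemma sum_exp_pos: "1 \<le> p \<Longrightarrow> 0 < (\<Sum>j=1..p. exp (f j :: real))" for p :: nat
  by (intro sum_pos) auto

lemma gibbs_weight_nonneg: "0 \<le> gibbs_weight p \<beta> y j"
  by (auto simp: gibbs_weight_def intro!: divide_nonneg_nonneg sum_nonneg)

lemma sum_gibbs_weight: "1 \<le> p \<Longrightarrow> (\<Sum>j=1..p. gibbs_weight p \<beta> y j) = 1"
  using sum_exp_pos[of p "\<lambda>j. \<beta> * y j"]
  by (simp add: gibbs_weight_def sum_divide_distrib[symmetric])

lemma abs_gibbs_average_le:
  assumes "1 \<le> p" "\<And>j. j \<in> {1..p} \<Longrightarrow> \<bar>f j\<bar> \<le> B"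
  shows "\<bar>\<Sum>j=1..p. gibbs_weight p \<beta> y j * f j\<bar> \<le> B"
proof -
  have "\<bar>\<Sum>j=1..p. gibbs_weight p \<beta> y j * f j\<bar> \<le> (\<Sum>j=1..p. \<bar>gibbs_weight p \<beta> y j * f j\<bar>)"
    by (rule sum_abs)
  also have "\<dots> \<le> (\<Sum>j=1..p. gibbs_weight p \<beta> y j * B)"
    by (intro sum_mono) (simp add: abs_mult gibbs_weight_nonneg assms mult_left_mono)
  also have "\<dots> = B" by (simp only: sum_distrib_right[symmetric] sum_gibbs_weight[OF assms(1)])
  finally show ?thesis .
qed

lemma abs_gibbs_moment_le:
  assumes "1 \<le> p" "\<And>j. j \<in> {1..p} \<Longrightarrow> \<bar>x j\<bar> \<le> R"
  shows "\<bar>gibbs_moment p \<beta> y x m\<bar> \<le> R ^ m"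
  unfolding gibbs_moment_def
  by (rule abs_gibbs_average_le[OF assms(1)]) (simp add: power_abs power_mono assms(2))

text \<open>The second derivative of the smoothed indicator in a direction \<open>x\<close> is a linear function of the
  second Gibbs moment \<open>v\<close> and the squared first Gibbs moment \<open>q\<close> of \<open>x\<close>. With these as arguments
  it can be evaluated after averaging over a random direction.\<close>

definition soft_step_curvature :: "nat \<Rightarrow> real \<Rightarrow> real \<Rightarrow> real \<Rightarrow> (nat \<Rightarrow> real) \<Rightarrow> real \<Rightarrow> real \<Rightarrow> real" where
  "soft_step_curvature p \<alpha> \<beta> c y v q =
   (let l = soft_step p \<alpha> \<beta> c y in
     - \<alpha> * \<beta> * (v - q) * (l * (1 - l)) + \<alpha>\<^sup>2 * q * (l * (1 - l)) * (1 - 2 * l))"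

lemma soft_step_bounds: "0 < soft_step p \<alpha> \<beta> c z" "soft_step p \<alpha> \<beta> c z < 1"
  by (auto simp: soft_step_def add_pos_pos divide_simps)

context
  fixes p :: nat and \<alpha> \<beta> c :: real and y x :: "nat \<Rightarrow> real"
  assumes p: "1 \<le> p" and pos: "0 < \<alpha>" "0 < \<beta>"
begin

abbreviation (input) "mom m r \<equiv> gibbs_moment p \<beta> (\<lambda>j. y j + r * x j) x m"
abbreviation (input) "lev r \<equiv> soft_step p \<alpha> \<beta> c (\<lambda>j. y j + r * x j)"

text \<open>Along a line the Gibbs moments satisfy a closed system of differential equations, from which
  all derivatives of the test function are computed.\<close>

lemma has_derivative_gibbs_moment:
  "((\<lambda>r. mom m r) has_real_derivative \<beta> * (mom (Suc m) r - mom m r * mom 1 r)) (at r)"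
proof -
  let ?S = "\<lambda>m r. \<Sum>j=1..p. x j ^ m * exp (\<beta> * (y j + r * x j))"
  have S0: "?S 0 r > 0" for r using sum_exp_pos[OF p] by simp
  have mS: "mom m r = ?S m r / ?S 0 r" for m r
    by (simp add: gibbs_moment_def gibbs_weight_def sum_divide_distrib mult.commute)
  have dS: "((\<lambda>r. ?S m r) has_real_derivative \<beta> * ?S (Suc m) r) (at r)" for m r
    unfolding sum_distrib_left
    by (rule DERIV_sum) (auto intro!: derivative_eq_intros)
  have "((\<lambda>r. ?S m r / ?S 0 r) has_real_derivative
      ((\<beta> * ?S (Suc m) r) * ?S 0 r - ?S m r * (\<beta> * ?S (Suc 0) r)) / (?S 0 r * ?S 0 r)) (at r)"
    by (rule DERIV_divide[OF dS dS]) (use S0[of r] in linarith)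
  moreover have "((\<beta> * ?S (Suc m) r) * ?S 0 r - ?S m r * (\<beta> * ?S (Suc 0) r)) / (?S 0 r * ?S 0 r)
     = \<beta> * (?S (Suc m) r / ?S 0 r - ?S m r / ?S 0 r * (?S 1 r / ?S 0 r))"
  proof -
    have "((b * s) * t - u * (b * v)) / (t * t) = b * (s / t - u / t * (v / t))" if "t > 0" for b s t u v :: real
      using that by (simp add: field_simps)
    from this[OF S0] show ?thesis by simp
  qed
  ultimately show ?thesis unfolding mS by metis
qed

lemma has_derivative_soft_step:
  "((\<lambda>r. lev r) has_real_derivative - \<alpha> * mom 1 r * (lev r * (1 - lev r))) (at r)"
proof -
  let ?S = "\<lambda>m r. \<Sum>j=1..p. x j ^ m * exp (\<beta> * (y j + r * x j))"
  let ?F = "\<lambda>r. soft_max p \<beta> (\<lambda>j. y j + r * x j)"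
  have S0: "?S 0 r > 0" for r using sum_exp_pos[OF p] by simp
  have dS: "((\<lambda>r. ?S 0 r) has_real_derivative \<beta> * ?S 1 r) (at r)" for r
    unfolding sum_distrib_left
    by (rule DERIV_sum) (auto intro!: derivative_eq_intros)
  have F: "(?F has_real_derivative mom 1 r) (at r)"
  proof -
    have "((\<lambda>r. ln (?S 0 r) / \<beta>) has_real_derivative (1 / ?S 0 r * (\<beta> * ?S 1 r)) / \<beta>) (at r)"
      by (intro DERIV_cdivide DERIV_chain2[OF _ dS] DERIV_ln_divide S0)
    moreover have "(1 / ?S 0 r * (\<beta> * ?S 1 r)) / \<beta> = mom 1 r"
      using pos by (simp add: gibbs_moment_def gibbs_weight_def sum_divide_distrib mult.commute)
    ultimately show ?thesis by (simp add: soft_max_def)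
  qed
  let ?E = "exp (\<alpha> * (?F r - c))"
  have E: "1 + ?E > 0" by (simp add: add_pos_pos)
  have "((\<lambda>r. 1 / (1 + exp (\<alpha> * (?F r - c)))) has_real_derivative
      - (?E * (\<alpha> * mom 1 r)) / (1 + ?E)\<^sup>2) (at r)"
    using E by (auto intro!: derivative_eq_intros F simp: power2_eq_square)
  moreover have "- (?E * (\<alpha> * mom 1 r)) / (1 + ?E)\<^sup>2 = - \<alpha> * mom 1 r * (lev r * (1 - lev r))"
    using E by (simp add: soft_step_def field_simps power2_eq_square)
  ultimately show ?thesis by (simp add: soft_step_def)
qed

text \<open>A remainder that is cubic in \<open>r\<close>, with a constant uniform in \<open>y\<close>, is what makes the sum of all
  remainders vanish when the interpolation step tends to 0.\<close>

lemma soft_step_taylor: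
  assumes r: "0 < r" and R: "\<And>j. j \<in> {1..p} \<Longrightarrow> \<bar>x j\<bar> \<le> R" "0 \<le> R"
  shows "\<bar>lev r - soft_step p \<alpha> \<beta> c y
      + r * \<alpha> * gibbs_moment p \<beta> y x 1 * (soft_step p \<alpha> \<beta> c y * (1 - soft_step p \<alpha> \<beta> c y))
      - r\<^sup>2 / 2 * soft_step_curvature p \<alpha> \<beta> c y (gibbs_moment p \<beta> y x 2) ((gibbs_moment p \<beta> y x 1)\<^sup>2)\<bar>
    \<le> (6 * \<alpha> * \<beta>\<^sup>2 + 6 * \<alpha>\<^sup>2 * \<beta> + 3 * \<alpha> ^ 3) * R ^ 3 * r ^ 3"
proof -
  let ?L = "\<lambda>r. lev r * (1 - lev r)"
  \<comment> \<open>The first three derivatives along the line, with \<open>?m1\<close>, \<open>?m2\<close>, \<open>?L'\<close> the derivatives of the Gibbs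
    moments and of the logistic variance \<open>?L\<close>.\<close>
  let ?d1 = "\<lambda>r. - \<alpha> * mom 1 r * ?L r"
  let ?d2 = "\<lambda>r. - \<alpha> * \<beta> * (mom 2 r - (mom 1 r)\<^sup>2) * ?L r + \<alpha>\<^sup>2 * (mom 1 r)\<^sup>2 * ?L r * (1 - 2 * lev r)"
  let ?m1 = "\<lambda>r. \<beta> * (mom 2 r - mom 1 r * mom 1 r)"
  let ?m2 = "\<lambda>r. \<beta> * (mom 3 r - mom 2 r * mom 1 r)"
  let ?L' = "\<lambda>r. ?d1 r * (1 - 2 * lev r)"
  let ?d3 = "\<lambda>r. - \<alpha> * \<beta> * ((?m2 r - 2 * mom 1 r * ?m1 r) * ?L r + (mom 2 r - (mom 1 r)\<^sup>2) * ?L' r)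
     + \<alpha>\<^sup>2 * (2 * mom 1 r * ?m1 r * ?L r * (1 - 2 * lev r) + (mom 1 r)\<^sup>2 * (?L' r * (1 - 2 * lev r) - 2 * ?L r * ?d1 r))"
  have D1: "((\<lambda>r. mom 1 r) has_real_derivative ?m1 r) (at r)" for r
    using has_derivative_gibbs_moment[of 1 r] by (simp add: numeral_2_eq_2)
  have D2: "((\<lambda>r. mom 2 r) has_real_derivative ?m2 r) (at r)" for r
    using has_derivative_gibbs_moment[of 2 r] by (simp add: numeral_3_eq_3 numeral_2_eq_2)
  have DL: "((\<lambda>r. lev r) has_real_derivative ?d1 r) (at r)" for r
    by (rule has_derivative_soft_step)
  have DLL: "(?L has_real_derivative ?L' r) (at r)" for r
    by (rule derivative_eq_intros DL refl)+ (simp add: algebra_simps)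
  have Dd1: "(?d1 has_real_derivative ?d2 r) (at r)" for r
    by (rule derivative_eq_intros DLL D1 refl)+ (simp add: algebra_simps power2_eq_square)
  have Dd2: "(?d2 has_real_derivative ?d3 r) (at r)" for r
    by (rule derivative_eq_intros DLL DL D1 D2 refl)+ (simp add: algebra_simps power2_eq_square)
  define diff where "diff = (\<lambda>m::nat. if m = 0 then (\<lambda>r. lev r) else if m = 1 then ?d1 else if m = 2 then ?d2 else ?d3)"
  have d: "diff 0 = (\<lambda>r. lev r)" "diff (Suc 0) = ?d1" "diff (Suc (Suc 0)) = ?d2" "diff (Suc (Suc (Suc 0))) = ?d3"
    by (simp_all add: diff_def)
  have "\<exists>t>0. t < r \<and> lev r = (\<Sum>m<3. diff m 0 / fact m * r ^ m) + diff 3 t / fact 3 * r ^ 3"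
  proof (rule Maclaurin[OF r])
    show "\<forall>m t. m < 3 \<and> 0 \<le> t \<and> t \<le> r \<longrightarrow> (diff m has_real_derivative diff (Suc m) t) (at t)"
    proof (intro allI impI)
      fix m t assume "m < (3::nat) \<and> 0 \<le> t \<and> t \<le> r"
      then consider "m = 0" | "m = Suc 0" | "m = Suc (Suc 0)" by linarith
      then show "(diff m has_real_derivative diff (Suc m) t) (at t)"
        by cases (simp_all only: d DL Dd1 Dd2)
    qed
  qed (simp_all add: diff_def)
  then obtain t where t: "lev r = (\<Sum>m<3. diff m 0 / fact m * r ^ m) + diff 3 t / fact 3 * r ^ 3" by blast
  have eq: "lev r - soft_step p \<alpha> \<beta> c y
      + r * \<alpha> * gibbs_moment p \<beta> y x 1 * (soft_step p \<alpha> \<beta> c y * (1 - soft_step p \<alpha> \<beta> c y))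
      - r\<^sup>2 / 2 * soft_step_curvature p \<alpha> \<beta> c y (gibbs_moment p \<beta> y x 2) ((gibbs_moment p \<beta> y x 1)\<^sup>2) = ?d3 t / 6 * r ^ 3"
  proof -
    have z: "diff 0 0 = soft_step p \<alpha> \<beta> c y"
      "diff 1 0 = - \<alpha> * gibbs_moment p \<beta> y x 1 * (soft_step p \<alpha> \<beta> c y * (1 - soft_step p \<alpha> \<beta> c y))"
      "diff 2 0 = soft_step_curvature p \<alpha> \<beta> c y (gibbs_moment p \<beta> y x 2) ((gibbs_moment p \<beta> y x 1)\<^sup>2)"
      by (simp_all add: diff_def soft_step_curvature_def Let_def)
    have gen: "X - a + r * \<alpha> * m * L - r\<^sup>2 / 2 * b = d / 6 * r ^ 3"
      if "X = a + (- \<alpha> * m * L) * r + b / 2 * r\<^sup>2 + d / 6 * r ^ 3" for X a m L b d :: real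
      using that by (simp add: algebra_simps)
    have "lev r = diff 0 0 + diff 1 0 * r + diff 2 0 / 2 * r\<^sup>2 + diff 3 t / 6 * r ^ 3"
      using t by (simp add: eval_nat_numeral fact_numeral)
    moreover have "diff 3 t = ?d3 t" by (simp add: diff_def)
    ultimately show ?thesis unfolding z by (intro gen) simp
  qed
  define l where "l = lev t"
  define m1 where "m1 = mom 1 t"
  define m2 where "m2 = mom 2 t"
  define m3 where "m3 = mom 3 t"
  have l: "0 < l" "l < 1" unfolding l_def by (rule soft_step_bounds)+
  have m: "\<bar>m1\<bar> \<le> R" "\<bar>m2\<bar> \<le> R\<^sup>2" "\<bar>m3\<bar> \<le> R ^ 3"
    using abs_gibbs_moment_le[OF p R(1), where m=1] abs_gibbs_moment_le[OF p R(1), where m=2]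
      abs_gibbs_moment_le[OF p R(1), where m=3] by (auto simp: m1_def m2_def m3_def)
  have mul: "\<bar>a * b\<bar> \<le> A * B" if "\<bar>a\<bar> \<le> A" "\<bar>b\<bar> \<le> B" for a b A B :: real
    using that by (auto simp: abs_mult intro!: mult_mono)
  have L: "\<bar>l * (1 - l)\<bar> \<le> 1" "\<bar>1 - 2 * l\<bar> \<le> 1"
    using mul[of l 1 "1 - l" 1] l by auto
  have a1: "\<bar>- \<alpha> * m1 * (l * (1 - l))\<bar> \<le> \<alpha> * R * 1" (is "\<bar>?a1\<bar> \<le> _")
    using pos by (intro mul m L) auto
  have m11: "\<bar>m1 * m1\<bar> \<le> R * R" "\<bar>m2 * m1\<bar> \<le> R\<^sup>2 * R" by (intro mul m)+
  have b1: "\<bar>\<beta> * (m2 - m1 * m1)\<bar> \<le> \<beta> * (2 * R\<^sup>2)"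
  proof (rule mul)
    show "\<bar>m2 - m1 * m1\<bar> \<le> 2 * R\<^sup>2"
      using m11(1) m(2) unfolding power2_eq_square by linarith
  qed (use pos in auto)
  have b2: "\<bar>\<beta> * (m3 - m2 * m1)\<bar> \<le> \<beta> * (2 * R ^ 3)"
  proof (rule mul)
    show "\<bar>m3 - m2 * m1\<bar> \<le> 2 * R ^ 3"
      using m11(2) m(3) unfolding power2_eq_square power3_eq_cube by linarith
  qed (use pos in auto)
  have L': "\<bar>?a1 * (1 - 2 * l)\<bar> \<le> \<alpha> * R * 1 * 1" by (intro mul a1 L)
  have c1: "\<bar>2 * m1 * (\<beta> * (m2 - m1 * m1))\<bar> \<le> 2 * R * (\<beta> * (2 * R\<^sup>2))"
    by (intro mul b1 m) auto
  have c2: "\<bar>(\<beta> * (m3 - m2 * m1) - 2 * m1 * (\<beta> * (m2 - m1 * m1))) * (l * (1 - l))\<bar> \<le> (\<beta> * (6 * R ^ 3)) * 1"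
    using b2 c1 by (intro mul L) (auto simp: power2_eq_square power3_eq_cube algebra_simps)
  have c3: "\<bar>(m2 - m1\<^sup>2) * (?a1 * (1 - 2 * l))\<bar> \<le> (2 * R\<^sup>2) * (\<alpha> * R * 1 * 1)"
  proof (rule mul[OF _ L'])
    show "\<bar>m2 - m1\<^sup>2\<bar> \<le> 2 * R\<^sup>2"
      using m11(1) m(2) unfolding power2_eq_square by linarith
  qed
  have c4: "\<bar>2 * m1 * (\<beta> * (m2 - m1 * m1)) * (l * (1 - l)) * (1 - 2 * l)\<bar> \<le> 2 * R * (\<beta> * (2 * R\<^sup>2)) * 1 * 1"
    by (intro mul[OF mul[OF c1 L(1)] L(2)])
  have c5: "\<bar>m1\<^sup>2 * (?a1 * (1 - 2 * l) * (1 - 2 * l) - 2 * (l * (1 - l)) * ?a1)\<bar> \<le> R\<^sup>2 * (3 * \<alpha> * R)"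
  proof (rule mul)
    show "\<bar>m1\<^sup>2\<bar> \<le> R\<^sup>2" using m11 by (simp add: power2_eq_square)
    have "\<bar>?a1 * (1 - 2 * l) * (1 - 2 * l)\<bar> \<le> \<alpha> * R * 1 * 1 * 1" by (intro mul[OF L' L(2)])
    moreover have "\<bar>2 * (l * (1 - l)) * ?a1\<bar> \<le> (2 * 1) * (\<alpha> * R * 1)"
      by (intro mul[OF mul[OF _ L(1)] a1]) auto
    ultimately show "\<bar>?a1 * (1 - 2 * l) * (1 - 2 * l) - 2 * (l * (1 - l)) * ?a1\<bar> \<le> 3 * \<alpha> * R" by linarith
  qed
  have e1: "\<bar>- \<alpha> * \<beta> * ((\<beta> * (m3 - m2 * m1) - 2 * m1 * (\<beta> * (m2 - m1 * m1))) * (l * (1 - l)) + (m2 - m1\<^sup>2) * (?a1 * (1 - 2 * l)))\<bar>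
      \<le> (\<alpha> * \<beta>) * (\<beta> * (6 * R ^ 3) * 1 + (2 * R\<^sup>2) * (\<alpha> * R * 1 * 1))"
  proof (rule mul)
    show "\<bar>(\<beta> * (m3 - m2 * m1) - 2 * m1 * (\<beta> * (m2 - m1 * m1))) * (l * (1 - l)) + (m2 - m1\<^sup>2) * (?a1 * (1 - 2 * l))\<bar>
      \<le> \<beta> * (6 * R ^ 3) * 1 + (2 * R\<^sup>2) * (\<alpha> * R * 1 * 1)"
      by (rule order_trans[OF abs_triangle_ineq add_mono[OF c2 c3]])
  qed (use pos in \<open>simp add: abs_mult\<close>)
  have e2: "\<bar>\<alpha>\<^sup>2 * (2 * m1 * (\<beta> * (m2 - m1 * m1)) * (l * (1 - l)) * (1 - 2 * l)
       + m1\<^sup>2 * (?a1 * (1 - 2 * l) * (1 - 2 * l) - 2 * (l * (1 - l)) * ?a1))\<bar>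
      \<le> \<alpha>\<^sup>2 * (2 * R * (\<beta> * (2 * R\<^sup>2)) * 1 * 1 + R\<^sup>2 * (3 * \<alpha> * R))"
    by (rule mul[OF _ order_trans[OF abs_triangle_ineq add_mono[OF c4 c5]]]) simp
  have "\<bar>?d3 t\<bar> \<le> (\<alpha> * \<beta>) * (\<beta> * (6 * R ^ 3) * 1 + (2 * R\<^sup>2) * (\<alpha> * R * 1 * 1))
      + \<alpha>\<^sup>2 * (2 * R * (\<beta> * (2 * R\<^sup>2)) * 1 * 1 + R\<^sup>2 * (3 * \<alpha> * R))"
    unfolding l_def[symmetric] m1_def[symmetric] m2_def[symmetric] m3_def[symmetric]
    by (rule order_trans[OF abs_triangle_ineq add_mono[OF e1 e2]])
  also have "\<dots> = (6 * \<alpha> * \<beta>\<^sup>2 + 6 * \<alpha>\<^sup>2 * \<beta> + 3 * \<alpha> ^ 3) * R ^ 3"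
    by (simp add: power2_eq_square power3_eq_cube algebra_simps)
  finally have d3: "\<bar>?d3 t\<bar> \<le> (6 * \<alpha> * \<beta>\<^sup>2 + 6 * \<alpha>\<^sup>2 * \<beta> + 3 * \<alpha> ^ 3) * R ^ 3" .
  have "\<bar>d / 6 * r ^ 3\<bar> \<le> B * r ^ 3" if "\<bar>d\<bar> \<le> B" for d B :: real
    using that r by (auto simp: abs_mult intro!: mult_right_mono)
  then show ?thesis unfolding eq using d3 by blast
qed

end

section \<open>Interpolation between two Gaussian laws\<close>

lemma soft_step_cong:
  "(\<And>j. j \<in> {1..p} \<Longrightarrow> y j = z j) \<Longrightarrow> soft_step p \<alpha> \<beta> c y = soft_step p \<alpha> \<beta> c z"
  by (simp add: soft_step_def soft_max_def)

lemma measurable_soft_step[measurable]: "soft_step p \<alpha> \<beta> c \<in> borel_measurable (real_vec p)"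
  unfolding soft_step_def[abs_def] soft_max_def by measurable

lemma integrable_abs_sum_cubed:
  assumes "\<And>j. j \<in> {1..p::nat} \<Longrightarrow> integrable \<mu> (\<lambda>y. (y j) ^ 4)" and "prob_space \<mu>"
    "sets \<mu> = sets (real_vec p)"
  shows "integrable \<mu> (\<lambda>y. (\<Sum>j=1..p. \<bar>y j\<bar>) ^ 3)"
proof -
  interpret prob_space \<mu> by fact
  note [measurable_cong] = assms(3)
  have i: "integrable \<mu> (\<lambda>y. real p ^ 3 * (1 + (\<Sum>j=1..p. (y j) ^ 4)))"
    using assms(1)
    by (intro integrable_mult_right Bochner_Integration.integrable_add Bochner_Integration.integrable_sum) auto
  have le: "(\<Sum>j=1..p. \<bar>y j\<bar>) ^ 3 \<le> real p ^ 3 * (1 + (\<Sum>j=1..p. (y j) ^ 4))" for y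
  proof (cases "p = 0")
    case False
    \<comment> \<open>The cube of the sum is at most \<open>p\<^sup>3 m\<^sup>3\<close> with \<open>m\<close> the largest entry, and \<open>m\<^sup>3 \<le> 1 + m\<^sup>4\<close>.\<close>
    define m where "m = (MAX j\<in>{1..p}. \<bar>y j\<bar>)"
    have "m \<in> (\<lambda>j. \<bar>y j\<bar>) ` {1..p}" unfolding m_def using False by (intro Max_in) auto
    then obtain k where k: "k \<in> {1..p}" "m = \<bar>y k\<bar>" by auto
    have "(\<Sum>j=1..p. \<bar>y j\<bar>) \<le> (\<Sum>j=1..p. m)"
      unfolding m_def by (intro sum_mono Max_ge) auto
    then have "(\<Sum>j=1..p. \<bar>y j\<bar>) ^ 3 \<le> (real p * m) ^ 3"
      by (intro power_mono) (auto intro: sum_nonneg)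
    also have "m ^ 3 \<le> 1 + m ^ 4"
    proof (cases "m \<le> 1")
      case True
      then have "m ^ 3 \<le> 1" using k(2) by (intro power_le_one) auto
      moreover have "0 \<le> m ^ 4" by simp
      ultimately show ?thesis by linarith
    next
      case False
      then have "m ^ 3 \<le> m ^ 4" by (intro power_increasing) auto
      then show ?thesis by simp
    qed
    then have "(real p * m) ^ 3 \<le> real p ^ 3 * (1 + m ^ 4)"
      by (simp add: power_mult_distrib mult_left_mono)
    also have "m ^ 4 = y k ^ 4" using k(2) by (simp add: power_even_abs)
    also have "y k ^ 4 \<le> (\<Sum>j=1..p. (y j) ^ 4)"
      using k(1) by (intro member_le_sum) auto
    finally show ?thesis by (simp add: mult_left_mono)
  qed simp
  show ?thesis
  proof (rule Bochner_Integration.integrable_bound[OF i])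
    have "norm ((\<Sum>j=1..p. \<bar>y j\<bar>) ^ 3) \<le> norm (real p ^ 3 * (1 + (\<Sum>j=1..p. (y j) ^ 4)))" for y :: "nat \<Rightarrow> real"
    proof -
      have "norm ((\<Sum>j=1..p. \<bar>y j\<bar>) ^ 3) = (\<Sum>j=1..p. \<bar>y j\<bar>) ^ 3"
        by (simp add: abs_of_nonneg sum_nonneg)
      then show ?thesis using le[of y] by (metis abs_ge_self order_trans real_norm_def)
    qed
    then show "AE y in \<mu>. norm ((\<Sum>j=1..p. \<bar>y j\<bar>) ^ 3) \<le> norm (real p ^ 3 * (1 + (\<Sum>j=1..p. (y j) ^ 4)))"
      by simp
  qed measurable
qed

lemma integrable_gaussian_norm_cubed:
  assumes "centered_gaussian p \<Sigma> \<mu>"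
  shows "integrable \<mu> (\<lambda>y. (\<Sum>j=1..p. \<bar>y j\<bar>) ^ 3)"
  using centered_gaussian_moments(1)[OF assms] centered_gaussianD[OF assms]
  by (intro integrable_abs_sum_cubed) auto

text \<open>Averaging the expansion over a centered direction removes the first-order term, and the
  second-order term depends on the law through its covariance matrix only.\<close>

lemma soft_step_gaussian_increment:
  assumes G: "centered_gaussian p \<Sigma> \<mu>" and p: "1 \<le> p" and pos: "0 < \<alpha>" "0 < \<beta>" and r: "0 < r"
  shows "\<bar>(\<integral>x. soft_step p \<alpha> \<beta> c (\<lambda>j\<in>{1..p}. y j + r * x j) \<partial>\<mu>) - soft_step p \<alpha> \<beta> c y
      - r\<^sup>2 / 2 * soft_step_curvature p \<alpha> \<beta> c y
          (\<Sum>j=1..p. gibbs_weight p \<beta> y j * \<Sigma> j j)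
          (\<Sum>j=1..p. gibbs_weight p \<beta> y j * (\<Sum>k=1..p. gibbs_weight p \<beta> y k * \<Sigma> j k))\<bar>
    \<le> (6 * \<alpha> * \<beta>\<^sup>2 + 6 * \<alpha>\<^sup>2 * \<beta> + 3 * \<alpha> ^ 3) * (\<integral>x. (\<Sum>j=1..p. \<bar>x j\<bar>) ^ 3 \<partial>\<mu>) * r ^ 3"
    (is "\<bar>?E - ?s - _\<bar> \<le> ?C * ?M * r ^ 3")
proof -
  note g = centered_gaussianD[OF G]
  note mo = centered_gaussian_moments[OF G]
  interpret prob_space \<mu> by fact
  note [measurable_cong] = g(1)
  let ?f = "\<lambda>x. soft_step p \<alpha> \<beta> c (\<lambda>j\<in>{1..p}. y j + r * x j)"
  let ?\<pi> = "gibbs_weight p \<beta> y"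
  let ?m = "\<lambda>k x. gibbs_moment p \<beta> y x k"
  let ?L = "?s * (1 - ?s)"
  have fm[measurable]: "?f \<in> borel_measurable \<mu>"
    by (rule measurable_compose[OF measurable_restrict measurable_soft_step]) measurable
  have fi: "integrable \<mu> ?f"
  proof (rule integrable_const_bound[where B=1, OF _ fm])
    show "AE x in \<mu>. norm (?f x) \<le> 1"
      using soft_step_bounds[of p \<alpha> \<beta> c] by (intro AE_I2) (simp add: abs_of_pos less_imp_le)
  qed
  have feq: "?f x = soft_step p \<alpha> \<beta> c (\<lambda>j. y j + r * x j)" for x
    by (rule soft_step_cong) simp
  have m1i: "integrable \<mu> (?m 1)" and m1: "(\<integral>x. ?m 1 x \<partial>\<mu>) = 0"
    using mo(1)[of _ _ 1] mo(2) by (auto simp: gibbs_moment_def)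
  have m2i: "integrable \<mu> (?m 2)" and m2: "(\<integral>x. ?m 2 x \<partial>\<mu>) = (\<Sum>j=1..p. ?\<pi> j * \<Sigma> j j)"
    using mo(3,4) by (auto simp: gibbs_moment_def power2_eq_square)
  have sq: "(?m 1 x)\<^sup>2 = (\<Sum>j=1..p. ?\<pi> j * (\<Sum>k=1..p. ?\<pi> k * (x j * x k)))" for x
    by (simp add: gibbs_moment_def power2_eq_square sum_product sum_distrib_left mult_ac)
  have qi: "integrable \<mu> (\<lambda>x. (?m 1 x)\<^sup>2)"
    and q: "(\<integral>x. (?m 1 x)\<^sup>2 \<partial>\<mu>) = (\<Sum>j=1..p. ?\<pi> j * (\<Sum>k=1..p. ?\<pi> k * \<Sigma> j k))"
  proof -
    have i: "integrable \<mu> (\<lambda>x. \<Sum>k=1..p. ?\<pi> k * (x j * x k))"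
      "(\<integral>x. (\<Sum>k=1..p. ?\<pi> k * (x j * x k)) \<partial>\<mu>) = (\<Sum>k=1..p. ?\<pi> k * \<Sigma> j k)"
      if "j \<in> {1..p}" for j
      using mo(3,4)[OF that] by auto
    show "integrable \<mu> (\<lambda>x. (?m 1 x)\<^sup>2)"
      unfolding sq by (intro Bochner_Integration.integrable_sum integrable_mult_right i)
    show "(\<integral>x. (?m 1 x)\<^sup>2 \<partial>\<mu>) = (\<Sum>j=1..p. ?\<pi> j * (\<Sum>k=1..p. ?\<pi> k * \<Sigma> j k))"
      unfolding sq using i by (subst Bochner_Integration.integral_sum) auto
  qed
  let ?T = "\<lambda>x. ?f x - ?s + r * \<alpha> * ?m 1 x * ?L - r\<^sup>2 / 2 * soft_step_curvature p \<alpha> \<beta> c y (?m 2 x) ((?m 1 x)\<^sup>2)"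
  have ci: "integrable \<mu> (\<lambda>x. soft_step_curvature p \<alpha> \<beta> c y (?m 2 x) ((?m 1 x)\<^sup>2))"
    unfolding soft_step_curvature_def Let_def
    by (intro Bochner_Integration.integrable_add integrable_mult_left integrable_mult_right Bochner_Integration.integrable_diff m2i qi)
  have c: "(\<integral>x. soft_step_curvature p \<alpha> \<beta> c y (?m 2 x) ((?m 1 x)\<^sup>2) \<partial>\<mu>)
     = soft_step_curvature p \<alpha> \<beta> c y (\<integral>x. ?m 2 x \<partial>\<mu>) (\<integral>x. (?m 1 x)\<^sup>2 \<partial>\<mu>)"
    unfolding soft_step_curvature_def Let_def using m2i qi by simp
  have Ti: "integrable \<mu> ?T"
    using fi m1i ci by simp
  have "(\<integral>x. ?T x \<partial>\<mu>) = ?E - ?s - r\<^sup>2 / 2 * soft_step_curvature p \<alpha> \<beta> c y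
          (\<Sum>j=1..p. ?\<pi> j * \<Sigma> j j) (\<Sum>j=1..p. ?\<pi> j * (\<Sum>k=1..p. ?\<pi> k * \<Sigma> j k))"
    using fi m1i ci m1 c[unfolded m2 q] by (simp add: prob_space)
  moreover have "\<bar>\<integral>x. ?T x \<partial>\<mu>\<bar> \<le> (\<integral>x. ?C * (\<Sum>j=1..p. \<bar>x j\<bar>) ^ 3 * r ^ 3 \<partial>\<mu>)"
  proof (rule order_trans[OF integral_abs_bound integral_mono])
    show "integrable \<mu> (\<lambda>x. \<bar>?T x\<bar>)" using Ti by simp
    show "integrable \<mu> (\<lambda>x. ?C * (\<Sum>j=1..p. \<bar>x j\<bar>) ^ 3 * r ^ 3)"
      using integrable_gaussian_norm_cubed[OF G] by simp
    show "\<bar>?T x\<bar> \<le> ?C * (\<Sum>j=1..p. \<bar>x j\<bar>) ^ 3 * r ^ 3" for x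
      unfolding feq
    proof (rule soft_step_taylor[OF p pos r])
      show "\<bar>x j\<bar> \<le> (\<Sum>j=1..p. \<bar>x j\<bar>)" if "j \<in> {1..p}" for j
        by (rule member_le_sum[OF that]) auto
    qed (simp add: sum_nonneg)
  qed
  ultimately show ?thesis by simp
qed

text \<open>Both arguments of the curvature are averages of covariance entries with respect to the Gibbs
  weights, so the bound does not depend on the dimension.\<close>

lemma soft_step_curvature_diff:
  assumes p: "1 \<le> p" and pos: "0 < \<alpha>" "0 < \<beta>"
    and D: "\<And>j k. j \<in> {1..p} \<Longrightarrow> k \<in> {1..p} \<Longrightarrow> \<bar>\<Sigma> j k - \<Sigma>' j k\<bar> \<le> \<Delta>"
  shows "\<bar>soft_step_curvature p \<alpha> \<beta> c y (\<Sum>j=1..p. gibbs_weight p \<beta> y j * \<Sigma> j j)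
          (\<Sum>j=1..p. gibbs_weight p \<beta> y j * (\<Sum>k=1..p. gibbs_weight p \<beta> y k * \<Sigma> j k))
       - soft_step_curvature p \<alpha> \<beta> c y (\<Sum>j=1..p. gibbs_weight p \<beta> y j * \<Sigma>' j j)
          (\<Sum>j=1..p. gibbs_weight p \<beta> y j * (\<Sum>k=1..p. gibbs_weight p \<beta> y k * \<Sigma>' j k))\<bar>
    \<le> (2 * \<alpha> * \<beta> + \<alpha>\<^sup>2) * \<Delta>"
proof -
  let ?\<pi> = "gibbs_weight p \<beta> y"
  let ?l = "soft_step p \<alpha> \<beta> c y"
  define v where "v = (\<Sum>j=1..p. ?\<pi> j * (\<Sigma> j j - \<Sigma>' j j))"
  define q where "q = (\<Sum>j=1..p. ?\<pi> j * (\<Sum>k=1..p. ?\<pi> k * (\<Sigma> j k - \<Sigma>' j k)))"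
  have mul: "\<bar>a * b\<bar> \<le> A * B" if "\<bar>a\<bar> \<le> A" "\<bar>b\<bar> \<le> B" for a b A B :: real
    using that by (auto simp: abs_mult intro!: mult_mono)
  have v: "\<bar>v\<bar> \<le> \<Delta>" unfolding v_def by (intro abs_gibbs_average_le p D)
  have q: "\<bar>q\<bar> \<le> \<Delta>" unfolding q_def by (intro abs_gibbs_average_le p D)
  have l: "0 < ?l" "?l < 1" by (rule soft_step_bounds)+
  have L: "\<bar>?l * (1 - ?l)\<bar> \<le> 1" "\<bar>1 - 2 * ?l\<bar> \<le> 1"
    using mul[of ?l 1 "1 - ?l" 1] l by auto
  have a: "\<bar>- \<alpha> * \<beta> * (v - q) * (?l * (1 - ?l))\<bar> \<le> (\<alpha> * \<beta>) * (2 * \<Delta>) * 1"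
    using pos v q by (intro mul[OF mul L(1)]) (auto simp: abs_mult)
  have b: "\<bar>\<alpha>\<^sup>2 * q * (?l * (1 - ?l)) * (1 - 2 * ?l)\<bar> \<le> \<alpha>\<^sup>2 * \<Delta> * 1 * 1"
    by (intro mul[OF mul[OF mul[OF _ q] L(1)] L(2)]) auto
  have v': "(\<Sum>j=1..p. ?\<pi> j * \<Sigma> j j) = (\<Sum>j=1..p. ?\<pi> j * \<Sigma>' j j) + v"
    by (simp add: v_def sum.distrib[symmetric] algebra_simps)
  have q': "(\<Sum>j=1..p. ?\<pi> j * (\<Sum>k=1..p. ?\<pi> k * \<Sigma> j k)) = (\<Sum>j=1..p. ?\<pi> j * (\<Sum>k=1..p. ?\<pi> k * \<Sigma>' j k)) + q"
    by (simp add: q_def right_diff_distrib sum_subtractf)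
  have lin: "soft_step_curvature p \<alpha> \<beta> c y (A + v) (B + q) - soft_step_curvature p \<alpha> \<beta> c y A B
     = - \<alpha> * \<beta> * (v - q) * (?l * (1 - ?l)) + \<alpha>\<^sup>2 * q * (?l * (1 - ?l)) * (1 - 2 * ?l)" for A B
    unfolding soft_step_curvature_def Let_def by algebra
  show ?thesis unfolding v' q' lin
    using a b by (simp add: algebra_simps)
qed

definition vec_scale :: "nat \<Rightarrow> real \<Rightarrow> (nat \<Rightarrow> real) measure \<Rightarrow> (nat \<Rightarrow> real) measure" where
  "vec_scale p s \<mu> = distr \<mu> (real_vec p) (\<lambda>y. \<lambda>j\<in>{1..p}. s * y j)"

lemma gaussian_law_vec_scale:
  "gaussian_law p \<Sigma> \<mu> \<Longrightarrow> gaussian_law p (\<lambda>j k. s\<^sup>2 * \<Sigma> j k) (vec_scale p s \<mu>)"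
  using gaussian_law_scale[of p \<Sigma> \<mu> "\<lambda>_. s"] by (simp add: vec_scale_def power2_eq_square)

text \<open>Telescoping along \<open>G t\<close>, the law of \<open>\<surd>t X + \<surd>(1 - t) Y\<close>. The laws \<open>G (t + e)\<close> and \<open>G t\<close> are the
  convolutions of one law \<open>W\<close> with the laws of \<open>\<surd>e X\<close> and \<open>\<surd>e Y\<close>.\<close>

lemma gaussian_soft_step_comparison:
  assumes X: "centered_gaussian p \<Sigma> \<mu>" and Y: "centered_gaussian p \<Sigma>' \<nu>"
    and p: "1 \<le> p" and pos: "0 < \<alpha>" "0 < \<beta>"
    and D: "\<And>j k. j \<in> {1..p} \<Longrightarrow> k \<in> {1..p} \<Longrightarrow> \<bar>\<Sigma> j k - \<Sigma>' j k\<bar> \<le> \<Delta>"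
  shows "\<bar>(\<integral>y. soft_step p \<alpha> \<beta> c y \<partial>\<mu>) - (\<integral>y. soft_step p \<alpha> \<beta> c y \<partial>\<nu>)\<bar> \<le> (2 * \<alpha> * \<beta> + \<alpha>\<^sup>2) * \<Delta> / 2"
proof -
  let ?f = "soft_step p \<alpha> \<beta> c"
  let ?K = "(2 * \<alpha> * \<beta> + \<alpha>\<^sup>2) * \<Delta>"
  let ?C = "6 * \<alpha> * \<beta>\<^sup>2 + 6 * \<alpha>\<^sup>2 * \<beta> + 3 * \<alpha> ^ 3"
  let ?M = "\<lambda>\<mu>. \<integral>x. (\<Sum>j=1..p. \<bar>x j\<bar>) ^ 3 \<partial>\<mu>"
  define A where "A = ?C * ?M \<mu> + ?C * ?M \<nu>"
  note Xl = gaussian_law_centered_gaussian[OF X] and Yl = gaussian_law_centered_gaussian[OF Y]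
  note mx = gaussian_lawD(1,2)[OF Xl] and my = gaussian_lawD(1,2)[OF Yl]
  define G where "G t = vec_convolution p (vec_scale p (sqrt t) \<mu>) (vec_scale p (sqrt (1 - t)) \<nu>)" for t
  have Gl: "gaussian_law p (\<lambda>j k. t * \<Sigma> j k + (1 - t) * \<Sigma>' j k) (G t)" if "0 \<le> t" "t \<le> 1" for t
    using gaussian_law_convolution[OF gaussian_law_vec_scale[OF Xl, of "sqrt t"] gaussian_law_vec_scale[OF Yl, of "sqrt (1 - t)"]] that
    by (simp add: G_def)
  have fb: "\<bar>?f y\<bar> \<le> 1" for y
    using soft_step_bounds[of p \<alpha> \<beta> c y] by simp
  have one: "\<bar>(\<integral>x. ?f (\<lambda>j\<in>{1..p}. w j + r * x j) \<partial>\<mu>) - (\<integral>x. ?f (\<lambda>j\<in>{1..p}. w j + r * x j) \<partial>\<nu>)\<bar>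
      \<le> r\<^sup>2 / 2 * ?K + A * r ^ 3" if r: "0 < r" for w r
  proof -
    have "\<bar>a - b\<bar> \<le> R * K + (m1 + m2) * r3" if "\<bar>a - s - R * c1\<bar> \<le> m1 * r3" "\<bar>b - s - R * c2\<bar> \<le> m2 * r3" "\<bar>c1 - c2\<bar> \<le> K" "0 \<le> R"
      for a b s R c1 c2 m1 m2 r3 K :: real
    proof -
      have "\<bar>R * (c1 - c2)\<bar> \<le> R * K" using that by (simp add: abs_mult mult_left_mono)
      then show ?thesis using that(1,2) by (simp add: algebra_simps)
    qed
    from this[OF soft_step_gaussian_increment[OF X p pos r] soft_step_gaussian_increment[OF Y p pos r] soft_step_curvature_diff[OF p pos D]]
    show ?thesis unfolding A_def by simp
  qed
  have step: "\<bar>(\<integral>y. ?f y \<partial>G (t + e)) - (\<integral>y. ?f y \<partial>G t)\<bar> \<le> e / 2 * ?K + A * sqrt e ^ 3"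
    if t: "0 \<le> t" "0 < e" "t + e \<le> 1" for t e
  proof -
    define W where "W = vec_convolution p (vec_scale p (sqrt t) \<mu>) (vec_scale p (sqrt (1 - t - e)) \<nu>)"
    have Wl: "gaussian_law p (\<lambda>j k. t * \<Sigma> j k + (1 - t - e) * \<Sigma>' j k) W"
      using gaussian_law_convolution[OF gaussian_law_vec_scale[OF Xl, of "sqrt t"] gaussian_law_vec_scale[OF Yl, of "sqrt (1 - t - e)"]] t
      by (simp add: W_def)
    note mw = gaussian_lawD(1,2)[OF Wl]
    interpret W: prob_space W by fact
    have G1: "G (t + e) = vec_convolution p W (vec_scale p (sqrt e) \<mu>)"
      by (rule gaussian_law_unique[OF Gl gaussian_law_convolution[OF Wl gaussian_law_vec_scale[OF Xl]]])
         (use t in \<open>auto simp: algebra_simps\<close>)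
    have G2: "G t = vec_convolution p W (vec_scale p (sqrt e) \<nu>)"
      by (rule gaussian_law_unique[OF Gl gaussian_law_convolution[OF Wl gaussian_law_vec_scale[OF Yl]]])
         (use t in \<open>auto simp: algebra_simps\<close>)
    have int: "(\<integral>y. ?f y \<partial>vec_convolution p W (vec_scale p (sqrt e) \<rho>))
          = (\<integral>w. (\<integral>x. ?f (\<lambda>j\<in>{1..p}. w j + sqrt e * x j) \<partial>\<rho>) \<partial>W)" (is ?a)
        "integrable W (\<lambda>w. \<integral>x. ?f (\<lambda>j\<in>{1..p}. w j + sqrt e * x j) \<partial>\<rho>)" (is ?b)
      if \<rho>: "gaussian_law p T \<rho>" for \<rho> T
    proof -
      note mr = gaussian_lawD(1,2)[OF \<rho>]
      note ms = gaussian_lawD(1,2)[OF gaussian_law_vec_scale[OF \<rho>, of "sqrt e"]]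
      note [measurable_cong] = mr(2)
      have sc: "(\<integral>x. ?f (\<lambda>j\<in>{1..p}. w j + x j) \<partial>vec_scale p (sqrt e) \<rho>)
          = (\<integral>x. ?f (\<lambda>j\<in>{1..p}. w j + sqrt e * x j) \<partial>\<rho>)" for w
      proof -
        have m1: "(\<lambda>y. \<lambda>j\<in>{1..p}. sqrt e * y j) \<in> \<rho> \<rightarrow>\<^sub>M real_vec p"
          by (intro measurable_restrict) measurable
        have m2: "(\<lambda>x. ?f (\<lambda>j\<in>{1..p}. w j + x j)) \<in> borel_measurable (real_vec p)"
          by (rule measurable_compose[OF measurable_restrict measurable_soft_step]) measurable
        show ?thesis unfolding vec_scale_def
          by (subst integral_distr[OF m1 m2]) (auto intro!: Bochner_Integration.integral_cong soft_step_cong)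
      qed
      show ?a ?b
        using integral_vec_convolution[OF mw ms measurable_soft_step fb] unfolding sc by auto
    qed
    let ?D = "\<lambda>w. (\<integral>x. ?f (\<lambda>j\<in>{1..p}. w j + sqrt e * x j) \<partial>\<mu>) - (\<integral>x. ?f (\<lambda>j\<in>{1..p}. w j + sqrt e * x j) \<partial>\<nu>)"
    have eq: "(\<integral>y. ?f y \<partial>G (t + e)) - (\<integral>y. ?f y \<partial>G t)
      = (\<integral>w. (\<integral>x. ?f (\<lambda>j\<in>{1..p}. w j + sqrt e * x j) \<partial>\<mu>) - (\<integral>x. ?f (\<lambda>j\<in>{1..p}. w j + sqrt e * x j) \<partial>\<nu>) \<partial>W)"
      unfolding G1 G2 int(1)[OF Xl] int(1)[OF Yl]
      by (rule Bochner_Integration.integral_diff[OF int(2)[OF Xl] int(2)[OF Yl], symmetric])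
    have "\<bar>\<integral>w. ?D w \<partial>W\<bar> \<le> (\<integral>w. (sqrt e)\<^sup>2 / 2 * ?K + A * sqrt e ^ 3 \<partial>W)"
    proof (rule order_trans[OF integral_abs_bound integral_mono])
      show "integrable W (\<lambda>w. \<bar>(\<integral>x. ?f (\<lambda>j\<in>{1..p}. w j + sqrt e * x j) \<partial>\<mu>) - (\<integral>x. ?f (\<lambda>j\<in>{1..p}. w j + sqrt e * x j) \<partial>\<nu>)\<bar>)"
        by (intro integrable_abs Bochner_Integration.integrable_diff int(2)[OF Xl] int(2)[OF Yl])
    qed (use t one[of "sqrt e"] in auto)
    also have "(\<integral>w. (sqrt e)\<^sup>2 / 2 * ?K + A * sqrt e ^ 3 \<partial>W) = (sqrt e)\<^sup>2 / 2 * ?K + A * sqrt e ^ 3"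
      by (simp only: lebesgue_integral_const W.prob_space scaleR_one)
    also have "(sqrt e)\<^sup>2 = e" using t by simp
    finally show ?thesis unfolding eq .
  qed
  have G1: "G 1 = \<mu>" by (rule gaussian_law_unique[OF Gl Xl]) auto
  have G0: "G 0 = \<nu>" by (rule gaussian_law_unique[OF Gl Yl]) auto
  have main: "\<bar>(\<integral>y. ?f y \<partial>\<mu>) - (\<integral>y. ?f y \<partial>\<nu>)\<bar> \<le> ?K / 2 + A * (1 / sqrt (real (Suc m)))" for m
  proof -
    define e where "e = 1 / real (Suc m)"
    have e: "0 < e" "real (Suc m) * e = 1" by (auto simp: e_def)
    have "\<bar>(\<integral>y. ?f y \<partial>G (real k * e)) - (\<integral>y. ?f y \<partial>G 0)\<bar> \<le> real k * (e / 2 * ?K + A * sqrt e ^ 3)"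
      if "k \<le> Suc m" for k
      using that
    proof (induction k)
      case (Suc k)
      have Sk: "real (Suc k) * e = real k * e + e" by (simp add: ring_distribs)
      have "real (Suc k) * e \<le> real (Suc m) * e"
        using Suc.prems e(1) by (intro mult_right_mono) auto
      then have "real k * e + e \<le> 1" unfolding Sk e(2) .
      then have k: "\<bar>(\<integral>y. ?f y \<partial>G (real k * e + e)) - (\<integral>y. ?f y \<partial>G (real k * e))\<bar> \<le> e / 2 * ?K + A * sqrt e ^ 3"
        using e(1) by (intro step) auto
      have "\<bar>c - a\<bar> \<le> real (Suc k) * B" if "\<bar>b - a\<bar> \<le> real k * B" "\<bar>c - b\<bar> \<le> B" for a b c B :: real
        using that by (simp add: algebra_simps)
      from this[OF Suc.IH k] Suc.prems show ?case unfolding Sk by (meson Suc_leD)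
    qed simp
    from this[of "Suc m"] have "\<bar>(\<integral>y. ?f y \<partial>\<mu>) - (\<integral>y. ?f y \<partial>\<nu>)\<bar> \<le> real (Suc m) * (e / 2 * ?K + A * sqrt e ^ 3)"
      unfolding e(2) G1 G0 by simp
    also have "\<dots> = (real (Suc m) * e) * (?K / 2 + A * sqrt e)"
      using e(1) by (simp add: power3_eq_cube algebra_simps)
    also have "\<dots> = ?K / 2 + A * (1 / sqrt (real (Suc m)))"
      unfolding e(2) by (simp add: e_def real_sqrt_divide)
    finally show ?thesis .
  qed
  have "(\<lambda>m. 1 / sqrt (real (Suc m))) \<longlonglongrightarrow> 0"
    using LIMSEQ_inverse_real_of_nat[THEN tendsto_real_sqrt] by (simp add: inverse_eq_divide real_sqrt_divide)
  then have lim: "(\<lambda>m. ?K / 2 + A * (1 / sqrt (real (Suc m)))) \<longlonglongrightarrow> ?K / 2 + A * 0"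
    by (intro tendsto_intros)
  have "\<bar>(\<integral>y. ?f y \<partial>\<mu>) - (\<integral>y. ?f y \<partial>\<nu>)\<bar> \<le> ?K / 2 + A * 0"
    using main by (intro LIMSEQ_le_const[OF lim]) blast
  then show ?thesis by (simp only: mult_zero_right add_0_right)
qed

section \<open>Translating intervals for the maximum of a Gaussian vector\<close>

lemma gaussian_law_line:
  "gaussian_law p (\<lambda>j k. c j * c k) (distr std_normal_distribution (real_vec p) (\<lambda>\<xi>. \<lambda>j\<in>{1..p}. c j * \<xi>))"
  unfolding gaussian_law_def
proof (intro conjI allI)
  interpret prob_space std_normal_distribution
    by (rule prob_space_normal_density) simp
  have [measurable]: "(\<lambda>\<xi>. \<lambda>j\<in>{1..p}. c j * \<xi>) \<in> std_normal_distribution \<rightarrow>\<^sub>M real_vec p"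
    by (intro measurable_restrict) measurable
  show "prob_space (distr std_normal_distribution (real_vec p) (\<lambda>\<xi>. \<lambda>j\<in>{1..p}. c j * \<xi>))"
    by (rule prob_space_distr) measurable
  fix a :: "nat \<Rightarrow> real" and \<theta>
  have "(\<integral>y. cos ((\<Sum>j=1..p. a j * y j) + \<theta>) \<partial>distr std_normal_distribution (real_vec p) (\<lambda>\<xi>. \<lambda>j\<in>{1..p}. c j * \<xi>))
      = (\<integral>\<xi>. cos ((\<Sum>j=1..p. a j * c j) * \<xi> + \<theta>) \<partial>std_normal_distribution)"
    by (subst integral_distr) (auto simp: sum_distrib_right mult.assoc)
  also have "\<dots> = exp (- (\<Sum>j=1..p. a j * c j)\<^sup>2 / 2) * cos \<theta>"
    by (rule integral_cos_std_normal)
  also have "(\<Sum>j=1..p. a j * c j)\<^sup>2 = (\<Sum>j=1..p. \<Sum>k=1..p. a j * (c j * c k) * a k)"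
    by (simp add: power2_eq_square sum_product mult_ac)
  finally show "(\<integral>y. cos ((\<Sum>j=1..p. a j * y j) + \<theta>) \<partial>distr std_normal_distribution (real_vec p) (\<lambda>\<xi>. \<lambda>j\<in>{1..p}. c j * \<xi>))
     = exp (- (\<Sum>j=1..p. \<Sum>k=1..p. a j * (c j * c k) * a k) / 2) * cos \<theta>" .
qed simp

text \<open>The law of the residual after linear regression on coordinate \<open>i\<close>, which has variance 1.\<close>

lemma gaussian_law_residual:
  assumes \<mu>: "gaussian_law p R \<mu>" and i: "i \<in> {1..p}" and Rii: "R i i = 1"
    and sym: "\<And>j. j \<in> {1..p} \<Longrightarrow> R j i = R i j"
  shows "gaussian_law p (\<lambda>j k. R j k - R i j * R i k)
           (distr \<mu> (real_vec p) (\<lambda>y. \<lambda>j\<in>{1..p}. y j - R i j * y i))"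
  unfolding gaussian_law_def
proof (intro conjI allI)
  note m = gaussian_lawD[OF \<mu>]
  note [measurable_cong] = m(2)
  interpret prob_space \<mu> by fact
  have rm[measurable]: "(\<lambda>y. \<lambda>j\<in>{1..p}. y j - R i j * y i) \<in> \<mu> \<rightarrow>\<^sub>M real_vec p"
    using i by (intro measurable_restrict) measurable
  show "prob_space (distr \<mu> (real_vec p) (\<lambda>y. \<lambda>j\<in>{1..p}. y j - R i j * y i))"
    by (rule prob_space_distr) measurable
  fix a :: "nat \<Rightarrow> real" and \<theta>
  define S where "S = (\<Sum>j=1..p. a j * R i j)"
  \<comment> \<open>Moving the regression from the vector to the linear form changes only coefficient \<open>i\<close>.\<close>
  define a' where "a' j = a j - S * (if j = i then 1 else 0)" for j
  have pick: "(\<Sum>j=1..p. a' j * z j) = (\<Sum>j=1..p. a j * z j) - S * z i" for z :: "nat \<Rightarrow> real"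
  proof -
    have "(\<Sum>j=1..p. a' j * z j) = (\<Sum>j=1..p. a j * z j) - (\<Sum>j=1..p. (if j = i then 1 else 0) * (S * z j))"
      by (simp only: sum_subtractf[symmetric] a'_def) (simp add: algebra_simps)
    then show ?thesis using i by (simp only: sum_single_coefficient)
  qed
  have "(\<Sum>j=1..p. a j * (y j - R i j * y i)) = (\<Sum>j=1..p. a' j * y j)" for y :: "nat \<Rightarrow> real"
    unfolding pick S_def by (simp add: right_diff_distrib sum_subtractf sum_distrib_right mult.assoc)
  then have "(\<integral>y. cos ((\<Sum>j=1..p. a j * y j) + \<theta>) \<partial>distr \<mu> (real_vec p) (\<lambda>y. \<lambda>j\<in>{1..p}. y j - R i j * y i))
      = (\<integral>y. cos ((\<Sum>j=1..p. a' j * y j) + \<theta>) \<partial>\<mu>)"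
    by (subst integral_distr[OF rm]) auto
  also have "\<dots> = exp (- (\<Sum>j=1..p. \<Sum>k=1..p. a' j * R j k * a' k) / 2) * cos \<theta>"
    by (rule m(3))
  also have "(\<Sum>j=1..p. \<Sum>k=1..p. a' j * R j k * a' k) = (\<Sum>j=1..p. \<Sum>k=1..p. a j * (R j k - R i j * R i k) * a k)"
  proof -
    have "(\<Sum>j=1..p. \<Sum>k=1..p. a' j * R j k * a' k) = (\<Sum>j=1..p. a' j * (\<Sum>k=1..p. a' k * R j k))"
      by (simp add: sum_distrib_left mult_ac)
    also have "\<dots> = (\<Sum>j=1..p. a j * ((\<Sum>k=1..p. a k * R j k) - S * R j i)) - S * (S - S * R i i)"
      unfolding pick S_def[symmetric] ..
    also have "\<dots> = (\<Sum>j=1..p. a j * (\<Sum>k=1..p. a k * R j k)) - S * (\<Sum>j=1..p. a j * R j i)"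
      using Rii by (simp add: right_diff_distrib sum_subtractf sum_distrib_left mult_ac)
    also have "(\<Sum>j=1..p. a j * R j i) = S" using sym by (simp add: S_def)
    also have "S * S = (\<Sum>j=1..p. \<Sum>k=1..p. a j * (R i j * R i k) * a k)"
      by (simp add: S_def sum_product mult_ac)
    finally show ?thesis
      by (simp add: right_diff_distrib left_diff_distrib sum_subtractf sum_distrib_left mult_ac)
  qed
  finally show "(\<integral>y. cos ((\<Sum>j=1..p. a j * y j) + \<theta>) \<partial>distr \<mu> (real_vec p) (\<lambda>y. \<lambda>j\<in>{1..p}. y j - R i j * y i))
     = exp (- (\<Sum>j=1..p. \<Sum>k=1..p. a j * (R j k - R i j * R i k) * a k) / 2) * cos \<theta>" .
qed simp

text \<open>The vector is the sum of its regression on coordinate \<open>i\<close> and an independent residual. Integrating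
  out the residual first is conditioning on the value \<open>\<xi>\<close> of coordinate \<open>i\<close>.\<close>

lemma gaussian_law_measure_conditioning:
  assumes \<mu>: "gaussian_law p R \<mu>" and i: "i \<in> {1..p}" and Rii: "R i i = 1"
    and sym: "\<And>j. j \<in> {1..p} \<Longrightarrow> R j i = R i j" and A[measurable]: "A \<in> sets (real_vec p)"
  defines "H \<equiv> \<lambda>\<xi>. \<integral>y. indicator A (\<lambda>j\<in>{1..p}. R i j * \<xi> + (y j - R i j * y i)) \<partial>\<mu>"
  shows "measure \<mu> A = (\<integral>\<xi>. std_normal_density \<xi> * H \<xi> \<partial>lborel)"
    and "integrable lborel (\<lambda>\<xi>. std_normal_density \<xi> * H \<xi>)"
proof -
  note m = gaussian_lawD[OF \<mu>]
  note [measurable_cong] = m(2)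
  interpret prob_space \<mu> by fact
  let ?l = "\<lambda>\<xi>. \<lambda>j\<in>{1..p}. R i j * \<xi>" and ?r = "\<lambda>y. \<lambda>j\<in>{1..p}. y j - R i j * y i"
  let ?L = "distr std_normal_distribution (real_vec p) ?l"
  let ?R = "distr \<mu> (real_vec p) ?r"
  have lm[measurable]: "?l \<in> std_normal_distribution \<rightarrow>\<^sub>M real_vec p"
    by (intro measurable_restrict) measurable
  have rm[measurable]: "?r \<in> \<mu> \<rightarrow>\<^sub>M real_vec p"
    using i by (intro measurable_restrict) measurable
  note gl = gaussian_law_line[of p "R i"]
  have gr: "gaussian_law p (\<lambda>j k. R j k - R i j * R i k) ?R"
    by (rule gaussian_law_residual[OF \<mu> i Rii]) (rule sym)
  note L = gaussian_lawD(1,2)[OF gl] and R = gaussian_lawD(1,2)[OF gr]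
  have \<mu>eq: "\<mu> = vec_convolution p ?L ?R"
    by (rule gaussian_law_unique[OF \<mu> gaussian_law_convolution[OF gl gr]]) auto
  have f: "(indicator A :: _ \<Rightarrow> real) \<in> borel_measurable (real_vec p)" by measurable
  have b: "\<bar>indicator A y :: real\<bar> \<le> 1" for y by (simp add: indicator_def)
  note conv = integral_vec_convolution[OF L R f b]
  let ?G = "\<lambda>x. \<integral>y. indicator A (\<lambda>j\<in>{1..p}. x j + y j) \<partial>?R :: real"
  have addm: "(\<lambda>y. indicator A (\<lambda>j\<in>{1..p}. x j + y j) :: real) \<in> borel_measurable (real_vec p)" for x
    by (rule measurable_compose[OF measurable_restrict f]) measurable
  have H: "?G (?l \<xi>) = H \<xi>" for \<xi>
    unfolding H_def
    by (subst integral_distr[OF rm addm])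
       (auto intro!: Bochner_Integration.integral_cong arg_cong[of _ _ "indicator A"])
  have Gm: "?G \<in> borel_measurable (real_vec p)"
    using borel_measurable_integrable[OF conv(2)] by simp
  have "integrable std_normal_distribution (\<lambda>\<xi>. H \<xi>)"
    using conv(2) unfolding integrable_distr_eq[OF lm Gm] H .
  moreover have Hm[measurable]: "H \<in> borel_measurable borel"
    using borel_measurable_integrable[OF calculation] by simp
  ultimately show "integrable lborel (\<lambda>\<xi>. std_normal_density \<xi> * H \<xi>)"
    by (simp add: integrable_density normal_density_nonneg)
  have "measure \<mu> A = (\<integral>y. indicator A y \<partial>\<mu>)"
    using sets.sets_into_space[of A \<mu>] m(2) A by (simp add: Int_absorb2)
  also have "\<dots> = (\<integral>x. ?G x \<partial>?L)"
    by (subst \<mu>eq) (rule conv(1))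
  also have "\<dots> = (\<integral>\<xi>. H \<xi> \<partial>std_normal_distribution)"
    by (simp only: integral_distr[OF lm Gm] H)
  also have "\<dots> = (\<integral>\<xi>. std_normal_density \<xi> * H \<xi> \<partial>lborel)"
    by (subst integral_density) (auto simp: normal_density_nonneg)
  finally show "measure \<mu> A = (\<integral>\<xi>. std_normal_density \<xi> * H \<xi> \<partial>lborel)" .
qed

text \<open>The first index at which the maximum is attained is \<open>i\<close>. Breaking ties in this way makes the
  events disjoint even if coordinates coincide almost surely.\<close>

definition first_argmax_event :: "nat \<Rightarrow> (nat \<Rightarrow> real) \<Rightarrow> nat \<Rightarrow> real \<Rightarrow> real \<Rightarrow> (nat \<Rightarrow> real) set" where
  "first_argmax_event p b i s t = {y \<in> space (real_vec p). s < y i - b i \<and> y i - b i \<le> t \<and>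
     (\<forall>k\<in>{1..p}. y k - b k \<le> y i - b i \<and> (k < i \<longrightarrow> y k - b k < y i - b i))}"

definition max_window :: "nat \<Rightarrow> (nat \<Rightarrow> real) \<Rightarrow> real \<Rightarrow> real \<Rightarrow> (nat \<Rightarrow> real) set" where
  "max_window p b s t = {y \<in> space (real_vec p). (\<exists>k\<in>{1..p}. s < y k - b k) \<and> (\<forall>k\<in>{1..p}. y k - b k \<le> t)}"

lemma sets_first_argmax_event[measurable]:
  assumes i: "i \<in> {1..p}"
  shows "first_argmax_event p b i s t \<in> sets (real_vec p)"
proof -
  have [measurable]: "(\<lambda>y. y k) \<in> borel_measurable (real_vec p)" if "k \<in> {1..p}" for k
    using that by (rule measurable_component_singleton)
  note [measurable] = this[OF i]
  have "Measurable.pred (real_vec p) (\<lambda>y. y k - b k \<le> y i - b i \<and> (k < i \<longrightarrow> y k - b k < y i - b i))"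
    if "k \<in> {1..p}" for k
  proof -
    have [measurable]: "(\<lambda>y. y k) \<in> borel_measurable (real_vec p)"
      using that by (rule measurable_component_singleton)
    have "Measurable.pred (real_vec p) (\<lambda>y. \<not> y i - b i < y k - b k \<and> (k < i \<longrightarrow> y k - b k < y i - b i))"
      by measurable
    then show ?thesis by (simp only: not_less)
  qed
  then have [measurable]: "Measurable.pred (real_vec p)
      (\<lambda>y. \<forall>k\<in>{1..p}. y k - b k \<le> y i - b i \<and> (k < i \<longrightarrow> y k - b k < y i - b i))"
    by (intro pred_intros_finite(3)) auto
  show ?thesis unfolding first_argmax_event_def by measurable
qed

lemma sets_max_window[measurable]: "max_window p b s t \<in> sets (real_vec p)"
  unfolding max_window_def by measurable

lemma max_window_UN: "max_window p b s t = (\<Union>i\<in>{1..p}. first_argmax_event p b i s t)"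
proof (intro equalityI subsetI)
  fix y assume y: "y \<in> max_window p b s t"
  then obtain k where k: "k \<in> {1..p}" "s < y k - b k" by (auto simp: max_window_def)
  define m where "m = (MAX k\<in>{1..p}. y k - b k)"
  have le: "y k - b k \<le> m" if "k \<in> {1..p}" for k unfolding m_def using that by (intro Max_ge) auto
  have "m \<in> (\<lambda>k. y k - b k) ` {1..p}" unfolding m_def using k by (intro Max_in) auto
  then obtain j where j: "j \<in> {1..p} \<and> y j - b j = m" by auto
  define i where "i = (LEAST j. j \<in> {1..p} \<and> y j - b j = m)"
  have i: "i \<in> {1..p} \<and> y i - b i = m" unfolding i_def by (rule LeastI[of "\<lambda>j. j \<in> {1..p} \<and> y j - b j = m", OF j])
  have "y k - b k < m" if "k \<in> {1..p}" "k < i" for k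
  proof -
    have "\<not> (k \<in> {1..p} \<and> y k - b k = m)"
      using that(2) unfolding i_def by (rule not_less_Least)
    then show ?thesis using le[OF that(1)] that(1) by auto
  qed
  then have "y \<in> first_argmax_event p b i s t"
    using y i le less_le_trans[OF k(2) le[OF k(1)]]
    by (auto simp: first_argmax_event_def max_window_def)
  then show "y \<in> (\<Union>i\<in>{1..p}. first_argmax_event p b i s t)" using i by blast
next
  fix y assume "y \<in> (\<Union>i\<in>{1..p}. first_argmax_event p b i s t)"
  then show "y \<in> max_window p b s t"
    by (fastforce simp: first_argmax_event_def max_window_def)
qed

lemma disjoint_first_argmax_event: "disjoint_family_on (\<lambda>i. first_argmax_event p b i s t) {1..p}"
proof -
  have "first_argmax_event p b i s t \<inter> first_argmax_event p b j s t = {}"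
    if i: "i \<in> {1..p}" and j: "j \<in> {1..p}" and ij: "i < j" for i j
  proof (rule equals0I)
    fix y assume y: "y \<in> first_argmax_event p b i s t \<inter> first_argmax_event p b j s t"
    then have "y j - b j \<le> y i - b i" using j unfolding first_argmax_event_def by blast
    moreover have "y i - b i < y j - b j" using y i ij unfolding first_argmax_event_def by blast
    ultimately show False by simp
  qed
  then show ?thesis unfolding disjoint_family_on_def by (metis Int_commute linorder_neqE_nat)
qed

lemma std_normal_density_shift:
  "std_normal_density (\<xi> + h) = exp (- h * (\<xi> + h / 2)) * std_normal_density \<xi>"
  by (simp add: std_normal_density_def mult_exp_exp field_simps power2_eq_square)

context
  fixes p :: nat and R :: "nat \<Rightarrow> nat \<Rightarrow> real" and \<mu> :: "(nat \<Rightarrow> real) measure" and b :: "nat \<Rightarrow> real" and B :: real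
  assumes \<mu>: "gaussian_law p R \<mu>"
    and Rii: "\<And>i. i \<in> {1..p} \<Longrightarrow> R i i = 1"
    and sym: "\<And>i j. i \<in> {1..p} \<Longrightarrow> j \<in> {1..p} \<Longrightarrow> R j i = R i j"
    and R1: "\<And>i j. i \<in> {1..p} \<Longrightarrow> j \<in> {1..p} \<Longrightarrow> R i j \<le> 1"
    and B: "\<And>i. i \<in> {1..p} \<Longrightarrow> b i \<le> B" "0 \<le> B"
begin

text \<open>When the \<open>i\<close>-th coordinate increases by \<open>h\<close>, the conditional mean of any other coordinate increases
  by at most \<open>h\<close>, so coordinate \<open>i\<close> remains a maximizer. The loss is the ratio of the normal densities
  at \<open>\<xi> + h\<close> and \<open>\<xi>\<close>, where \<open>\<xi> \<le> t + B\<close> on the event.\<close>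

lemma first_argmax_event_shift:
  assumes i: "i \<in> {1..p}" and h: "0 \<le> h"
  shows "exp (- h * (t + B + h / 2)) * measure \<mu> (first_argmax_event p b i s t)
    \<le> measure \<mu> (first_argmax_event p b i (s + h) (t + h))"
proof -
  note m = gaussian_lawD[OF \<mu>]
  note [measurable_cong] = m(2)
  interpret prob_space \<mu> by (rule m(1))
  let ?A = "first_argmax_event p b i s t" and ?A' = "first_argmax_event p b i (s + h) (t + h)"
  let ?z = "\<lambda>\<xi> y. \<lambda>j\<in>{1..p}. R i j * \<xi> + (y j - R i j * y i)"
  define H where "H \<xi> = (\<integral>y. (indicator ?A (?z \<xi> y) :: real) \<partial>\<mu>)" for \<xi>
  define H' where "H' \<xi> = (\<integral>y. (indicator ?A' (?z \<xi> y) :: real) \<partial>\<mu>)" for \<xi>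
  have sA: "?A \<in> sets (real_vec p)" "?A' \<in> sets (real_vec p)" using i by measurable
  have c: "measure \<mu> ?A = (\<integral>\<xi>. std_normal_density \<xi> * H \<xi> \<partial>lborel)"
    "integrable lborel (\<lambda>\<xi>. std_normal_density \<xi> * H \<xi>)"
    unfolding H_def
    using gaussian_law_measure_conditioning[OF \<mu> i Rii[OF i] _ sA(1)] sym[OF i] by blast+
  have c': "measure \<mu> ?A' = (\<integral>\<xi>. std_normal_density \<xi> * H' \<xi> \<partial>lborel)"
    "integrable lborel (\<lambda>\<xi>. std_normal_density \<xi> * H' \<xi>)"
    unfolding H'_def
    using gaussian_law_measure_conditioning[OF \<mu> i Rii[OF i] _ sA(2)] sym[OF i] by blast+
  have zi: "?z \<xi> y i = \<xi>" for \<xi> y using i Rii[OF i] by simp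
  have zm: "(\<lambda>y. ?z \<xi> y) \<in> \<mu> \<rightarrow>\<^sub>M real_vec p" for \<xi>
    using i by (intro measurable_restrict) measurable
  have mem: "?z (\<xi> + h) y \<in> ?A'" if A: "?z \<xi> y \<in> ?A" for \<xi> y
  proof -
    have lin: "?z (\<xi> + h) y k \<le> ?z \<xi> y k + h" if "k \<in> {1..p}" for k
      using mult_right_mono[OF R1[OF i that] h] that by (simp add: algebra_simps)
    have "?z (\<xi> + h) y \<in> space (real_vec p)" by (auto simp: space_PiM)
    moreover have "s + h < ?z (\<xi> + h) y i - b i" "?z (\<xi> + h) y i - b i \<le> t + h"
      using A unfolding first_argmax_event_def zi mem_Collect_eq by auto
    moreover have "?z (\<xi> + h) y k - b k \<le> ?z (\<xi> + h) y i - b i \<and> (k < i \<longrightarrow> ?z (\<xi> + h) y k - b k < ?z (\<xi> + h) y i - b i)"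
      if k: "k \<in> {1..p}" for k
    proof -
      have "?z \<xi> y k - b k \<le> ?z \<xi> y i - b i \<and> (k < i \<longrightarrow> ?z \<xi> y k - b k < ?z \<xi> y i - b i)"
        using A k unfolding first_argmax_event_def mem_Collect_eq by blast
      then show ?thesis using lin[OF k] unfolding zi by linarith
    qed
    ultimately show ?thesis unfolding first_argmax_event_def mem_Collect_eq by blast
  qed
  have ii: "integrable \<mu> (\<lambda>y. indicator C (?z \<xi> y) :: real)" if C: "C \<in> sets (real_vec p)" for C \<xi>
  proof (rule integrable_const_bound[where B=1])
    show "(\<lambda>y. indicator C (?z \<xi> y) :: real) \<in> borel_measurable \<mu>"
      by (rule measurable_compose[OF zm borel_measurable_indicator[OF C]])
  qed (auto simp: indicator_def)
  have HH': "H \<xi> \<le> H' (\<xi> + h)" for \<xi>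
    unfolding H_def H'_def
    by (rule integral_mono[OF ii[OF sA(1)] ii[OF sA(2)]]) (use mem in \<open>auto simp: indicator_def\<close>)
  have H0: "0 \<le> H \<xi>" for \<xi> unfolding H_def by simp
  have Hz: "H \<xi> = 0" if "t + B < \<xi>" for \<xi>
  proof -
    have "?z \<xi> y \<notin> ?A" for y
      using that B(1)[OF i] unfolding first_argmax_event_def mem_Collect_eq zi by auto
    then have "indicator ?A (?z \<xi> y) = (0::real)" for y by simp
    then show ?thesis by (simp add: H_def)
  qed
  let ?e = "exp (- h * (t + B + h / 2))"
  have "?e * measure \<mu> ?A = (\<integral>\<xi>. ?e * (std_normal_density \<xi> * H \<xi>) \<partial>lborel)"
    by (simp add: c)
  also have "\<dots> \<le> (\<integral>\<xi>. std_normal_density (h + 1 * \<xi>) * H' (h + 1 * \<xi>) \<partial>lborel)"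
  proof (rule integral_mono)
    show "integrable lborel (\<lambda>\<xi>. ?e * (std_normal_density \<xi> * H \<xi>))" using c(2) by simp
    show "integrable lborel (\<lambda>\<xi>. std_normal_density (h + 1 * \<xi>) * H' (h + 1 * \<xi>))"
      using lborel_integrable_real_affine[OF c'(2), of 1 h] by simp
    fix \<xi> :: real
    show "?e * (std_normal_density \<xi> * H \<xi>) \<le> std_normal_density (h + 1 * \<xi>) * H' (h + 1 * \<xi>)"
    proof (cases "t + B < \<xi>")
      case True
      then have "H \<xi> = 0" by (rule Hz)
      moreover have "0 \<le> H' (h + 1 * \<xi>)" unfolding H'_def by simp
      ultimately show ?thesis by (simp add: normal_density_nonneg)
    next
      case False
      have "?e \<le> exp (- h * (\<xi> + h / 2))"
        using False h by (simp add: mult_left_mono)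
      then have "?e * (std_normal_density \<xi> * H \<xi>) \<le> exp (- h * (\<xi> + h / 2)) * (std_normal_density \<xi> * H' (\<xi> + h))"
        using HH'[of \<xi>] H0 by (intro mult_mono) (auto simp: normal_density_nonneg mult_left_mono)
      also have "\<dots> = std_normal_density (\<xi> + h) * H' (\<xi> + h)"
        by (simp only: std_normal_density_shift mult.assoc)
      finally show ?thesis by (simp add: add.commute)
    qed
  qed
  also have "\<dots> = measure \<mu> ?A'"
    unfolding c'(1) using lborel_integral_real_affine[of 1 "\<lambda>\<xi>. std_normal_density \<xi> * H' \<xi>" h] by simp
  finally show ?thesis .
qed

lemma max_window_shift:
  assumes h: "0 \<le> h"
  shows "exp (- h * (t + B + h / 2)) * measure \<mu> (max_window p b s t) \<le> measure \<mu> (max_window p b (s + h) (t + h))"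
proof -
  note m = gaussian_lawD[OF \<mu>]
  interpret prob_space \<mu> by (rule m(1))
  have M: "measure \<mu> (max_window p b s t) = (\<Sum>i=1..p. measure \<mu> (first_argmax_event p b i s t))" for s t
    unfolding max_window_UN
    by (rule finite_measure_finite_Union[OF _ _ disjoint_first_argmax_event])
       (simp, intro image_subsetI, simp only: m(2) sets_first_argmax_event)
  show ?thesis unfolding M sum_distrib_left
    by (intro sum_mono first_argmax_event_shift h)
qed

text \<open>About \<open>1 / (d (B + 2))\<close> disjoint translates of the window fit into the tail, and each of them keeps
  at least the fraction \<open>e\<^sup>-\<^sup>1\<close> of its probability.\<close>

lemma max_window_le_tail:
  assumes d: "0 < d" "s + d \<le> 1"
  shows "measure \<mu> (max_window p b s (s + d))
    \<le> 2 * exp 1 * d * (B + 2) * measure \<mu> {y \<in> space (real_vec p). \<exists>k\<in>{1..p}. s < y k - b k}"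
    (is "?m \<le> _ * measure \<mu> ?T")
proof -
  note m = gaussian_lawD[OF \<mu>]
  note [measurable_cong] = m(2)
  interpret prob_space \<mu> by (rule m(1))
  have T: "?T \<in> sets (real_vec p)" by measurable
  show ?thesis
  proof (cases "d * (B + 2) > 1")
    case True
    have "?m \<le> measure \<mu> ?T"
      by (rule finite_measure_mono) (use T m(2) in \<open>auto simp: max_window_def\<close>)
    also have "\<dots> \<le> (2 * exp 1 * (d * (B + 2))) * measure \<mu> ?T"
    proof -
      have "1 \<le> 2 * exp (1::real)" using exp_ge_add_one_self[of 1] by simp
      then have "1 * 1 \<le> 2 * exp 1 * (d * (B + 2))" using True by (intro mult_mono) auto
      then show ?thesis using mult_right_mono[of 1 _ "measure \<mu> ?T"] by simp
    qed
    finally show ?thesis by (simp add: mult_ac)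
  next
    case False
    have BD: "0 < d * (B + 2)" using d B(2) by simp
    \<comment> \<open>The number of translates; rounding down loses at most a factor of 2 because \<open>n \<ge> 1\<close>.\<close>
    define n where "n = nat \<lfloor>1 / (d * (B + 2))\<rfloor>"
    have n: "real n \<le> 1 / (d * (B + 2))" "1 / (d * (B + 2)) < real n + 1"
      using BD by (simp_all add: n_def of_nat_floor)
    have n1: "1 \<le> n" using False BD by (simp add: n_def le_nat_iff)
    let ?W = "\<lambda>i::nat. max_window p b (s + real i * d) (s + d + real i * d)"
    have each: "exp (- 1) * ?m \<le> measure \<mu> (?W i)" if i: "i < n" for i
    proof -
      have "(real i * d) * (B + 2) \<le> real n * (d * (B + 2))"
        using i BD unfolding mult.assoc by (intro mult_right_mono) auto
      also have "\<dots> \<le> 1" using n(1) BD by (simp add: pos_le_divide_eq)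
      finally have i1: "(real i * d) * (B + 2) \<le> 1" .
      \<comment> \<open>The total shift is at most \<open>1 / (B + 2) \<le> 1\<close>, so the factor in \<open>max_window_shift\<close> is at least \<open>e\<^sup>-\<^sup>1\<close>.\<close>
      have "(real i * d) * 1 \<le> (real i * d) * (B + 2)" using d B(2) by (intro mult_left_mono) auto
      with i1 have "s + d + B + real i * d / 2 \<le> B + 2" using d by linarith
      then have "(real i * d) * (s + d + B + real i * d / 2) \<le> (real i * d) * (B + 2)"
        using d by (intro mult_left_mono) auto
      with i1 have "(real i * d) * (s + d + B + real i * d / 2) \<le> 1" by linarith
      then have "exp (- 1) \<le> exp (- (real i * d) * (s + d + B + real i * d / 2))" by simp
      then have "exp (- 1) * ?m \<le> exp (- (real i * d) * (s + d + B + real i * d / 2)) * ?m"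
        by (rule mult_right_mono) simp
      also have "\<dots> \<le> measure \<mu> (?W i)" using d by (intro max_window_shift) simp
      finally show ?thesis .
    qed
    have dis: "disjoint_family_on ?W {..<n}"
    proof -
      have "?W i \<inter> ?W j = {}" if "i < j" for i j
      proof -
        have "real (Suc i) \<le> real j" using that by simp
        then have "(real i + 1) * d \<le> real j * d" using d by (intro mult_right_mono) auto
        then have "s + d + real i * d \<le> s + real j * d" by (simp add: algebra_simps)
        then show ?thesis unfolding max_window_def by fastforce
      qed
      then show ?thesis unfolding disjoint_family_on_def by (metis Int_commute linorder_neqE_nat)
    qed
    have "real n * (exp (- 1) * ?m) = (\<Sum>i<n. exp (- 1) * ?m)" by simp
    also have "\<dots> \<le> (\<Sum>i<n. measure \<mu> (?W i))" by (intro sum_mono each) auto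
    also have "\<dots> = measure \<mu> (\<Union>i<n. ?W i)"
      by (rule finite_measure_finite_Union[symmetric, OF _ _ dis])
         (simp, intro image_subsetI, simp only: m(2) sets_max_window)
    also have "\<dots> \<le> measure \<mu> ?T"
    proof (rule finite_measure_mono)
      show "(\<Union>i<n. ?W i) \<subseteq> ?T"
      proof
        fix y assume "y \<in> (\<Union>i<n. ?W i)"
        then obtain i k where "y \<in> space (real_vec p)" "k \<in> {1..p}" "s + real i * d < y k - b k"
          by (auto simp: max_window_def)
        moreover have "0 \<le> real i * d" using d by simp
        ultimately show "y \<in> ?T" by force
      qed
    qed (use T m(2) in simp)
    finally have le: "real n * (exp (- 1) * ?m) \<le> measure \<mu> ?T" .
    have "1 / (d * (B + 2)) \<le> 2 * real n" using n(2) n1 by linarith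
    then have "1 \<le> 2 * real n * (d * (B + 2))" using BD by (simp add: pos_divide_le_eq)
    then have "1 * ?m \<le> 2 * real n * (d * (B + 2)) * ?m" by (rule mult_right_mono) simp
    also have "\<dots> = (2 * exp 1 * (d * (B + 2))) * (real n * (exp (- 1) * ?m))"
      by (simp add: exp_minus field_simps)
    also have "\<dots> \<le> (2 * exp 1 * (d * (B + 2))) * measure \<mu> ?T"
      using le BD by (intro mult_left_mono) auto
    finally show ?thesis by (simp add: mult_ac)
  qed
qed

end

section \<open>Distribution functions of Gaussian maxima\<close>

lemma vec_max_le_iff: "1 \<le> p \<Longrightarrow> vec_max p y \<le> t \<longleftrightarrow> (\<forall>k\<in>{1..p}. y k \<le> t)"
  and less_vec_max_iff: "1 \<le> p \<Longrightarrow> s < vec_max p y \<longleftrightarrow> (\<exists>k\<in>{1..p}. s < y k)"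
proof -
  assume "1 \<le> p"
  then have *: "finite (y ` {1..p})" "y ` {1..p} \<noteq> {}" by auto
  show "vec_max p y \<le> t \<longleftrightarrow> (\<forall>k\<in>{1..p}. y k \<le> t)"
    unfolding vec_max_def using Max_le_iff[OF *] by simp
  show "s < vec_max p y \<longleftrightarrow> (\<exists>k\<in>{1..p}. s < y k)"
    unfolding vec_max_def using Max_gr_iff[OF *] by simp
qed

lemma measurable_vec_max[measurable]:
  assumes "1 \<le> p"
  shows "vec_max p \<in> borel_measurable (real_vec p)"
proof (rule borel_measurableI_le)
  show "{y \<in> space (real_vec p). vec_max p y \<le> t} \<in> sets (real_vec p)" for t
    unfolding vec_max_le_iff[OF assms] by measurable
qed

lemma integrable_gaussian_vec_max:
  assumes G: "centered_gaussian p \<Sigma> \<mu>" and p: "1 \<le> p"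
  shows "integrable \<mu> (vec_max p)"
proof (rule Bochner_Integration.integrable_bound)
  note [measurable_cong] = centered_gaussianD(1)[OF G]
  have "integrable \<mu> (\<lambda>y. y j)" if "j \<in> {1..p}" for j
    using centered_gaussian_moments(1)[OF G that that, of 1] by simp
  then show "integrable \<mu> (\<lambda>y. \<Sum>j=1..p. \<bar>y j\<bar>)"
    by (intro Bochner_Integration.integrable_sum integrable_abs)
  show "vec_max p \<in> borel_measurable \<mu>" using p by measurable
  have "\<bar>vec_max p y\<bar> \<le> (\<Sum>j=1..p. \<bar>y j\<bar>)" for y
  proof -
    have "vec_max p y \<in> y ` {1..p}" unfolding vec_max_def using p by (intro Max_in) auto
    then obtain k where k: "k \<in> {1..p}" "vec_max p y = y k" by auto
    show ?thesis unfolding k(2) by (rule member_le_sum[OF k(1)]) auto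
  qed
  then show "AE y in \<mu>. norm (vec_max p y) \<le> norm (\<Sum>j=1..p. \<bar>y j\<bar>)"
    by (simp add: abs_of_nonneg sum_nonneg)
qed

text \<open>After division by the standard deviations the offsets are \<open>x / \<surd>\<Sigma>\<^sub>j\<^sub>j\<close>, at most \<open>x\<^sup>+ / \<sigma>\<close>. The factor
  \<open>x\<^sup>+\<close> that they contribute is absorbed by Markov's inequality \<open>x P (max > x) \<le> E max\<^sup>+\<close> for \<open>x > 0\<close>.\<close>

lemma gaussian_max_anticoncentration:
  assumes G: "centered_gaussian p \<Sigma> \<mu>" and p: "1 \<le> p" and \<sigma>: "0 < \<sigma>"
    and var: "\<And>j. j \<in> {1..p} \<Longrightarrow> \<sigma>\<^sup>2 \<le> \<Sigma> j j" and \<eta>: "0 < \<eta>"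
  shows "measure \<mu> {y \<in> space \<mu>. x < vec_max p y \<and> vec_max p y \<le> x + \<eta>}
    \<le> 2 * exp 1 * (\<eta> / \<sigma>) * (2 + (\<integral>y. max 0 (vec_max p y) \<partial>\<mu>) / \<sigma>)"
proof -
  note g = centered_gaussianD[OF G]
  note [measurable_cong] = g(1)
  interpret prob_space \<mu> by (rule g(2))
  have vm[measurable]: "vec_max p \<in> borel_measurable (real_vec p)" by (rule measurable_vec_max[OF p])
  define m where "m = (\<integral>y. max 0 (vec_max p y) \<partial>\<mu>)"
  have mi: "integrable \<mu> (\<lambda>y. max 0 (vec_max p y))"
    using integrable_gaussian_vec_max[OF G p] by simp
  have m0: "0 \<le> m" unfolding m_def by (intro integral_nonneg_AE) simp
  show ?thesis
  proof (cases "1 < \<eta> / \<sigma>")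
    case True
    have "1 \<le> exp (1::real)" by simp
    then have "1 * 1 * 1 * 1 \<le> 2 * exp 1 * (\<eta> / \<sigma>) * (2 + m / \<sigma>)"
      using True m0 \<sigma> by (intro mult_mono) (auto intro: add_increasing2)
    moreover have "measure \<mu> {y \<in> space \<mu>. x < vec_max p y \<and> vec_max p y \<le> x + \<eta>} \<le> 1" by simp
    ultimately show ?thesis unfolding m_def by linarith
  next
    case False
    define s where "s j = 1 / sqrt (\<Sigma> j j)" for j
    have spos: "0 < s j" and s1: "s j \<le> 1 / \<sigma>" and ss: "s j * s j * \<Sigma> j j = 1" if j: "j \<in> {1..p}" for j
    proof -
      have "0 < \<Sigma> j j" using var[OF j] \<sigma> by (smt (verit) zero_less_power)
      then show "0 < s j" "s j * s j * \<Sigma> j j = 1" by (simp_all add: s_def)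
      have "\<sigma> \<le> sqrt (\<Sigma> j j)" using var[OF j] by (rule real_le_rsqrt)
      then show "s j \<le> 1 / \<sigma>" using \<sigma> by (simp add: s_def frac_le)
    qed
    let ?R = "\<lambda>j k. s j * s k * \<Sigma> j k"
    let ?S = "\<lambda>y. \<lambda>j\<in>{1..p}. s j * y j"
    let ?\<nu> = "distr \<mu> (real_vec p) ?S"
    have law: "gaussian_law p ?R ?\<nu>"
      by (rule gaussian_law_scale[OF gaussian_law_centered_gaussian[OF G]])
    have R1: "?R i j \<le> 1" if i: "i \<in> {1..p}" and j: "j \<in> {1..p}" for i j
    proof -
      have "(?R i j)\<^sup>2 = (s i * s j)\<^sup>2 * (\<Sigma> i j)\<^sup>2" by (simp add: power_mult_distrib)
      also have "\<dots> \<le> (s i * s j)\<^sup>2 * (\<Sigma> i i * \<Sigma> j j)"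
        by (intro mult_left_mono centered_gaussian_moments(6)[OF G i j]) auto
      also have "\<dots> = (s i * s i * \<Sigma> i i) * (s j * s j * \<Sigma> j j)" by (simp add: power2_eq_square mult_ac)
      also have "\<dots> = 1" using ss i j by simp
      finally have "\<bar>?R i j\<bar> \<le> 1" by (simp add: abs_square_le_1)
      then show ?thesis by simp
    qed
    define b where "b j = x * s j" for j
    define B where "B = max 0 x / \<sigma>"
    have B: "b j \<le> B" if "j \<in> {1..p}" for j
    proof -
      have "x * s j \<le> max 0 x * s j" using spos[OF that] by (intro mult_right_mono) auto
      also have "\<dots> \<le> max 0 x * (1 / \<sigma>)" by (intro mult_left_mono s1 that) auto
      finally show ?thesis by (simp add: b_def B_def)
    qed
    have B0: "0 \<le> B" using \<sigma> by (simp add: B_def)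
    have Sm[measurable]: "?S \<in> \<mu> \<rightarrow>\<^sub>M real_vec p"
      by (intro measurable_restrict) measurable
    define d where "d = \<eta> / \<sigma>"
    have d: "0 < d" "0 + d \<le> 1" using \<eta> \<sigma> False by (auto simp: d_def)
    let ?T = "{y \<in> space (real_vec p). \<exists>k\<in>{1..p}. 0 < y k - b k}"
    have win: "measure ?\<nu> (max_window p b 0 (0 + d)) \<le> 2 * exp 1 * d * (B + 2) * measure ?\<nu> ?T"
      by (rule max_window_le_tail[OF law _ _ R1 B B0 d]) (use ss g(5) in \<open>auto simp: mult_ac\<close>)
    have Tm: "?T \<in> sets (real_vec p)" by measurable
    have t: "measure ?\<nu> ?T = measure \<mu> {y \<in> space \<mu>. x < vec_max p y}"
    proof (subst measure_distr[OF Sm Tm], rule arg_cong[of _ _ "measure \<mu>"])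
      have "(\<exists>k\<in>{1..p}. 0 < ?S y k - b k) \<longleftrightarrow> x < vec_max p y" for y
        unfolding less_vec_max_iff[OF p]
        by (rule bex_cong) (use spos in \<open>auto simp: b_def mult.commute\<close>)
      then show "?S -` ?T \<inter> space \<mu> = {y \<in> space \<mu>. x < vec_max p y}"
        using measurable_space[OF Sm] by auto
    qed
    have w: "measure \<mu> {y \<in> space \<mu>. x < vec_max p y \<and> vec_max p y \<le> x + \<eta>} \<le> measure ?\<nu> (max_window p b 0 (0 + d))"
    proof (subst measure_distr[OF Sm sets_max_window], rule finite_measure_mono)
      show "{y \<in> space \<mu>. x < vec_max p y \<and> vec_max p y \<le> x + \<eta>} \<subseteq> ?S -` max_window p b 0 (0 + d) \<inter> space \<mu>"
      proof
        fix y assume "y \<in> {y \<in> space \<mu>. x < vec_max p y \<and> vec_max p y \<le> x + \<eta>}"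
        then have y: "y \<in> space \<mu>" "\<exists>k\<in>{1..p}. x < y k" "\<forall>k\<in>{1..p}. y k \<le> x + \<eta>"
          by (simp_all add: less_vec_max_iff[OF p] vec_max_le_iff[OF p])
        have "\<exists>k\<in>{1..p}. 0 < ?S y k - b k"
          using y(2) by (rule bexE) (rule bexI, use spos in \<open>auto simp: b_def mult.commute\<close>)
        moreover have "?S y k - b k \<le> 0 + d" if k: "k \<in> {1..p}" for k
        proof -
          have "s k * (y k - x) \<le> s k * \<eta>" using bspec[OF y(3) k] spos[OF k] by (intro mult_left_mono) linarith+
          also have "\<dots> \<le> 1 / \<sigma> * \<eta>" using s1[OF k] \<eta> by (intro mult_right_mono) auto
          finally show ?thesis using k by (simp add: b_def d_def algebra_simps)
        qed
        ultimately show "y \<in> ?S -` max_window p b 0 (0 + d) \<inter> space \<mu>"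
          using measurable_space[OF Sm y(1)] y(1) unfolding max_window_def by blast
      qed
      show "?S -` max_window p b 0 (0 + d) \<inter> space \<mu> \<in> sets \<mu>"
        by (rule measurable_sets[OF Sm sets_max_window])
    qed
    have Bt: "B * measure \<mu> {y \<in> space \<mu>. x < vec_max p y} \<le> m / \<sigma>"
    proof (cases "0 < x")
      case True
      have "measure \<mu> {y \<in> space \<mu>. x < vec_max p y} \<le> measure \<mu> {y \<in> space \<mu>. x \<le> max 0 (vec_max p y)}"
        by (rule finite_measure_mono) auto
      also have "\<dots> \<le> m / x"
        unfolding m_def by (rule integral_Markov_inequality_measure[OF mi, of "space \<mu>" x, simplified]) (use True in auto)
      finally show ?thesis using True \<sigma> by (simp add: B_def field_simps)
    qed (use m0 \<sigma> in \<open>simp add: B_def max_def\<close>)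
    have "measure \<mu> {y \<in> space \<mu>. x < vec_max p y \<and> vec_max p y \<le> x + \<eta>}
        \<le> 2 * exp 1 * d * (B * measure \<mu> {y \<in> space \<mu>. x < vec_max p y} + 2 * measure \<mu> {y \<in> space \<mu>. x < vec_max p y})"
      using w win unfolding t by (simp add: algebra_simps)
    also have "\<dots> \<le> 2 * exp 1 * d * (m / \<sigma> + 2 * 1)"
      using d(1) Bt by (intro mult_left_mono add_mono) auto
    finally show ?thesis unfolding m_def d_def by (simp add: add.commute)
  qed
qed

text \<open>The negative part of the maximum is at most the negative part of the first coordinate, whose mean
  is controlled by its second moment.\<close>

lemma gaussian_max_positive_part_le:
  assumes G: "centered_gaussian p \<Sigma> \<mu>" and p: "1 \<le> p" and C: "\<Sigma> 1 1 \<le> C"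
  shows "(\<integral>y. max 0 (vec_max p y) \<partial>\<mu>) \<le> (\<integral>y. vec_max p y \<partial>\<mu>) + 1 + C"
proof -
  interpret prob_space \<mu> by (rule centered_gaussianD(2)[OF G])
  have 1: "1 \<in> {1..p}" using p by simp
  note mo = centered_gaussian_moments(3,4)[OF G 1 1]
  note vi = integrable_gaussian_vec_max[OF G p]
  have "(\<integral>y. max 0 (vec_max p y) \<partial>\<mu>) \<le> (\<integral>y. vec_max p y + (1 + y 1 * y 1) \<partial>\<mu>)"
  proof (rule integral_mono)
    show "integrable \<mu> (\<lambda>y. vec_max p y + (1 + y 1 * y 1))"
      using vi mo(1) by simp
    show "max 0 (vec_max p y) \<le> vec_max p y + (1 + y 1 * y 1)" for y
    proof -
      have "y 1 \<le> vec_max p y" unfolding vec_max_def using 1 by (intro Max_ge) auto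
      moreover have "0 \<le> (y 1 + 1/2)\<^sup>2" by simp
      then have "- y 1 \<le> 1 + y 1 * y 1" by (simp add: power2_eq_square algebra_simps)
      moreover have "0 \<le> y 1 * y 1" by simp
      ultimately show ?thesis by linarith
    qed
  qed (use vi in simp)
  also have "\<dots> = (\<integral>y. vec_max p y \<partial>\<mu>) + 1 + \<Sigma> 1 1"
    using vi mo by (simp add: prob_space)
  finally show ?thesis using C by linarith
qed

lemma soft_max_bounds:
  assumes p: "1 \<le> p" and \<beta>: "0 < \<beta>"
  shows "vec_max p y \<le> soft_max p \<beta> y" "soft_max p \<beta> y \<le> vec_max p y + ln (real p) / \<beta>"
proof -
  have "vec_max p y \<in> y ` {1..p}" unfolding vec_max_def using p by (intro Max_in) auto
  then obtain k where k: "k \<in> {1..p}" "vec_max p y = y k" by auto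
  have S: "0 < (\<Sum>j=1..p. exp (\<beta> * y j))" by (rule sum_exp_pos[OF p])
  have "exp (\<beta> * y k) \<le> (\<Sum>j=1..p. exp (\<beta> * y j))" by (rule member_le_sum[OF k(1)]) auto
  then have "\<beta> * y k \<le> ln (\<Sum>j=1..p. exp (\<beta> * y j))" using S by (simp add: ln_ge_iff)
  then show "vec_max p y \<le> soft_max p \<beta> y"
    unfolding k(2) soft_max_def using \<beta> by (simp add: pos_le_divide_eq mult.commute)
  have "(\<Sum>j=1..p. exp (\<beta> * y j)) \<le> (\<Sum>j=1..p. exp (\<beta> * vec_max p y))"
    using \<beta> unfolding vec_max_def by (intro sum_mono) auto
  also have "\<dots> = exp (ln (real p) + \<beta> * vec_max p y)" using p by (simp add: exp_add)
  finally have "ln (\<Sum>j=1..p. exp (\<beta> * y j)) \<le> ln (real p) + \<beta> * vec_max p y"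
    using S by (metis ln_le_cancel_iff exp_gt_zero ln_exp)
  then show "soft_max p \<beta> y \<le> vec_max p y + ln (real p) / \<beta>"
    unfolding soft_max_def using \<beta> by (simp add: field_simps)
qed

text \<open>The soft maximum exceeds the maximum by at most \<open>\<delta>\<close> for this choice of \<open>\<beta>\<close>; a distance \<open>\<delta>\<close> from
  the center \<open>x + 2 \<delta>\<close> on either side brings the logistic function within \<open>e\<^sup>-\<^sup>K\<close> of its limits.\<close>

lemma soft_step_sandwich:
  fixes x K \<delta> :: real
  assumes p: "2 \<le> p" and K: "0 < K" and \<delta>: "0 < \<delta>"
  defines "f \<equiv> soft_step p (K / \<delta>) (ln (real p) / \<delta>) (x + 2 * \<delta>)"
  shows "vec_max p y \<le> x \<Longrightarrow> 1 - exp (- K) \<le> f y" and "x + 3 * \<delta> < vec_max p y \<Longrightarrow> f y \<le> exp (- K)"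
proof -
  have lp: "0 < ln (real p)" using p by simp
  let ?F = "soft_max p (ln (real p) / \<delta>) y"
  have F: "vec_max p y \<le> ?F" "?F \<le> vec_max p y + \<delta>"
    using soft_max_bounds[of p "ln (real p) / \<delta>" y] p lp \<delta> by auto
  {
    assume "vec_max p y \<le> x"
    then have "(K / \<delta>) * (?F - (x + 2 * \<delta>)) \<le> (K / \<delta>) * (- \<delta>)" using F K \<delta> by (intro mult_left_mono) auto
    then have "exp ((K / \<delta>) * (?F - (x + 2 * \<delta>))) \<le> exp (- K)" using \<delta> by simp
    then have "1 / (1 + exp (- K)) \<le> f y"
      unfolding f_def soft_step_def by (intro divide_left_mono) (auto simp: add_pos_pos)
    moreover have "1 - exp (- K) \<le> 1 / (1 + exp (- K))"
    proof -
      have "1 - e \<le> 1 / (1 + e)" if "0 < e" for e :: real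
        using that by (subst pos_le_divide_eq) (auto simp: algebra_simps)
      then show ?thesis by simp
    qed
    ultimately show "1 - exp (- K) \<le> f y" by linarith
  next
    assume "x + 3 * \<delta> < vec_max p y"
    then have "(K / \<delta>) * \<delta> \<le> (K / \<delta>) * (?F - (x + 2 * \<delta>))" using F K \<delta> by (intro mult_left_mono) auto
    then have "exp K \<le> 1 + exp ((K / \<delta>) * (?F - (x + 2 * \<delta>)))"
      using \<delta> by (intro order_trans[OF _ add_increasing[of 1, OF _ order_refl]]) auto
    then have "f y \<le> 1 / exp K"
      unfolding f_def soft_step_def by (intro divide_left_mono) (auto simp: add_pos_pos)
    then show "f y \<le> exp (- K)" by (simp add: exp_minus inverse_eq_divide)
  }
qed

lemma soft_step_integral_sandwich:
  fixes x K \<delta> :: real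
  assumes p: "2 \<le> p" and K: "0 < K" and \<delta>: "0 < \<delta>"
    and \<mu>: "prob_space \<mu>" "sets \<mu> = sets (real_vec p)"
  defines "f \<equiv> soft_step p (K / \<delta>) (ln (real p) / \<delta>) (x + 2 * \<delta>)"
  shows "measure \<mu> {y \<in> space \<mu>. vec_max p y \<le> x} \<le> (\<integral>y. f y \<partial>\<mu>) + exp (- K)"
    and "(\<integral>y. f y \<partial>\<mu>) \<le> measure \<mu> {y \<in> space \<mu>. vec_max p y \<le> x + 3 * \<delta>} + exp (- K)"
proof -
  interpret prob_space \<mu> by fact
  note [measurable_cong] = \<mu>(2)
  have [measurable]: "vec_max p \<in> borel_measurable (real_vec p)" using p by (intro measurable_vec_max) simp
  have f01: "0 < f y" "f y < 1" for y unfolding f_def by (rule soft_step_bounds)+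
  have fm: "f \<in> borel_measurable \<mu>" unfolding f_def by measurable
  have fi: "integrable \<mu> f"
    by (rule integrable_const_bound[where B=1, OF _ fm]) (use f01 in \<open>auto simp: abs_of_pos less_imp_le\<close>)
  let ?I = "\<lambda>t. {y \<in> space \<mu>. vec_max p y \<le> t}"
  have ii: "integrable \<mu> (indicator (?I t) :: _ \<Rightarrow> real)" "(\<integral>y. indicator (?I t) y \<partial>\<mu>) = measure \<mu> (?I t)" for t
    by (auto simp: emeasure_eq_measure)
  have "(\<integral>y. indicator (?I x) y \<partial>\<mu>) \<le> (\<integral>y. f y + exp (- K) \<partial>\<mu>)"
  proof (rule integral_mono)
    show "indicator (?I x) y \<le> f y + exp (- K)" for y
      using soft_step_sandwich(1)[OF p K \<delta>, of y x, folded f_def] f01(1)[of y]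
      by (auto simp: indicator_def intro: add_nonneg_nonneg less_imp_le)
  qed (use fi ii in auto)
  then show "measure \<mu> (?I x) \<le> (\<integral>y. f y \<partial>\<mu>) + exp (- K)"
    using fi by (simp add: ii prob_space)
  have "(\<integral>y. f y \<partial>\<mu>) \<le> (\<integral>y. indicator (?I (x + 3 * \<delta>)) y + exp (- K) \<partial>\<mu>)"
  proof (rule integral_mono)
    show "f y \<le> indicator (?I (x + 3 * \<delta>)) y + exp (- K)" if "y \<in> space \<mu>" for y
      using soft_step_sandwich(2)[OF p K \<delta>, of x y, folded f_def] f01(2)[of y] that
      by (auto simp: indicator_def not_le intro: order_trans[OF less_imp_le])
  qed (use fi ii in auto)
  then show "(\<integral>y. f y \<partial>\<mu>) \<le> measure \<mu> (?I (x + 3 * \<delta>)) + exp (- K)"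
    using ii by (simp add: prob_space)
qed

lemma gaussian_max_comparison:
  assumes X: "centered_gaussian p \<Sigma> \<mu>" and Y: "centered_gaussian p \<Sigma>' \<nu>" and p: "2 \<le> p"
    and \<sigma>: "0 < \<sigma>" and var: "\<And>j. j \<in> {1..p} \<Longrightarrow> \<sigma>\<^sup>2 \<le> \<Sigma>' j j"
    and D: "\<And>j k. j \<in> {1..p} \<Longrightarrow> k \<in> {1..p} \<Longrightarrow> \<bar>\<Sigma> j k - \<Sigma>' j k\<bar> \<le> \<Delta>"
    and K: "0 < K" and \<delta>: "0 < \<delta>"
  shows "\<bar>measure \<mu> {y \<in> space \<mu>. vec_max p y \<le> x} - measure \<nu> {y \<in> space \<nu>. vec_max p y \<le> x}\<bar>
    \<le> 2 * exp (- K) + (2 * K * ln (real p) + K\<^sup>2) * \<Delta> / (2 * \<delta>\<^sup>2)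
      + 2 * exp 1 * (3 * \<delta> / \<sigma>) * (2 + (\<integral>y. max 0 (vec_max p y) \<partial>\<nu>) / \<sigma>)"
    (is "_ \<le> _ + ?E + ?A")
proof -
  note gx = centered_gaussianD(1,2)[OF X] and gy = centered_gaussianD(1,2)[OF Y]
  interpret \<nu>: prob_space \<nu> by fact
  note [measurable_cong] = gy(1)
  have p1: "1 \<le> p" using p by simp
  have [measurable]: "vec_max p \<in> borel_measurable (real_vec p)" by (rule measurable_vec_max[OF p1])
  have lp: "0 < ln (real p)" using p by simp
  let ?PX = "\<lambda>t. measure \<mu> {y \<in> space \<mu>. vec_max p y \<le> t}"
  let ?PY = "\<lambda>t. measure \<nu> {y \<in> space \<nu>. vec_max p y \<le> t}"
  let ?f = "\<lambda>x. soft_step p (K / \<delta>) (ln (real p) / \<delta>) (x + 2 * \<delta>)"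
  have cmp: "\<bar>(\<integral>y. ?f x y \<partial>\<mu>) - (\<integral>y. ?f x y \<partial>\<nu>)\<bar> \<le> ?E" for x
  proof -
    have "\<bar>(\<integral>y. ?f x y \<partial>\<mu>) - (\<integral>y. ?f x y \<partial>\<nu>)\<bar>
        \<le> (2 * (K / \<delta>) * (ln (real p) / \<delta>) + (K / \<delta>)\<^sup>2) * \<Delta> / 2"
      using K \<delta> lp by (intro gaussian_soft_step_comparison[OF X Y p1 _ _ D]) auto
    also have "\<dots> = ?E" using \<delta> by (simp add: field_simps power2_eq_square)
    finally show ?thesis .
  qed
  have anti: "?PY (t + 3 * \<delta>) \<le> ?PY t + ?A" for t
  proof -
    have "?PY (t + 3 * \<delta>) \<le> measure \<nu> ({y \<in> space \<nu>. vec_max p y \<le> t} \<union> {y \<in> space \<nu>. t < vec_max p y \<and> vec_max p y \<le> t + 3 * \<delta>})"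
      by (rule \<nu>.finite_measure_mono) auto
    also have "\<dots> \<le> ?PY t + measure \<nu> {y \<in> space \<nu>. t < vec_max p y \<and> vec_max p y \<le> t + 3 * \<delta>}"
      by (rule measure_Un_le) measurable
    also have "measure \<nu> {y \<in> space \<nu>. t < vec_max p y \<and> vec_max p y \<le> t + 3 * \<delta>} \<le> ?A"
      using gaussian_max_anticoncentration[OF Y p1 \<sigma> var, of "3 * \<delta>" t] \<delta> by simp
    finally show ?thesis by simp
  qed
  note sx = soft_step_integral_sandwich[OF p K \<delta> gx(2,1)]
  note sy = soft_step_integral_sandwich[OF p K \<delta> gy(2,1)]
  \<comment> \<open>The upper bound uses the test function centered at \<open>x + 2 \<delta>\<close>, the lower bound the one centered
    at \<open>x - \<delta>\<close>.\<close>
  have "?PX x \<le> ?PY x + (2 * exp (- K) + ?E + ?A)"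
    using sx(1)[of x] cmp[of x] sy(2)[of x] anti[of x] by linarith
  moreover have "?PY x \<le> ?PX x + (2 * exp (- K) + ?E + ?A)"
    using sy(1)[of "x - 3 * \<delta>"] cmp[of "x - 3 * \<delta>"] sx(2)[of "x - 3 * \<delta>"] anti[of "x - 3 * \<delta>"] by simp
  ultimately show ?thesis by (simp add: abs_le_iff)
qed

text \<open>The parameters are chosen in the order \<open>K\<close>, \<open>\<delta>\<close>, \<open>\<tau>\<close>. The bound holds simultaneously for all dimensions,
  which is what a sequence with growing \<open>p\<close> requires.\<close>

lemma gaussian_max_comparison_uniform:
  assumes \<sigma>: "0 < \<sigma>" and \<epsilon>: "0 < \<epsilon>"
  obtains \<tau> where "0 < \<tau>" and
    "\<And>p \<Sigma> \<mu> \<Sigma>' \<nu> \<Delta> x. \<lbrakk>centered_gaussian p \<Sigma> \<mu>; centered_gaussian p \<Sigma>' \<nu>; 2 \<le> p;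
        \<And>j. j \<in> {1..p} \<Longrightarrow> \<sigma>\<^sup>2 \<le> \<Sigma>' j j;
        \<And>j k. j \<in> {1..p} \<Longrightarrow> k \<in> {1..p} \<Longrightarrow> \<bar>\<Sigma> j k - \<Sigma>' j k\<bar> \<le> \<Delta>;
        \<Delta> * ln (real p) * (1 + (\<integral>y. max 0 (vec_max p y) \<partial>\<nu>))\<^sup>2 \<le> \<tau>\<rbrakk>
      \<Longrightarrow> \<bar>measure \<mu> {y \<in> space \<mu>. vec_max p y \<le> x} - measure \<nu> {y \<in> space \<nu>. vec_max p y \<le> x}\<bar> \<le> \<epsilon>"
proof -
  \<comment> \<open>\<open>K\<close> makes the two logistic tails together at most \<open>\<epsilon> / 4\<close>; \<open>A \<delta> (1 + m)\<close> bounds the anti-concentration term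
    and \<open>C \<tau>\<close> the smoothing term, where \<open>m\<close> is the mean of the positive part of the maximum.\<close>
  define K where "K = max 1 (ln (8 / \<epsilon>))"
  have K: "0 < K" by (simp add: K_def)
  have "exp (- K) \<le> exp (- ln (8 / \<epsilon>))" by (simp add: K_def)
  also have "\<dots> = \<epsilon> / 8" using \<epsilon> by (simp add: exp_minus)
  finally have eK: "2 * exp (- K) \<le> \<epsilon> / 4" by simp
  define A where "A = 6 * exp 1 / \<sigma> * (2 + 1 / \<sigma>)"
  have A: "0 < A" using \<sigma> by (simp add: A_def add_pos_pos)
  define \<theta> where "\<theta> = \<epsilon> / (4 * A)"
  have \<theta>: "0 < \<theta>" using A \<epsilon> by (simp add: \<theta>_def)
  define C where "C = (2 * K + K\<^sup>2 / ln 2) / (2 * \<theta>\<^sup>2)"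
  have C: "0 < C" using K \<theta> by (simp add: C_def add_pos_pos)
  show ?thesis
  proof (rule that[of "\<epsilon> / (4 * C)"])
    show "0 < \<epsilon> / (4 * C)" using C \<epsilon> by simp
    fix p \<Sigma> \<mu> \<Sigma>' \<nu> \<Delta> x
    assume X: "centered_gaussian p \<Sigma> \<mu>" and Y: "centered_gaussian p \<Sigma>' \<nu>" and p: "2 \<le> p"
      and var: "\<And>j. j \<in> {1..p} \<Longrightarrow> \<sigma>\<^sup>2 \<le> \<Sigma>' j j"
      and D: "\<And>j k. j \<in> {1..p} \<Longrightarrow> k \<in> {1..p} \<Longrightarrow> \<bar>\<Sigma> j k - \<Sigma>' j k\<bar> \<le> \<Delta>"
      and small: "\<Delta> * ln (real p) * (1 + (\<integral>y. max 0 (vec_max p y) \<partial>\<nu>))\<^sup>2 \<le> \<epsilon> / (4 * C)"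
    define m where "m = (\<integral>y. max 0 (vec_max p y) \<partial>\<nu>)"
    have m: "0 \<le> m" unfolding m_def by (intro integral_nonneg_AE) simp
    have \<Delta>: "0 \<le> \<Delta>" using D[of 1 1] p by fastforce
    define \<delta> where "\<delta> = \<theta> / (1 + m)"
    have \<delta>: "0 < \<delta>" using \<theta> m by (simp add: \<delta>_def)
    have lp: "ln 2 \<le> ln (real p)" using p by simp
    have "(2 * K * ln (real p) + K\<^sup>2) * \<Delta> / (2 * \<delta>\<^sup>2) \<le> ((2 * K + K\<^sup>2 / ln 2) * ln (real p)) * \<Delta> / (2 * \<delta>\<^sup>2)"
    proof (intro divide_right_mono mult_right_mono \<Delta>)
      have "K\<^sup>2 * 1 \<le> K\<^sup>2 * (ln (real p) / ln 2)" using lp by (intro mult_left_mono) (auto simp: field_simps)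
      then show "2 * K * ln (real p) + K\<^sup>2 \<le> (2 * K + K\<^sup>2 / ln 2) * ln (real p)"
        by (simp add: algebra_simps)
    qed simp
    also have "\<dots> = C * (\<Delta> * ln (real p) * (1 + m)\<^sup>2)"
      using \<theta> m by (simp add: C_def \<delta>_def power_divide)
    also have "\<dots> \<le> C * (\<epsilon> / (4 * C))"
      using small C unfolding m_def by (intro mult_left_mono) auto
    also have "\<dots> = \<epsilon> / 4" using C by simp
    finally have E: "(2 * K * ln (real p) + K\<^sup>2) * \<Delta> / (2 * \<delta>\<^sup>2) \<le> \<epsilon> / 4" .
    have "2 * exp 1 * (3 * \<delta> / \<sigma>) * (2 + m / \<sigma>) \<le> 2 * exp 1 * (3 * \<delta> / \<sigma>) * ((2 + 1 / \<sigma>) * (1 + m))"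
    proof (rule mult_left_mono)
      have "(2 + 1 / \<sigma>) * (1 + m) = (2 + m / \<sigma>) + (2 * m + 1 / \<sigma>)"
        by (simp add: ring_distribs add_divide_distrib)
      then show "2 + m / \<sigma> \<le> (2 + 1 / \<sigma>) * (1 + m)" using m \<sigma> by simp
    qed (use \<delta> \<sigma> in simp)
    also have "\<dots> = A * (\<delta> * (1 + m))" using \<sigma> by (simp add: A_def)
    also have "\<dots> = \<epsilon> / 4" using m A by (simp add: \<delta>_def \<theta>_def)
    finally have F: "2 * exp 1 * (3 * \<delta> / \<sigma>) * (2 + m / \<sigma>) \<le> \<epsilon> / 4" .
    show "\<bar>measure \<mu> {y \<in> space \<mu>. vec_max p y \<le> x} - measure \<nu> {y \<in> space \<nu>. vec_max p y \<le> x}\<bar> \<le> \<epsilon>"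
      using gaussian_max_comparison[OF X Y p \<sigma> var D K \<delta>, of x] eK E F \<epsilon> unfolding m_def by linarith
  qed
qed

section \<open>Conditional laws and convergence in probability\<close>

text \<open>Turns the supremum in the theorem into a countable one, for measurability and for exchanging it with
  almost sure statements.\<close>

lemma SUP_rationals_eq:
  fixes h :: "real \<Rightarrow> real"
  assumes cont: "\<And>x. continuous (at_right x) h" and bd: "\<And>x. h x \<le> B"
  shows "(SUP x. h x) = (SUP q\<in>\<rat>. h q)"
proof (rule antisym)
  have bdd: "bdd_above (h ` A)" for A using bd by (auto simp: bdd_above_def)
  show "(SUP q\<in>\<rat>. h q) \<le> (SUP x. h x)"
    by (rule cSUP_subset_mono[OF _ bdd]) (auto intro: exI[of _ 0])
  show "(SUP x. h x) \<le> (SUP q\<in>\<rat>. h q)"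
  proof (rule cSUP_least)
    fix x :: real
    show "h x \<le> (SUP q\<in>\<rat>. h q)"
    proof (rule ccontr)
      assume "\<not> ?thesis"
      then have "\<forall>\<^sub>F y in at_right x. (SUP q\<in>\<rat>. h q) < h y"
        using cont[of x] unfolding continuous_within by (intro order_tendstoD(1)) auto
      then obtain b where b: "b > x" "\<forall>y>x. y < b \<longrightarrow> (SUP q\<in>\<rat>. h q) < h y"
        unfolding eventually_at_right_field by blast
      obtain q where q: "q \<in> \<rat>" "x < q" "q < b" using Rats_dense_in_real[OF b(1)] by blast
      then have "h q \<le> (SUP q\<in>\<rat>. h q)" by (intro cSUP_upper bdd)
      then show False using b(2) q by fastforce
    qed
  qed simp
qed

abbreviation (input) max_cdf :: "nat \<Rightarrow> (nat \<Rightarrow> real) measure \<Rightarrow> real \<Rightarrow> real" where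
  "max_cdf p \<mu> x \<equiv> measure \<mu> {y \<in> space (real_vec p). vec_max p y \<le> x}"

lemma space_real_vec_law: "sets \<mu> = sets (real_vec p) \<Longrightarrow> space \<mu> = space (real_vec p)"
  by (rule sets_eq_imp_space_eq)

lemma max_cdf_right_continuous:
  assumes \<mu>: "prob_space \<mu>" "sets \<mu> = sets (real_vec p)" and p: "1 \<le> p"
  shows "continuous (at_right x) (max_cdf p \<mu>)"
proof -
  interpret prob_space \<mu> by fact
  note [measurable_cong] = \<mu>(2)
  have [measurable]: "vec_max p \<in> borel_measurable (real_vec p)" by (rule measurable_vec_max[OF p])
  interpret D: real_distribution "distr \<mu> borel (vec_max p)"
    by (rule real_distribution_distr) measurable
  have "max_cdf p \<mu> = cdf (distr \<mu> borel (vec_max p))"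
  proof
    fix x
    have "cdf (distr \<mu> borel (vec_max p)) x = measure \<mu> (vec_max p -` {..x} \<inter> space \<mu>)"
      unfolding cdf_def by (rule measure_distr) measurable
    also have "vec_max p -` {..x} \<inter> space \<mu> = {y \<in> space (real_vec p). vec_max p y \<le> x}"
      using space_real_vec_law[OF \<mu>(2)] by auto
    finally show "max_cdf p \<mu> x = cdf (distr \<mu> borel (vec_max p)) x" ..
  qed
  then show ?thesis using D.cdf_is_right_cont by simp
qed

lemma max_cdf_diff_le_one:
  assumes "prob_space \<mu>" "prob_space \<nu>"
  shows "\<bar>max_cdf p \<mu> x - max_cdf p \<nu> x\<bar> \<le> 1"
  using prob_space.prob_le_1[OF assms(1)] prob_space.prob_le_1[OF assms(2)]
  by (simp add: abs_le_iff add_increasing2 algebra_simps)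

lemma SUP_max_cdf_diff_rationals:
  assumes \<mu>: "prob_space \<mu>" "sets \<mu> = sets (real_vec p)" and \<nu>: "prob_space \<nu>" "sets \<nu> = sets (real_vec p)"
    and p: "1 \<le> p"
  shows "(SUP x. \<bar>max_cdf p \<mu> x - max_cdf p \<nu> x\<bar>) = (SUP q\<in>\<rat>. \<bar>max_cdf p \<mu> q - max_cdf p \<nu> q\<bar>)"
  by (rule SUP_rationals_eq[where B=1])
     (intro continuous_intros max_cdf_right_continuous[OF \<mu> p] max_cdf_right_continuous[OF \<nu> p],
      rule max_cdf_diff_le_one[OF \<mu>(1) \<nu>(1)])

lemma measurable_SUP_max_cdf_diff:
  assumes \<kappa>: "\<kappa> \<in> M \<rightarrow>\<^sub>M prob_algebra (real_vec p)"
    and \<nu>: "prob_space \<nu>" "sets \<nu> = sets (real_vec p)" and p: "1 \<le> p"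
  shows "(\<lambda>\<omega>. SUP x. \<bar>max_cdf p (\<kappa> \<omega>) x - max_cdf p \<nu> x\<bar>) \<in> borel_measurable M"
proof -
  have [measurable]: "vec_max p \<in> borel_measurable (real_vec p)" by (rule measurable_vec_max[OF p])
  have k: "prob_space (\<kappa> \<omega>)" "sets (\<kappa> \<omega>) = sets (real_vec p)" if "\<omega> \<in> space M" for \<omega>
    using measurable_space[OF \<kappa> that] by (auto simp: space_prob_algebra)
  have m: "(\<lambda>\<omega>. max_cdf p (\<kappa> \<omega>) q) \<in> borel_measurable M" for q
    by (rule measurable_compose[OF measurable_prob_algebraD[OF \<kappa>]]) measurable
  have "(\<lambda>\<omega>. SUP q\<in>\<rat>. \<bar>max_cdf p (\<kappa> \<omega>) q - max_cdf p \<nu> q\<bar>) \<in> borel_measurable M"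
  proof (rule borel_measurable_cSUP)
    show "countable (\<rat> :: real set)" by (rule countable_rat)
    show "bdd_above ((\<lambda>q. \<bar>max_cdf p (\<kappa> \<omega>) q - max_cdf p \<nu> q\<bar>) ` \<rat>)" if "\<omega> \<in> space M" for \<omega>
      using max_cdf_diff_le_one[OF k(1)[OF that] \<nu>(1)] by (auto simp: bdd_above_def)
  qed (use m in measurable)
  then show ?thesis
    by (subst measurable_cong) (rule SUP_max_cdf_diff_rationals[OF k \<nu> p])
qed

lemma subalgebra_vimage_algebra:
  assumes X: "X \<in> M \<rightarrow>\<^sub>M N"
  shows "subalgebra M (vimage_algebra (space M) X N)"
  unfolding subalgebra_def
  by (auto simp: sets_vimage_algebra2 measurable_space[OF X] intro!: measurable_sets[OF X])

lemma regular_cond_distr_prob_space: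
  assumes "regular_cond_distr M F N X \<kappa>" "space F = space M" "\<omega> \<in> space M"
  shows "prob_space (\<kappa> \<omega>)" "sets (\<kappa> \<omega>) = sets N"
proof -
  have "\<kappa> \<in> F \<rightarrow>\<^sub>M prob_algebra N" using assms(1) by (simp add: regular_cond_distr_def)
  then have "\<kappa> \<omega> \<in> space (prob_algebra N)"
    by (rule measurable_space) (simp only: assms(2,3))
  then show "prob_space (\<kappa> \<omega>)" "sets (\<kappa> \<omega>) = sets N"
    by (simp_all add: space_prob_algebra)
qed

lemma regular_cond_distr_AE_eq:
  assumes "regular_cond_distr M F N X \<kappa>" "regular_cond_distr M F N X \<kappa>'"
    and "countable I" "\<And>i. i \<in> I \<Longrightarrow> A i \<in> sets N"
  shows "AE \<omega> in M. \<forall>i\<in>I. measure (\<kappa> \<omega>) (A i) = measure (\<kappa>' \<omega>) (A i)"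
proof -
  have "AE \<omega> in M. measure (\<kappa> \<omega>) (A i) = measure (\<kappa>' \<omega>) (A i)" if "i \<in> I" for i
  proof -
    have "AE \<omega> in M. measure (\<kappa> \<omega>) (A i) = real_cond_exp M F (indicator (X -` A i \<inter> space M)) \<omega>"
      "AE \<omega> in M. measure (\<kappa>' \<omega>) (A i) = real_cond_exp M F (indicator (X -` A i \<inter> space M)) \<omega>"
      using assms that by (auto simp: regular_cond_distr_def)
    then show ?thesis by eventually_elim simp
  qed
  then show ?thesis using assms(3) by (simp add: AE_ball_countable)
qed

lemma empirical_covariance_diff_le_Delta_hat:
  assumes "j \<in> {1..p}" "k \<in> {1..p}"
  shows "\<bar>(1 / real n) * (\<Sum>i=1..n. Z i \<omega> j * Z i \<omega> k) - average_cov M n Z j k\<bar> \<le> Delta_hat M n p Z \<omega>"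
proof -
  let ?f = "\<lambda>(j, k). \<bar>(1 / real n) * (\<Sum>i=1..n. Z i \<omega> j * Z i \<omega> k - integral\<^sup>L M (\<lambda>\<omega>. Z i \<omega> j * Z i \<omega> k))\<bar>"
  have "?f (j, k) \<in> ?f ` ({1..p} \<times> {1..p})" using assms by (intro imageI) auto
  then have "?f (j, k) \<le> Delta_hat M n p Z \<omega>"
    unfolding Delta_hat_def by (intro Max_ge) auto
  then show ?thesis
    by (simp add: average_cov_def sum_subtractf right_diff_distrib)
qed

text \<open>A version of the conditional law need not be Gaussian at any given sample point. Almost surely, though,
  it agrees at all rational arguments with the law obtained by freezing the data, and right-continuity
  extends an estimate for the frozen law to the given version.\<close>

lemma (in prob_space) cond_max_law_AE_close:
  assumes Z: "\<And>i. i \<in> {1..n} \<Longrightarrow> Z i \<in> M \<rightarrow>\<^sub>M real_vec p"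
    and \<eta>: "indep_vars (\<lambda>_. borel) \<eta> {1..n}"
      "\<And>i. i \<in> {1..n} \<Longrightarrow> distributed M lborel (\<eta> i) std_normal_density"
    and ind: "indep_set (sets (generated_algebra M n (real_vec p) Z)) (sets (generated_algebra M n borel \<eta>))"
    and \<kappa>: "regular_cond_distr M (generated_algebra M n (real_vec p) Z) (real_vec p)
        (\<lambda>\<omega>. multiplier_sum n p (\<lambda>i. Z i \<omega>) (\<lambda>i. \<eta> i \<omega>)) \<kappa>"
    and \<nu>: "prob_space \<nu>" "sets \<nu> = sets (real_vec p)" and p: "1 \<le> p"
    and close: "\<And>\<omega> x. \<omega> \<in> space M \<Longrightarrow> small \<omega> \<Longrightarrow>
        \<bar>max_cdf p (distr M (real_vec p) (\<lambda>\<omega>'. multiplier_sum n p (\<lambda>i. Z i \<omega>) (\<lambda>i. \<eta> i \<omega>'))) x - max_cdf p \<nu> x\<bar> \<le> \<epsilon>"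
  shows "AE \<omega> in M. small \<omega> \<longrightarrow> (SUP x. \<bar>max_cdf p (\<kappa> \<omega>) x - max_cdf p \<nu> x\<bar>) \<le> \<epsilon>"
proof -
  let ?F = "generated_algebra M n (real_vec p) Z"
  let ?\<kappa>' = "\<lambda>\<omega>. distr M (real_vec p) (\<lambda>\<omega>'. multiplier_sum n p (\<lambda>i. Z i \<omega>) (\<lambda>i. \<eta> i \<omega>'))"
  have [measurable]: "vec_max p \<in> borel_measurable (real_vec p)" by (rule measurable_vec_max[OF p])
  have "\<And>i. i \<in> {1..n} \<Longrightarrow> \<eta> i \<in> borel_measurable M"
    using \<eta>(1) by (auto simp: indep_vars_def)
  then have \<kappa>': "regular_cond_distr M ?F (real_vec p)
        (\<lambda>\<omega>. multiplier_sum n p (\<lambda>i. Z i \<omega>) (\<lambda>i. \<eta> i \<omega>)) ?\<kappa>'"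
    using Z ind by (intro regular_cond_distr_multiplier_sum) auto
  have "AE \<omega> in M. \<forall>q\<in>\<rat>. max_cdf p (\<kappa> \<omega>) q = max_cdf p (?\<kappa>' \<omega>) q"
    by (rule regular_cond_distr_AE_eq[OF \<kappa> \<kappa>' countable_rat]) measurable
  moreover note k = regular_cond_distr_prob_space[OF \<kappa> space_vimage_algebra]
  ultimately show ?thesis
  proof (elim AE_mp, intro AE_I2 impI)
    fix \<omega> assume \<omega>: "\<omega> \<in> space M" and eq: "\<forall>q\<in>\<rat>. max_cdf p (\<kappa> \<omega>) q = max_cdf p (?\<kappa>' \<omega>) q" and s: "small \<omega>"
    have "(SUP x. \<bar>max_cdf p (\<kappa> \<omega>) x - max_cdf p \<nu> x\<bar>) = (SUP q\<in>\<rat>. \<bar>max_cdf p (\<kappa> \<omega>) q - max_cdf p \<nu> q\<bar>)"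
      by (rule SUP_max_cdf_diff_rationals[OF k[OF \<omega>] \<nu> p])
    also have "\<dots> \<le> \<epsilon>"
      by (rule cSUP_least) (use eq close[OF \<omega> s] in \<open>auto intro: exI[of _ 0]\<close>)
    finally show "(SUP x. \<bar>max_cdf p (\<kappa> \<omega>) x - max_cdf p \<nu> x\<bar>) \<le> \<epsilon>" .
  qed
qed

lemma tendsto_0_in_probD:
  "tendsto_0_in_prob M X \<Longrightarrow> 0 < \<epsilon> \<Longrightarrow> (\<lambda>n. measure (M n) {\<omega> \<in> space (M n). \<bar>X n \<omega>\<bar> > \<epsilon>}) \<longlonglongrightarrow> 0"
  by (simp add: tendsto_0_in_prob_def)

lemma tendsto_0_in_prob_cong:
  fixes X Y :: "nat \<Rightarrow> 'a \<Rightarrow> real"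
  assumes X: "tendsto_0_in_prob M X" and eq: "\<And>n. 1 \<le> n \<Longrightarrow> X n = Y n"
  shows "tendsto_0_in_prob M Y"
  unfolding tendsto_0_in_prob_def
proof (intro conjI allI impI)
  show "Y n \<in> borel_measurable (M n)" if "1 \<le> n" for n
    using X that unfolding tendsto_0_in_prob_def eq[OF that, symmetric] by blast
  show "(\<lambda>n. measure (M n) {\<omega> \<in> space (M n). \<bar>Y n \<omega>\<bar> > \<epsilon>}) \<longlonglongrightarrow> 0" if "0 < \<epsilon>" for \<epsilon>
    by (rule Lim_transform_eventually[OF tendsto_0_in_probD[OF X that]], rule eventually_sequentiallyI[of 1])
       (simp add: eq)
qed

theorem proposition1:
  fixes M :: "nat \<Rightarrow> 'a measure"
    and p :: "nat \<Rightarrow> nat"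
    and Z :: "nat \<Rightarrow> nat \<Rightarrow> 'a \<Rightarrow> nat \<Rightarrow> real"
    and T :: "nat \<Rightarrow> 'a \<Rightarrow> nat \<Rightarrow> real"
    and \<eta> :: "nat \<Rightarrow> nat \<Rightarrow> 'a \<Rightarrow> real"
    and \<kappa> :: "nat \<Rightarrow> 'a \<Rightarrow> (nat \<Rightarrow> real) measure"
    and c\<^sub>1 C\<^sub>1 :: real
  assumes prob: "\<And>n. n \<ge> 1 \<Longrightarrow> prob_space (M n)"
    and dim: "\<And>n. n \<ge> 1 \<Longrightarrow> p n \<ge> 2"
    and Z_indep: "\<And>n. n \<ge> 1 \<Longrightarrow> prob_space.indep_vars (M n) (\<lambda>_. real_vec (p n)) (Z n) {1..n}"
    and Z_cov: "\<And>n i j k. \<lbrakk>n \<ge> 1; i \<in> {1..n}; j \<in> {1..p n}; k \<in> {1..p n}\<rbrakk>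
          \<Longrightarrow> integrable (M n) (\<lambda>\<omega>. Z n i \<omega> j * Z n i \<omega> k)"
    and Z_centered: "\<And>n i j. \<lbrakk>n \<ge> 1; i \<in> {1..n}; j \<in> {1..p n}\<rbrakk>
          \<Longrightarrow> integral\<^sup>L (M n) (\<lambda>\<omega>. Z n i \<omega> j) = 0"
    and T_meas: "\<And>n. n \<ge> 1 \<Longrightarrow> T n \<in> M n \<rightarrow>\<^sub>M real_vec (p n)"
    and T_gauss: "\<And>n. n \<ge> 1 \<Longrightarrow>
          centered_gaussian (p n) (average_cov (M n) n (Z n)) (distr (M n) (real_vec (p n)) (T n))"
    and \<eta>_indep: "\<And>n. n \<ge> 1 \<Longrightarrow> prob_space.indep_vars (M n) (\<lambda>_. borel) (\<eta> n) {1..n}"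
    and \<eta>_std: "\<And>n i. \<lbrakk>n \<ge> 1; i \<in> {1..n}\<rbrakk> \<Longrightarrow> distributed (M n) lborel (\<eta> n i) std_normal_density"
    and \<eta>_Z_indep: "\<And>n. n \<ge> 1 \<Longrightarrow>
          prob_space.indep_set (M n)
            (sets (generated_algebra (M n) n (real_vec (p n)) (Z n)))
            (sets (generated_algebra (M n) n borel (\<eta> n)))"
    and cond_law: "\<And>n. n \<ge> 1 \<Longrightarrow>
          regular_cond_distr (M n) (generated_algebra (M n) n (real_vec (p n)) (Z n)) (real_vec (p n))
            (\<lambda>\<omega>. multiplier_sum n (p n) (\<lambda>i. Z n i \<omega>) (\<lambda>i. \<eta> n i \<omega>)) (\<kappa> n)"
    and c: "0 < c\<^sub>1" "c\<^sub>1 < C\<^sub>1"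
    and var_bounds: "\<And>n j. \<lbrakk>n \<ge> 1; j \<in> {1..p n}\<rbrakk> \<Longrightarrow>
          c\<^sub>1 \<le> (1 / real n) * (\<Sum>i=1..n. integral\<^sup>L (M n) (\<lambda>\<omega>. (Z n i \<omega> j)\<^sup>2)) \<and>
          (1 / real n) * (\<Sum>i=1..n. integral\<^sup>L (M n) (\<lambda>\<omega>. (Z n i \<omega> j)\<^sup>2)) \<le> C\<^sub>1"
    and Delta_max: "tendsto_0_in_prob M (\<lambda>n \<omega>.
          Delta_hat (M n) n (p n) (Z n) \<omega>
            * (integral\<^sup>L (M n) (\<lambda>\<omega>. vec_max (p n) (T n \<omega>)))\<^sup>2 * ln (real (p n)))"
    and Delta_log: "tendsto_0_in_prob M (\<lambda>n \<omega>.
          Delta_hat (M n) n (p n) (Z n) \<omega>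
            * ln (real (p n)) * max 1 (ln (ln (real (p n)))))"
  shows "tendsto_0_in_prob M (\<lambda>n \<omega>.
          SUP x. \<bar>measure (\<kappa> n \<omega>) {y \<in> space (real_vec (p n)). vec_max (p n) y \<le> x}
               - measure (M n) {\<omega>' \<in> space (M n). vec_max (p n) (T n \<omega>') \<le> x}\<bar>)"
proof -
  let ?law = "\<lambda>n. distr (M n) (real_vec (p n)) (T n)"
  let ?D = "\<lambda>n. Delta_hat (M n) n (p n) (Z n)"
  let ?EV = "\<lambda>n. integral\<^sup>L (M n) (\<lambda>\<omega>. vec_max (p n) (T n \<omega>))"
  let ?a = "\<lambda>n \<omega>. ?D n \<omega> * (?EV n)\<^sup>2 * ln (real (p n))"
  let ?b = "\<lambda>n \<omega>. ?D n \<omega> * ln (real (p n)) * max 1 (ln (ln (real (p n))))"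
  let ?S = "\<lambda>n \<omega>. SUP x. \<bar>max_cdf (p n) (\<kappa> n \<omega>) x - max_cdf (p n) (?law n) x\<bar>"
  have p1: "1 \<le> p n" if "n \<ge> 1" for n using dim[OF that] by simp
  have vm: "vec_max (p n) \<in> borel_measurable (real_vec (p n))" if "n \<ge> 1" for n
    by (rule measurable_vec_max[OF p1[OF that]])
  have law: "prob_space (?law n)" "sets (?law n) = sets (real_vec (p n))" if "n \<ge> 1" for n
    using centered_gaussianD(1,2)[OF T_gauss[OF that]] by auto
  have Z_meas: "Z n i \<in> M n \<rightarrow>\<^sub>M real_vec (p n)" if "n \<ge> 1" "i \<in> {1..n}" for n i
    using Z_indep[OF that(1)] that by (auto simp: prob_space.indep_vars_def[OF prob[OF that(1)]])
  have cdf_T: "measure (M n) {\<omega>' \<in> space (M n). vec_max (p n) (T n \<omega>') \<le> x} = max_cdf (p n) (?law n) x"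
    if n: "n \<ge> 1" for n x
  proof -
    note [measurable] = vm[OF n] T_meas[OF n]
    have "max_cdf (p n) (?law n) x = measure (M n) (T n -` {y \<in> space (real_vec (p n)). vec_max (p n) y \<le> x} \<inter> space (M n))"
      by (rule measure_distr) measurable
    also have "T n -` {y \<in> space (real_vec (p n)). vec_max (p n) y \<le> x} \<inter> space (M n)
        = {\<omega>' \<in> space (M n). vec_max (p n) (T n \<omega>') \<le> x}"
      using measurable_space[OF T_meas[OF n]] by auto
    finally show ?thesis ..
  qed
  have S_meas: "?S n \<in> borel_measurable (M n)" if n: "n \<ge> 1" for n
  proof -
    let ?F = "generated_algebra (M n) n (real_vec (p n)) (Z n)"
    have Zr: "(\<lambda>\<omega>. \<lambda>i\<in>{1..n}. Z n i \<omega>) \<in> M n \<rightarrow>\<^sub>M PiM {1..n} (\<lambda>_. real_vec (p n))"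
      using Z_meas[OF n] by (rule measurable_restrict)
    have "subalgebra (M n) ?F" by (rule subalgebra_vimage_algebra[OF Zr])
    moreover have "\<kappa> n \<in> ?F \<rightarrow>\<^sub>M prob_algebra (real_vec (p n))"
      using cond_law[OF n] by (simp add: regular_cond_distr_def)
    ultimately have "\<kappa> n \<in> M n \<rightarrow>\<^sub>M prob_algebra (real_vec (p n))"
      by (rule measurable_from_subalg)
    then show ?thesis by (rule measurable_SUP_max_cdf_diff[OF _ law[OF n] p1[OF n]])
  qed
  have S_nonneg: "0 \<le> ?S n \<omega>" if n: "n \<ge> 1" and \<omega>: "\<omega> \<in> space (M n)" for n \<omega>
  proof -
    have "prob_space (\<kappa> n \<omega>)"
      by (rule regular_cond_distr_prob_space(1)[OF cond_law[OF n] space_vimage_algebra \<omega>])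
    then have "bdd_above (range (\<lambda>x. \<bar>max_cdf (p n) (\<kappa> n \<omega>) x - max_cdf (p n) (?law n) x\<bar>))"
      using max_cdf_diff_le_one[OF _ law(1)[OF n]] by (auto simp: bdd_above_def)
    then have "\<bar>max_cdf (p n) (\<kappa> n \<omega>) 0 - max_cdf (p n) (?law n) 0\<bar> \<le> ?S n \<omega>"
      by (intro cSUP_upper) auto
    then show ?thesis by linarith
  qed
  have "(\<lambda>n. measure (M n) {\<omega> \<in> space (M n). \<bar>?S n \<omega>\<bar> > \<epsilon>}) \<longlonglongrightarrow> 0" if \<epsilon>: "\<epsilon> > 0" for \<epsilon>
  proof -
    have sc: "0 < sqrt c\<^sub>1" "(sqrt c\<^sub>1)\<^sup>2 = c\<^sub>1" using c by auto
    obtain \<tau> where \<tau>: "0 < \<tau>" and close: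
      "\<And>p \<Sigma> \<mu> \<Sigma>' \<nu> \<Delta> x. \<lbrakk>centered_gaussian p \<Sigma> \<mu>; centered_gaussian p \<Sigma>' \<nu>; 2 \<le> p;
        \<And>j. j \<in> {1..p} \<Longrightarrow> c\<^sub>1 \<le> \<Sigma>' j j;
        \<And>j k. j \<in> {1..p} \<Longrightarrow> k \<in> {1..p} \<Longrightarrow> \<bar>\<Sigma> j k - \<Sigma>' j k\<bar> \<le> \<Delta>;
        \<Delta> * ln (real p) * (1 + (\<integral>y. max 0 (vec_max p y) \<partial>\<nu>))\<^sup>2 \<le> \<tau>\<rbrakk>
      \<Longrightarrow> \<bar>measure \<mu> {y \<in> space \<mu>. vec_max p y \<le> x} - measure \<nu> {y \<in> space \<nu>. vec_max p y \<le> x}\<bar> \<le> \<epsilon>"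
      using gaussian_max_comparison_uniform[OF sc(1) \<epsilon>] unfolding sc(2) by blast
    \<comment> \<open>Since \<open>1 + E max\<^sup>+ \<le> E max + D\<close>, the square is at most \<open>2 (E max)\<^sup>2 + 2 D\<^sup>2\<close>; the thresholds below
      give each of the two summands half of \<open>\<tau>\<close>.\<close>
    define D where "D = 2 + C\<^sub>1"
    have D: "0 < D" using c by (simp add: D_def)
    let ?ta = "\<tau> / 4" and ?tb = "\<tau> / (4 * D\<^sup>2)"
    have bound: "measure (M n) {\<omega> \<in> space (M n). \<bar>?S n \<omega>\<bar> > \<epsilon>}
        \<le> measure (M n) {\<omega> \<in> space (M n). \<bar>?a n \<omega>\<bar> > ?ta} + measure (M n) {\<omega> \<in> space (M n). \<bar>?b n \<omega>\<bar> > ?tb}"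
      if n: "n \<ge> 1" for n
    proof -
      interpret prob_space "M n" by (rule prob[OF n])
      note [measurable] = S_meas[OF n]
      have am: "?a n \<in> borel_measurable (M n)" and bm: "?b n \<in> borel_measurable (M n)"
        using Delta_max Delta_log n unfolding tendsto_0_in_prob_def by blast+
      note [measurable] = am bm
      let ?small = "\<lambda>\<omega>. ?a n \<omega> \<le> ?ta \<and> ?b n \<omega> \<le> ?tb"
      have lp: "0 < ln (real (p n))" using dim[OF n] by simp
      have avg: "c\<^sub>1 \<le> average_cov (M n) n (Z n) j j \<and> average_cov (M n) n (Z n) j j \<le> C\<^sub>1"
        if "j \<in> {1..p n}" for j
        using var_bounds[OF n that] by (simp add: average_cov_def power2_eq_square)
      define m where "m = (\<integral>y. max 0 (vec_max (p n) y) \<partial>?law n)"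
      have EV: "(\<integral>y. vec_max (p n) y \<partial>?law n) = ?EV n"
        by (rule integral_distr[OF T_meas[OF n] vm[OF n]])
      have m: "0 \<le> 1 + m" "1 + m \<le> ?EV n + D"
      proof -
        show "0 \<le> 1 + m" unfolding m_def by (intro add_nonneg_nonneg integral_nonneg_AE) auto
        show "1 + m \<le> ?EV n + D"
          using gaussian_max_positive_part_le[OF T_gauss[OF n] p1[OF n] conjunct2[OF avg]] p1[OF n]
          unfolding EV m_def D_def by simp
      qed
      have small: "?D n \<omega> * ln (real (p n)) * (1 + m)\<^sup>2 \<le> \<tau>" if s: "?small \<omega>" for \<omega>
      proof -
        have D0: "0 \<le> ?D n \<omega>"
          using empirical_covariance_diff_le_Delta_hat[of 1 "p n" 1 n "Z n" \<omega> "M n"] p1[OF n] by simp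
        have "(1 + m)\<^sup>2 \<le> (?EV n + D)\<^sup>2" using m by (intro power_mono)
        also have "\<dots> \<le> 2 * (?EV n)\<^sup>2 + 2 * D\<^sup>2"
          using zero_le_power2[of "?EV n - D"] by (simp add: power2_eq_square algebra_simps)
        finally have "?D n \<omega> * ln (real (p n)) * (1 + m)\<^sup>2 \<le> ?D n \<omega> * ln (real (p n)) * (2 * (?EV n)\<^sup>2 + 2 * D\<^sup>2)"
          using D0 lp by (intro mult_left_mono) auto
        also have "\<dots> = 2 * ?a n \<omega> + 2 * D\<^sup>2 * (?D n \<omega> * ln (real (p n)) * 1)"
          by (simp add: algebra_simps)
        also have "\<dots> \<le> 2 * ?ta + 2 * D\<^sup>2 * ?tb"
        proof (intro add_mono mult_left_mono)
          have "?D n \<omega> * ln (real (p n)) * 1 \<le> ?b n \<omega>"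
            using D0 lp by (intro mult_left_mono) auto
          then show "?D n \<omega> * ln (real (p n)) * 1 \<le> ?tb" using s by linarith
        qed (use s in auto)
        also have "\<dots> = \<tau>" using D by simp
        finally show ?thesis .
      qed
      have "AE \<omega> in M n. ?small \<omega> \<longrightarrow> ?S n \<omega> \<le> \<epsilon>"
      proof (rule cond_max_law_AE_close[OF Z_meas[OF n] \<eta>_indep[OF n] \<eta>_std[OF n] \<eta>_Z_indep[OF n] cond_law[OF n] law[OF n] p1[OF n]])
        fix \<omega> x assume \<omega>: "\<omega> \<in> space (M n)" and s: "?small \<omega>"
        let ?N = "distr (M n) (real_vec (p n)) (\<lambda>\<omega>'. multiplier_sum n (p n) (\<lambda>i. Z n i \<omega>) (\<lambda>i. \<eta> n i \<omega>'))"
        have G: "centered_gaussian (p n) (\<lambda>j k. (1 / real n) * (\<Sum>i=1..n. Z n i \<omega> j * Z n i \<omega> k)) ?N"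
          by (rule centered_gaussian_multiplier_sum[OF \<eta>_indep[OF n] \<eta>_std[OF n]])
        have "\<bar>measure ?N {y \<in> space ?N. vec_max (p n) y \<le> x} - measure (?law n) {y \<in> space (?law n). vec_max (p n) y \<le> x}\<bar> \<le> \<epsilon>"
          by (rule close[OF G T_gauss[OF n] dim[OF n] _ empirical_covariance_diff_le_Delta_hat small[OF s, unfolded m_def]])
             (use avg in auto)
        then show "\<bar>max_cdf (p n) ?N x - max_cdf (p n) (?law n) x\<bar> \<le> \<epsilon>" by simp
      qed
      then have "measure (M n) {\<omega> \<in> space (M n). \<bar>?S n \<omega>\<bar> > \<epsilon>}
          \<le> measure (M n) ({\<omega> \<in> space (M n). \<bar>?a n \<omega>\<bar> > ?ta} \<union> {\<omega> \<in> space (M n). \<bar>?b n \<omega>\<bar> > ?tb})"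
      proof (intro finite_measure_mono_AE, elim AE_mp, intro AE_I2 impI)
        fix \<omega> assume \<omega>: "\<omega> \<in> space (M n)" and i: "?small \<omega> \<longrightarrow> ?S n \<omega> \<le> \<epsilon>"
          and big: "\<omega> \<in> {\<omega> \<in> space (M n). \<bar>?S n \<omega>\<bar> > \<epsilon>}"
        have "\<not> ?small \<omega>" using big i S_nonneg[OF n \<omega>] by (auto simp: abs_of_nonneg)
        then show "\<omega> \<in> {\<omega> \<in> space (M n). \<bar>?a n \<omega>\<bar> > ?ta} \<union> {\<omega> \<in> space (M n). \<bar>?b n \<omega>\<bar> > ?tb}"
          using \<omega> by (auto simp: not_le)
      qed measurable
      also have "\<dots> \<le> measure (M n) {\<omega> \<in> space (M n). \<bar>?a n \<omega>\<bar> > ?ta} + measure (M n) {\<omega> \<in> space (M n). \<bar>?b n \<omega>\<bar> > ?tb}"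
        by (rule measure_Un_le) measurable
      finally show ?thesis .
    qed
    have "(\<lambda>n. measure (M n) {\<omega> \<in> space (M n). \<bar>?a n \<omega>\<bar> > ?ta} + measure (M n) {\<omega> \<in> space (M n). \<bar>?b n \<omega>\<bar> > ?tb}) \<longlonglongrightarrow> 0 + 0"
    proof (rule tendsto_add)
      show "(\<lambda>n. measure (M n) {\<omega> \<in> space (M n). \<bar>?a n \<omega>\<bar> > ?ta}) \<longlonglongrightarrow> 0"
        by (rule tendsto_0_in_probD[OF Delta_max]) (use \<tau> in simp)
      show "(\<lambda>n. measure (M n) {\<omega> \<in> space (M n). \<bar>?b n \<omega>\<bar> > ?tb}) \<longlonglongrightarrow> 0"
        by (rule tendsto_0_in_probD[OF Delta_log]) (use \<tau> D in simp)
    qed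
    then have lim: "(\<lambda>n. measure (M n) {\<omega> \<in> space (M n). \<bar>?a n \<omega>\<bar> > ?ta} + measure (M n) {\<omega> \<in> space (M n). \<bar>?b n \<omega>\<bar> > ?tb}) \<longlonglongrightarrow> 0"
      by simp
    show ?thesis
      by (rule tendsto_sandwich[OF _ _ tendsto_const lim])
         (simp, rule eventually_sequentiallyI[of 1], rule bound)
  qed
  then have S: "tendsto_0_in_prob M ?S"
    unfolding tendsto_0_in_prob_def using S_meas by blast
  show ?thesis
    by (rule tendsto_0_in_prob_cong[OF S]) (simp only: cdf_T)
qed

end
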